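(* Let $s,k\ge 0$ be integers and let $G=G(s,k)$ be a path-friendship graph with $s$ triangles and $k$ paths. If $H$ is a graph that is $L$-cospectral with $G$, then $H$ and $G$ have the same degree sequence.
   Context: All graphs are finite and simple. The Laplacian matrix of a graph is $L(G)=D(G)-A(G)$, where $A(G)$ is the adjacency matrix and $D(G)$ the diagonal matrix of vertex degrees. Two graphs are $L$-cospectral if their Laplacian matrices have the same multiset of eigenvalues. The friendship graph $F_s$ consists of $s$ triangles sharing exactly one common vertex (its center). A path-friendship graph $G(s,k)$ is obtained by taking $F_s$ and $k$ paths (each with at least one edge) and identifying the center of $F_s$ with one endpoint of each of the $k$ paths; so it consists of $s$ triangles and $k$ pendant paths all sharing one common vertex. (The notation $G(s,k)$ denotes any such graph; the path lengths are not specified.) *)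

theory Defs
  imports
    "Graph_Theory.Graph_Theory"
    "Jordan_Normal_Form.Char_Poly"
begin

text \<open>A finite simple graph is a \<open>pair_graph\<close>: a finite, loop-free, symmetric set of
  arcs, each undirected edge being the two arcs \<open>(u, v)\<close> and \<open>(v, u)\<close>. The degree of a
  vertex is therefore its \<open>out_degree\<close>.\<close>

definition degree_sequence :: "'a pair_pre_digraph \<Rightarrow> nat list" where
  "degree_sequence G =
     rev (sorted_list_of_multiset (image_mset (out_degree (with_proj G)) (mset_set (pverts G))))"


text \<open>Matrices are indexed by positions in a list \<open>vs\<close> enumerating the vertices.\<close>

definition vertex_enum :: "'a pair_pre_digraph \<Rightarrow> 'a list \<Rightarrow> bool" where
  "vertex_enum G vs \<longleftrightarrow> distinct vs \<and> set vs = pverts G"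

definition adjacency_matrix :: "'a pair_pre_digraph \<Rightarrow> 'a list \<Rightarrow> real mat" where
  "adjacency_matrix G vs =
     mat (length vs) (length vs) (\<lambda>(i, j). if (vs ! i, vs ! j) \<in> parcs G then 1 else 0)"

definition degree_matrix :: "'a pair_pre_digraph \<Rightarrow> 'a list \<Rightarrow> real mat" where
  "degree_matrix G vs =
     mat (length vs) (length vs)
       (\<lambda>(i, j). if i = j then real (out_degree (with_proj G) (vs ! i)) else 0)"

definition laplacian_matrix :: "'a pair_pre_digraph \<Rightarrow> 'a list \<Rightarrow> real mat" where
  "laplacian_matrix G vs = degree_matrix G vs - adjacency_matrix G vs"

definition eigenvalue_mset :: "real mat \<Rightarrow> complex multiset" where
  "eigenvalue_mset A = proots (char_poly (map_mat complex_of_real A))"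

text \<open>The choice of enumeration is immaterial, see \<open>laplacian_spectrum_eq\<close> below.\<close>

definition laplacian_spectrum :: "'a pair_pre_digraph \<Rightarrow> complex multiset" where
  "laplacian_spectrum G = eigenvalue_mset (laplacian_matrix G (SOME vs. vertex_enum G vs))"

definition L_cospectral :: "'a pair_pre_digraph \<Rightarrow> 'b pair_pre_digraph \<Rightarrow> bool" where
  "L_cospectral G H \<longleftrightarrow> laplacian_spectrum G = laplacian_spectrum H"

lemma det_permute_rows_cols:
  fixes A :: "'a :: comm_ring_1 mat"
  assumes A: "A \<in> carrier_mat n n" and p: "p permutes {0..<n}"
  shows "det (mat n n (\<lambda>(i, j). A $$ (p i, p j))) = det A"
proof -
  let ?B = "mat n n (\<lambda>(i, j). A $$ (i, p j))"
  have pn: "p i < n" if "i < n" for i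
    using permutes_in_image[OF p, of i] that by simp
  have "mat n n (\<lambda>(i, j). A $$ (p i, p j)) = mat n n (\<lambda>(i, j). ?B $$ (p i, j))"
    by (rule eq_matI) (auto simp: pn)
  then have 1: "det (mat n n (\<lambda>(i, j). A $$ (p i, p j))) = signof p * det ?B"
    using det_permute_rows[OF _ p, of ?B] by simp
  have "transpose_mat ?B = mat n n (\<lambda>(i, j). transpose_mat A $$ (p i, j))"
    by (rule eq_matI) (use A pn in auto)
  then have "det ?B = signof p * det A"
    using det_permute_rows[OF _ p, of "transpose_mat A"] A
    by (metis det_transpose mat_carrier transpose_carrier_mat)
  with 1 show ?thesis
    by (simp add: sign_def)
qed

lemma char_poly_laplacian_enum:
  assumes "vertex_enum G vs" "vertex_enum G ws"
  shows "char_poly (map_mat complex_of_real (laplacian_matrix G vs))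
       = char_poly (map_mat complex_of_real (laplacian_matrix G ws))"
proof -
  let ?n = "length vs"
  have "mset vs = mset ws"
    using assms set_eq_iff_mset_eq_distinct[of vs ws] by (simp add: vertex_enum_def)
  then obtain p where p: "p permutes {..<?n}" and perm: "permute_list p vs = ws"
    by (metis mset_eq_permutation mset_eq_length)
  from perm have len: "length ws = ?n" by auto
  have ws: "ws ! i = vs ! p i" if "i < ?n" for i
    using that p perm permute_list_nth by blast
  have pn: "p i < ?n" if "i < ?n" for i
    using permutes_in_image[OF p, of i] that by simp
  have pinj: "p i = p j \<longleftrightarrow> i = j" for i j
    using permutes_inj[OF p] by (auto dest: injD)
  let ?C = "char_poly_matrix (map_mat complex_of_real (laplacian_matrix G vs))"
  have C: "?C \<in> carrier_mat ?n ?n"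
    by (intro char_poly_matrix_closed)
       (auto simp: laplacian_matrix_def degree_matrix_def adjacency_matrix_def)
  have "char_poly_matrix (map_mat complex_of_real (laplacian_matrix G ws))
      = mat ?n ?n (\<lambda>(i, j). ?C $$ (p i, p j))"
    by (rule eq_matI)
       (auto simp: char_poly_matrix_def laplacian_matrix_def degree_matrix_def
          adjacency_matrix_def len ws pn pinj)
  then show ?thesis
    using det_permute_rows_cols[OF C, of p] p by (simp add: char_poly_def atLeast0LessThan)
qed

lemma laplacian_spectrum_eq:
  assumes "vertex_enum G vs"
  shows "laplacian_spectrum G = eigenvalue_mset (laplacian_matrix G vs)"
  using char_poly_laplacian_enum[OF someI[of "vertex_enum G", OF assms] assms]
  by (simp add: laplacian_spectrum_def eigenvalue_mset_def)


datatype pf_vertex = Center | Tri nat bool | Leg nat nat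

definition friendship_graph :: "nat \<Rightarrow> pf_vertex pair_pre_digraph" where
  "friendship_graph s =
     (let E = {(Center, Tri i b) | i b. i < s} \<union> {(Tri i False, Tri i True) | i. i < s}
      in \<lparr>pverts = insert Center {Tri i b | i b. i < s}, parcs = E \<union> E\<inverse>\<rparr>)"

text \<open>The \<open>j\<close>-th path has vertices \<open>leg_vertex j 0, \<dots>, leg_vertex j l\<close>; its endpoint
  \<open>leg_vertex j 0\<close> is identified with the center of the friendship graph.\<close>

definition leg_vertex :: "nat \<Rightarrow> nat \<Rightarrow> pf_vertex" where
  "leg_vertex j i = (if i = 0 then Center else Leg j i)"

definition pendant_path :: "nat \<Rightarrow> nat \<Rightarrow> pf_vertex pair_pre_digraph" where
  "pendant_path j l =
     (let E = {(leg_vertex j i, leg_vertex j (Suc i)) | i. i < l}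
      in \<lparr>pverts = leg_vertex j ` {0..l}, parcs = E \<union> E\<inverse>\<rparr>)"

text \<open>\<open>ls\<close> lists the numbers of edges of the paths.\<close>

definition path_friendship_graph :: "nat \<Rightarrow> nat list \<Rightarrow> pf_vertex pair_pre_digraph" where
  "path_friendship_graph s ls =
     \<lparr>pverts = pverts (friendship_graph s) \<union> (\<Union>j<length ls. pverts (pendant_path j (ls ! j))),
      parcs = parcs (friendship_graph s) \<union> (\<Union>j<length ls. parcs (pendant_path j (ls ! j)))\<rparr>"

definition is_path_friendship :: "nat \<Rightarrow> nat \<Rightarrow> 'a pair_pre_digraph \<Rightarrow> bool" where
  "is_path_friendship s k G \<longleftrightarrow>
     (\<exists>ls. length ls = k \<and> (\<forall>l \<in> set ls. 1 \<le> l) \<and>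
           digraph_iso (with_proj (path_friendship_graph s ls)) (with_proj G))"

lemma pair_graph_path_friendship_graph: "pair_graph (path_friendship_graph s ls)"
proof -
  let ?G = "path_friendship_graph s ls"
  have "finite {Tri i b | i b. i < s}"
    by (rule finite_subset[of _ "(\<lambda>(i, b). Tri i b) ` ({..<s} \<times> UNIV)"]) auto
  then have fv: "finite (pverts ?G)"
    by (auto simp: path_friendship_graph_def friendship_graph_def pendant_path_def Let_def)
  have wf: "u \<in> pverts ?G \<and> v \<in> pverts ?G" if "(u, v) \<in> parcs ?G" for u v
    using that
    by (fastforce simp: path_friendship_graph_def friendship_graph_def pendant_path_def Let_def)
  then have "parcs ?G \<subseteq> pverts ?G \<times> pverts ?G" by auto
  then have fa: "finite (parcs ?G)" using fv finite_subset by blast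
  have "sym (parcs ?G)"
    by (rule symI) (auto simp: path_friendship_graph_def friendship_graph_def pendant_path_def Let_def)
  moreover have "u \<noteq> v" if "(u, v) \<in> parcs ?G" for u v
    using that by (auto simp: path_friendship_graph_def friendship_graph_def pendant_path_def
        leg_vertex_def Let_def split: if_splits)
  ultimately show ?thesis
    using fv fa wf by unfold_locales (auto simp: symmetric_def)
qed

end

theory Submission
  imports Defs "Jordan_Normal_Form.Schur_Decomposition"
begin

text \<open>The Laplacian spectrum determines the number of vertices and, for the degrees \<open>d\<close> and the number
  \<open>t\<close> of triangles, the values \<open>\<Sum>d\<close>, \<open>\<Sum>d\<^sup>2\<close> and \<open>\<Sum>d\<^sup>3 - 6 t\<close>; it also tells whether the graph is
  connected. Let \<open>\<Delta> = 2 s + k\<close> be the degree of the center of \<open>G\<close>; its other vertices have degree 1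
  or 2. On vectors vanishing at the center the Laplacian form of \<open>G\<close> is less than \<open>4 \<bar>x\<bar>\<^sup>2\<close>, so at most
  one eigenvalue is at least 4, whereas two vertices of degree at least 4 in \<open>H\<close> would produce two such
  eigenvalues. Hence all vertices of \<open>H\<close> but one have degree 1, 2 or 3. Comparing \<open>\<Sum>(d - 1)(d - 2)\<close> and
  \<open>\<Sum>(d - 1)(d - 2)(d - 3) - 6 t\<close> shows that the maximum degree of \<open>H\<close> is \<open>\<Delta>\<close> and that the other degrees
  are 1 or 2, unless \<open>\<Delta> = 4\<close>, \<open>H\<close> has maximum degree 3 and \<open>s\<close> is 1 or 2.

  If \<open>s = 2\<close>, then \<open>G\<close> is the butterfly, whose largest eigenvalue equals its number 5 of vertices; this
  forces the complement of \<open>H\<close> to be disconnected, which its degrees exclude. If \<open>s = 1\<close>, then \<open>H\<close> has as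
  many edges as vertices, no triangles and three spanning trees. For a primitive integer vector \<open>z\<close> in
  the kernel of its incidence matrix, \<open>\<bar>z\<bar>\<^sup>2\<close> divides the number of spanning trees with a square as
  quotient, so \<open>\<bar>z\<bar>\<^sup>2 = 3\<close> and the three edges in the support of \<open>z\<close> form a triangle.\<close>

section \<open>Real symmetric matrices\<close>

text \<open>The polynomials \<open>(d - 1)(d - 2)\<close> and \<open>(d - 1)(d - 2)(d - 3)\<close>
  vanish at 1 and 2, so for G only the center counts; the second also vanishes at 3, so for H only
  the vertex of maximum degree counts. If that degree is below \<Delta>, the cubic sum drops by at
  least \<open>3 (\<Delta> - 2)(\<Delta> - 3)\<close>, and the triangles of G can make up for at
  most \<open>6 s \<le> 3 \<Delta>\<close> of it; hence \<open>\<Delta> \<le> 4\<close>.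

  These invariants cannot settle \<Delta> = 4: exchanging the degrees 4, 2, 2, 2 for 3, 3, 3, 1 and
  losing one triangle preserves all of them. The exception needs other spectral information. For s =
  2 this is the eigenvalue n, whose eigenvectors are constant on the components of the complement.
  For s = 1 it is the number of spanning trees, which for a connected graph with n vertices and n
  edges is the length of its only cycle; the divisibility argument extracts that cycle from
  determinants, without following walks in H.\<close>

lemma real_symmetric_eigenvalue:
  fixes A :: "real mat"
  assumes A: "A \<in> carrier_mat n n" and sym: "transpose_mat A = A" and n: "n \<noteq> 0"
  shows "\<exists>e. eigenvalue A e"
proof -
  let ?C = "map_mat complex_of_real A"
  have C: "?C \<in> carrier_mat n n" using A by simp
  have "degree (char_poly ?C) = n" using degree_monic_char_poly[OF C] by simp
  then have "\<not> constant (poly (char_poly ?C))" using n by (simp add: constant_degree)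
  then obtain l where l: "poly (char_poly ?C) l = 0"
    using fundamental_theorem_of_algebra by blast
  then obtain v where v: "v \<in> carrier_vec n" "v \<noteq> 0\<^sub>v n" and ev: "?C *\<^sub>v v = l \<cdot>\<^sub>v v"
    using C by (auto simp: eigenvalue_root_char_poly[OF C, symmetric] eigenvalue_def eigenvector_def)
  \<comment> \<open>Symmetry moves the real matrix to the other side of the Hermitian product, so
    \<open>l\<close> equals its own conjugate.\<close>
  have cC: "(?C *\<^sub>v v) \<bullet>c v = v \<bullet>c (?C *\<^sub>v v)"
  proof -
    have "(?C *\<^sub>v v) \<bullet>c v = (\<Sum>i<n. \<Sum>j<n. A $$ (i,j) * v $ j * cnj (v $ i))"
      using A v by (simp add: scalar_prod_def sum_distrib_right lessThan_atLeast0)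
    also have "\<dots> = (\<Sum>j<n. \<Sum>i<n. A $$ (i,j) * v $ j * cnj (v $ i))"
      by (rule sum.swap)
    also have "\<dots> = (\<Sum>j<n. \<Sum>i<n. A $$ (j,i) * v $ j * cnj (v $ i))"
    proof (intro sum.cong refl)
      fix i j assume "i \<in> {..<n}" "j \<in> {..<n}"
      then have "A $$ (i,j) = A $$ (j,i)"
        using A sym by (metis carrier_matD(1) carrier_matD(2) index_transpose_mat(1) lessThan_iff)
      then show "A $$ (i,j) * v $ j * cnj (v $ i) = A $$ (j,i) * v $ j * cnj (v $ i)" by simp
    qed
    also have "\<dots> = v \<bullet>c (?C *\<^sub>v v)"
      using A v by (simp add: scalar_prod_def sum_distrib_left lessThan_atLeast0 mult_ac)
    finally show ?thesis .
  qed
  have "l * (v \<bullet>c v) = cnj l * (v \<bullet>c v)"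
    using cC v unfolding ev by (simp add: conjugate_smult_vec)
  moreover have "v \<bullet>c v \<noteq> 0" using v conjugate_square_eq_0_vec by blast
  ultimately have "cnj l = l" by simp
  then have "l = complex_of_real (Re l)" by (simp add: complex_eq_iff)
  moreover have "char_poly ?C = map_poly complex_of_real (char_poly A)"
    using A by (rule of_real_hom.char_poly_hom)
  ultimately have "poly (char_poly A) (Re l) = 0"
    using l by (metis of_real_eq_0_iff of_real_hom.poly_map_poly)
  then show ?thesis using eigenvalue_root_char_poly[OF A] by blast
qed

text \<open>Gram-Schmidt keeps the head of the completed basis, so column 0 stays a multiple of
  \<open>v\<close>. As \<open>gram_schmidt\<close> only orthogonalizes, the columns still have to be
  normalized, which brings in \<open>c\<close>.\<close>

lemma orthonormal_completion:
  fixes v :: "real vec"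
  assumes v: "v \<in> carrier_vec n" and v0: "v \<noteq> 0\<^sub>v n"
  shows "\<exists>W c. W \<in> carrier_mat n n \<and> transpose_mat W * W = 1\<^sub>m n \<and> col W 0 = c \<cdot>\<^sub>v v \<and> c \<noteq> 0"
proof -
  interpret cof_vec_space n "TYPE(real)" .
  define b where "b = basis_completion v"
  define ws where "ws = gram_schmidt n b"
  from basis_completion[OF v v0, folded b_def]
  have dist_b: "distinct b" and indep: "\<not> lin_dep (set b)"
    and b: "set b \<subseteq> carrier_vec n" and hdb: "hd b = v" and len_b: "length b = n" by auto
  have n: "n \<noteq> 0" using v v0 by (cases n) auto
  from hdb len_b n obtain vs where bv: "b = v # vs" by (cases b, auto)
  from gram_schmidt_result[OF b dist_b indep refl, folded ws_def]
  have ws: "set ws \<subseteq> carrier_vec n" "corthogonal ws" "length ws = n" by (auto simp: len_b)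
  from gram_schmidt_hd[OF v, of vs, folded bv] have hdws: "hd ws = v" unfolding ws_def .
  define r where "r w = 1 / sqrt (w \<bullet> w)" for w :: "real vec"
  have ci: "ws ! i \<in> carrier_vec n" if "i < n" for i using ws that by auto
  have orth: "ws ! i \<bullet> ws ! j = 0 \<longleftrightarrow> i \<noteq> j" if "i < n" "j < n" for i j
    using corthogonalD[OF ws(2), of i j] that ws(3) by simp
  have pos: "ws ! i \<bullet> ws ! i > 0" if "i < n" for i
  proof -
    have "ws ! i \<bullet> ws ! i \<ge> 0" by (simp add: scalar_prod_def sum_nonneg)
    with orth[OF that that] show ?thesis by simp
  qed
  define W where "W = mat_of_cols n (map (\<lambda>w. r w \<cdot>\<^sub>v w) ws)"
  have W: "W \<in> carrier_mat n n" using ws by (auto simp: W_def)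
  have col: "col W i = r (ws ! i) \<cdot>\<^sub>v ws ! i" if "i < n" for i
    unfolding W_def using that ws ci by (subst col_mat_of_cols) auto
  have "transpose_mat W * W = 1\<^sub>m n"
  proof (rule eq_matI)
    fix i j assume ij: "i < dim_row (1\<^sub>m n :: real mat)" "j < dim_col (1\<^sub>m n :: real mat)"
    then have "(transpose_mat W * W) $$ (i,j) = col W i \<bullet> col W j"
      using W by simp
    also have "\<dots> = r (ws ! i) * r (ws ! j) * (ws ! i \<bullet> ws ! j)"
      using ij ci by (simp add: col smult_scalar_prod_distrib[of _ n] scalar_prod_smult_distrib[of _ n])
    also have "\<dots> = 1\<^sub>m n $$ (i,j)"
      using ij orth[of i j] pos[of i] by (auto simp: r_def)
    finally show "(transpose_mat W * W) $$ (i,j) = 1\<^sub>m n $$ (i,j)" .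
  qed (use W in auto)
  moreover have "ws ! 0 = v" using hdws ws(3) n by (metis hd_conv_nth list.size(3))
  ultimately show ?thesis using W col[of 0] pos[of 0] n
    by (intro exI[of _ W] exI[of _ "r v"]) (auto simp: r_def)
qed

text \<open>Deflation: in an orthonormal basis that starts with an eigenvector, column 0 of the
  matrix is zero below the corner, by symmetry so is row 0 beside it, and the induction hypothesis
  diagonalizes the remaining block.\<close>

lemma real_symmetric_diagonalization:
  fixes A :: "real mat"
  assumes "A \<in> carrier_mat n n" and "transpose_mat A = A"
  shows "\<exists>U D. U \<in> carrier_mat n n \<and> D \<in> carrier_mat n n \<and> transpose_mat U * U = 1\<^sub>m n \<and>
    diagonal_mat D \<and> A * U = U * D"
  using assms
proof (induction n arbitrary: A)
  case 0
  then show ?case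
    by (intro exI[of _ "1\<^sub>m 0"] exI[of _ A]) (auto simp: diagonal_mat_def)
next
  case (Suc n)
  note A = Suc.prems(1)
  obtain e v where v: "v \<in> carrier_vec (Suc n)" "v \<noteq> 0\<^sub>v (Suc n)" and ev: "A *\<^sub>v v = e \<cdot>\<^sub>v v"
    using real_symmetric_eigenvalue[OF Suc.prems] A by (auto simp: eigenvalue_def eigenvector_def)
  obtain W c where W: "W \<in> carrier_mat (Suc n) (Suc n)" and WW: "transpose_mat W * W = 1\<^sub>m (Suc n)"
    and col0: "col W 0 = c \<cdot>\<^sub>v v" using orthonormal_completion[OF v] by blast
  have WW': "W * transpose_mat W = 1\<^sub>m (Suc n)"
    using mat_mult_left_right_inverse[OF _ W WW] W by simp
  define A' where "A' = transpose_mat W * A * W"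
  have A': "A' \<in> carrier_mat (Suc n) (Suc n)" using A W by (simp add: A'_def)
  have symA': "transpose_mat A' = A'"
  proof -
    have "transpose_mat A' = transpose_mat W * transpose_mat (transpose_mat W * A)"
      unfolding A'_def using A W by (intro transpose_mult[of _ "Suc n" "Suc n" _ "Suc n"]) auto
    also have "transpose_mat (transpose_mat W * A) = A * W"
      using A W Suc.prems(2) by (simp add: transpose_mult[of _ "Suc n" "Suc n"])
    also have "transpose_mat W * (A * W) = A'" unfolding A'_def using A W by (simp add: assoc_mult_mat[of _ "Suc n" "Suc n"])
    finally show ?thesis .
  qed
  have WA': "A * W = W * A'"
  proof -
    have "W * A' = W * transpose_mat W * (A * W)"
      using A W assoc_mult_mat[of W "Suc n" "Suc n" "transpose_mat W" "Suc n" "A * W" "Suc n"]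
      by (simp add: A'_def assoc_mult_mat[of _ "Suc n" "Suc n"])
    then show ?thesis using A W by (simp add: WW')
  qed
  have colA': "A' $$ (i, 0) = (if i = 0 then e else 0)" if "i < Suc n" for i
  proof -
    have "A' = transpose_mat W * (A * W)" using A W by (simp add: A'_def assoc_mult_mat[of _ "Suc n" "Suc n"])
    then have "A' $$ (i, 0) = col W i \<bullet> (A *\<^sub>v col W 0)"
      using that A W by (simp add: mult_mat_vec_def scalar_prod_def)
    also have "A *\<^sub>v col W 0 = e \<cdot>\<^sub>v col W 0"
      using A v ev by (simp add: col0 mult_mat_vec smult_smult_assoc mult.commute)
    also have "col W i \<bullet> (e \<cdot>\<^sub>v col W 0) = e * (col W i \<bullet> col W 0)"
      using W that by (intro scalar_prod_smult_distrib[of _ "Suc n"]) (auto intro: col_carrier_vec)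
    also have "col W i \<bullet> col W 0 = (transpose_mat W * W) $$ (i,0)" using W that by simp
    finally show ?thesis using that unfolding WW by simp
  qed
  have rowA': "A' $$ (0, i) = (if i = 0 then e else 0)" if "i < Suc n" for i
    using colA'[OF that] symA' A' that by (metis carrier_matD(1) carrier_matD(2) index_transpose_mat(1) zero_less_Suc)
  define B where "B = mat n n (\<lambda>(i,j). A' $$ (Suc i, Suc j))"
  have B: "B \<in> carrier_mat n n" by (simp add: B_def)
  have "transpose_mat B = B"
  proof (rule eq_matI)
    fix i j assume "i < dim_row B" "j < dim_col B"
    then show "transpose_mat B $$ (i,j) = B $$ (i,j)"
      using symA' A' by (simp add: B_def) (metis Suc_mono carrier_matD(1) carrier_matD(2) index_transpose_mat(1))
  qed (auto simp: B_def)
  then obtain P D where P: "P \<in> carrier_mat n n" and D: "D \<in> carrier_mat n n"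
    and PP: "transpose_mat P * P = 1\<^sub>m n" and dD: "diagonal_mat D" and BP: "B * P = P * D"
    using Suc.IH[OF B] by blast
  define E where "E = mat 1 1 (\<lambda>_. e)"
  have E: "E \<in> carrier_mat 1 1" by (simp add: E_def)
  let ?z = "0\<^sub>m 1 n :: real mat" and ?z' = "0\<^sub>m n 1 :: real mat"
  have A'b: "A' = four_block_mat E ?z ?z' B"
    by (rule eq_matI) (use A' colA' rowA' in \<open>auto simp: E_def B_def\<close>)
  define Q where "Q = four_block_mat (1\<^sub>m 1) ?z ?z' P"
  define F where "F = four_block_mat E ?z ?z' D"
  have Q: "Q \<in> carrier_mat (Suc n) (Suc n)" and F: "F \<in> carrier_mat (Suc n) (Suc n)"
    using P D E by (auto simp: Q_def F_def)
  have A'Q: "A' * Q = Q * F"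
    unfolding A'b Q_def F_def using P D E B BP
    by (simp add: mult_four_block_mat[where ?nr1.0 = 1 and ?n1.0 = 1 and ?n2.0 = n and ?nr2.0 = n and ?nc1.0 = 1 and ?nc2.0 = n] del: One_nat_def)
  have QQ: "transpose_mat Q * Q = 1\<^sub>m (Suc n)"
    unfolding Q_def using P PP
    by (simp add: transpose_four_block_mat[where ?nr1.0 = 1 and ?nc1.0 = 1 and ?nr2.0 = n and ?nc2.0 = n]
      mult_four_block_mat[where ?nr1.0 = 1 and ?n1.0 = 1 and ?n2.0 = n and ?nr2.0 = n and ?nc1.0 = 1 and ?nc2.0 = n] plus_1_eq_Suc del: One_nat_def)
  have dF: "diagonal_mat F"
    using dD D E by (auto simp: diagonal_mat_def F_def)
  have "transpose_mat (W * Q) * (W * Q) = transpose_mat Q * ((transpose_mat W * W) * Q)"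
    using W Q by (simp add: transpose_mult[of _ "Suc n" "Suc n"] assoc_mult_mat[of _ "Suc n" "Suc n" _ "Suc n" _ "Suc n"])
  then have "transpose_mat (W * Q) * (W * Q) = 1\<^sub>m (Suc n)" using Q QQ by (simp add: WW)
  moreover have "A * (W * Q) = (W * Q) * F"
  proof -
    have "A * (W * Q) = (A * W) * Q" using A W Q by simp
    also have "\<dots> = W * (A' * Q)" unfolding WA' using W A' Q by simp
    also have "\<dots> = (W * Q) * F" unfolding A'Q using W F Q by simp
    finally show ?thesis .
  qed
  ultimately show ?case using W Q F dF by (intro exI[of _ "W * Q"] exI[of _ F]) auto
qed

section \<open>Expansion in an orthonormal eigenbasis\<close>

text \<open>The diagonalization \<open>A = U D U^T\<close>, with the columns of \<open>U\<close>
  read as functions on the vertex set, so that the graph arguments are free of enumerations.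
  \<open>orth\<close> and \<open>complete\<close> are \<open>U^T U = 1\<close> and
  \<open>U U^T = 1\<close>.\<close>

locale eigenbasis =
  fixes V :: "'a set" and n :: nat and A :: "'a \<Rightarrow> 'a \<Rightarrow> real"
    and mu :: "nat \<Rightarrow> real" and e :: "nat \<Rightarrow> 'a \<Rightarrow> real"
  assumes fin: "finite V"
    and orth: "\<And>i j. i < n \<Longrightarrow> j < n \<Longrightarrow> (\<Sum>v\<in>V. e i v * e j v) = of_bool (i = j)"
    and complete: "\<And>u v. u \<in> V \<Longrightarrow> v \<in> V \<Longrightarrow> (\<Sum>i<n. e i u * e i v) = of_bool (u = v)"
    and decomp: "\<And>u v. u \<in> V \<Longrightarrow> v \<in> V \<Longrightarrow> A u v = (\<Sum>i<n. mu i * e i u * e i v)"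
begin

definition coord :: "('a \<Rightarrow> real) \<Rightarrow> nat \<Rightarrow> real" where
  "coord x i = (\<Sum>v\<in>V. e i v * x v)"

text \<open>Two matrices with the same eigenvectors are multiplied eigenvalue by eigenvalue.
  Independent coefficients \<open>a\<close> and \<open>b\<close> allow a second use, with
  \<open>mu\<close> and \<open>mu^2\<close>, for the cube of \<open>A\<close>.\<close>

lemma sum_product_decomp:
  "(\<Sum>v\<in>V. (\<Sum>i<n. a i * e i u * e i v) * (\<Sum>j<n. b j * e j v * e j w))
    = (\<Sum>i<n. (a i * b i) * e i u * e i w)"
proof -
  have "(\<Sum>v\<in>V. (\<Sum>i<n. a i * e i u * e i v) * (\<Sum>j<n. b j * e j v * e j w))
      = (\<Sum>v\<in>V. \<Sum>i<n. \<Sum>j<n. a i * e i u * (b j * e j w) * (e i v * e j v))"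
    by (simp add: sum_product mult_ac)
  also have "\<dots> = (\<Sum>i<n. \<Sum>j<n. \<Sum>v\<in>V. a i * e i u * (b j * e j w) * (e i v * e j v))"
    by (subst sum.swap) (intro sum.cong refl sum.swap)
  also have "\<dots> = (\<Sum>i<n. \<Sum>j<n. a i * e i u * (b j * e j w) * of_bool (i = j))"
    by (intro sum.cong refl) (simp add: sum_distrib_left[symmetric] orth)
  also have "\<dots> = (\<Sum>i<n. (a i * b i) * e i u * e i w)"
    by (intro sum.cong refl) (simp add: mult_ac of_bool_def if_distrib cong: if_cong)
  finally show ?thesis .
qed

lemma sum_diag_decomp: "(\<Sum>v\<in>V. \<Sum>i<n. a i * e i v * e i v) = (\<Sum>i<n. a i)"
proof -
  have "(\<Sum>v\<in>V. \<Sum>i<n. a i * e i v * e i v) = (\<Sum>i<n. a i * (\<Sum>v\<in>V. e i v * e i v))"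
    by (subst sum.swap) (simp add: sum_distrib_left mult_ac)
  then show ?thesis by (simp add: orth)
qed

lemma trace1: "(\<Sum>i<n. mu i) = (\<Sum>v\<in>V. A v v)"
  using sum_diag_decomp[of mu] by (simp add: decomp)

lemma decomp2:
  assumes "u \<in> V" "w \<in> V"
  shows "(\<Sum>v\<in>V. A u v * A v w) = (\<Sum>i<n. (mu i)\<^sup>2 * e i u * e i w)"
  using sum_product_decomp[of mu u mu w] assms by (simp add: decomp power2_eq_square)

lemma trace2: "(\<Sum>i<n. (mu i)\<^sup>2) = (\<Sum>u\<in>V. \<Sum>v\<in>V. A u v * A v u)"
  using sum_diag_decomp[of "\<lambda>i. (mu i)\<^sup>2"] by (simp add: decomp2)

lemma trace3: "(\<Sum>i<n. (mu i)^3) = (\<Sum>u\<in>V. \<Sum>v\<in>V. \<Sum>w\<in>V. A u v * A v w * A w u)"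
proof -
  have "(\<Sum>v\<in>V. \<Sum>w\<in>V. A u v * A v w * A w u) = (\<Sum>i<n. (mu i)^3 * e i u * e i u)" if "u \<in> V" for u
  proof -
    have "(\<Sum>v\<in>V. \<Sum>w\<in>V. A u v * A v w * A w u) = (\<Sum>v\<in>V. A u v * (\<Sum>w\<in>V. A v w * A w u))"
      by (simp add: sum_distrib_left mult_ac)
    also have "\<dots> = (\<Sum>v\<in>V. (\<Sum>i<n. mu i * e i u * e i v) * (\<Sum>i<n. (mu i)\<^sup>2 * e i v * e i u))"
      using that by (intro sum.cong refl) (simp add: decomp2[symmetric] decomp[symmetric])
    also have "\<dots> = (\<Sum>i<n. (mu i)^3 * e i u * e i u)"
      by (simp only: sum_product_decomp) (simp add: power3_eq_cube power2_eq_square mult.assoc)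
    finally show ?thesis .
  qed
  then show ?thesis using sum_diag_decomp[of "\<lambda>i. (mu i)^3"] by simp
qed

lemma form_coord: "(\<Sum>u\<in>V. \<Sum>v\<in>V. x u * A u v * x v) = (\<Sum>i<n. mu i * (coord x i)\<^sup>2)"
proof -
  have "(\<Sum>u\<in>V. \<Sum>v\<in>V. x u * A u v * x v) = (\<Sum>u\<in>V. \<Sum>v\<in>V. \<Sum>i<n. mu i * ((e i u * x u) * (e i v * x v)))"
    by (intro sum.cong refl) (simp add: decomp sum_distrib_left sum_distrib_right mult_ac)
  also have "\<dots> = (\<Sum>u\<in>V. \<Sum>i<n. \<Sum>v\<in>V. mu i * ((e i u * x u) * (e i v * x v)))"
    by (intro sum.cong refl sum.swap)
  also have "\<dots> = (\<Sum>i<n. \<Sum>u\<in>V. \<Sum>v\<in>V. mu i * ((e i u * x u) * (e i v * x v)))"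
    by (rule sum.swap)
  also have "\<dots> = (\<Sum>i<n. mu i * (coord x i)\<^sup>2)"
    by (simp add: coord_def power2_eq_square sum_product sum_distrib_left[symmetric])
  finally show ?thesis .
qed

lemma parseval: "(\<Sum>v\<in>V. (x v)\<^sup>2) = (\<Sum>i<n. (coord x i)\<^sup>2)"
proof -
  have "(\<Sum>v\<in>V. (x v)\<^sup>2) = (\<Sum>u\<in>V. \<Sum>v\<in>V. x u * of_bool (u = v) * x v)"
    using fin by (intro sum.cong refl) (simp add: power2_eq_square of_bool_def if_distrib if_distribR cong: if_cong)
  also have "\<dots> = (\<Sum>u\<in>V. \<Sum>v\<in>V. \<Sum>i<n. (e i u * x u) * (e i v * x v))"
    by (intro sum.cong refl) (simp add: complete[symmetric] sum_distrib_left sum_distrib_right mult_ac)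
  also have "\<dots> = (\<Sum>u\<in>V. \<Sum>i<n. \<Sum>v\<in>V. (e i u * x u) * (e i v * x v))"
    by (intro sum.cong refl sum.swap)
  also have "\<dots> = (\<Sum>i<n. \<Sum>u\<in>V. \<Sum>v\<in>V. (e i u * x u) * (e i v * x v))"
    by (rule sum.swap)
  also have "\<dots> = (\<Sum>i<n. (coord x i)\<^sup>2)"
    by (simp add: coord_def power2_eq_square sum_product)
  finally show ?thesis .
qed

lemma coord_combination: "coord (\<lambda>v. a * x v + b * y v) i = a * coord x i + b * coord y i"
  by (simp add: coord_def sum.distrib sum_distrib_left algebra_simps)

lemma coord_basis: "i < n \<Longrightarrow> j < n \<Longrightarrow> coord (e j) i = of_bool (i = j)"
  by (simp add: coord_def orth)

lemma eigenvector:
  assumes i: "i < n" and u: "u \<in> V"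
  shows "(\<Sum>v\<in>V. A u v * e i v) = mu i * e i u"
proof -
  have "(\<Sum>v\<in>V. A u v * e i v) = (\<Sum>v\<in>V. \<Sum>j<n. mu j * e j u * (e j v * e i v))"
    using u by (simp add: decomp sum_distrib_right mult.assoc)
  also have "\<dots> = (\<Sum>j<n. \<Sum>v\<in>V. mu j * e j u * (e j v * e i v))" by (rule sum.swap)
  also have "\<dots> = (\<Sum>j<n. mu j * e j u * of_bool (j = i))"
    using i by (simp add: sum_distrib_left[symmetric] orth)
  finally show ?thesis using i by (simp add: of_bool_def if_distrib cong: if_cong)
qed

text \<open>An eigenvector for a value missing from the list is orthogonal to every
  \<open>e i\<close>, hence zero by \<open>parseval\<close>.\<close>

lemma eigenvalue_in_basis:
  assumes x: "\<And>u. u \<in> V \<Longrightarrow> (\<Sum>v\<in>V. A u v * x v) = t * x u" and ne: "\<exists>v\<in>V. x v \<noteq> 0"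
  shows "\<exists>i<n. mu i = t"
proof (rule ccontr)
  assume no: "\<not> ?thesis"
  have sym: "A u v = A v u" if "u \<in> V" "v \<in> V" for u v using that by (simp add: decomp mult_ac)
  have "coord x i = 0" if i: "i < n" for i
  proof -
    have "t * coord x i = (\<Sum>u\<in>V. e i u * (t * x u))"
      by (simp add: coord_def sum_distrib_left mult.left_commute)
    also have "\<dots> = (\<Sum>u\<in>V. e i u * (\<Sum>v\<in>V. A u v * x v))" by (simp add: x)
    also have "\<dots> = (\<Sum>u\<in>V. \<Sum>v\<in>V. x v * (A v u * e i u))"
      unfolding sum_distrib_left by (intro sum.cong refl) (metis sym mult.assoc mult.commute)
    also have "\<dots> = (\<Sum>v\<in>V. x v * (\<Sum>u\<in>V. A v u * e i u))"
      by (subst sum.swap) (simp add: sum_distrib_left)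
    also have "\<dots> = mu i * coord x i"
      using i by (simp add: coord_def sum_distrib_left eigenvector mult_ac)
    finally show ?thesis using no i by auto
  qed
  then have "(\<Sum>v\<in>V. (x v)\<^sup>2) = 0" by (simp add: parseval)
  then have "\<forall>v\<in>V. x v = 0" using fin by (simp add: sum_nonneg_eq_0_iff)
  with ne show False by blast
qed

text \<open>The sign \<open>\<sigma>\<close> lets the two counting lemmas serve both ends of the spectrum.\<close>

lemma card_eigenvalues_le_1:
  assumes *: "\<And>x. x r = 0 \<Longrightarrow> \<exists>v\<in>V. x v \<noteq> 0 \<Longrightarrow>
    \<sigma> * (\<Sum>u\<in>V. \<Sum>v\<in>V. x u * A u v * x v) < t * (\<Sum>v\<in>V. (x v)\<^sup>2)"
  shows "card {i. i < n \<and> t \<le> \<sigma> * mu i} \<le> 1"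
proof -
  have False if ij: "i < n" "j < n" "t \<le> \<sigma> * mu i" "t \<le> \<sigma> * mu j" "i \<noteq> j" for i j
  proof -
    \<comment> \<open>A plane meets a hyperplane: some nonzero combination of the two eigenvectors
      vanishes at \<open>r\<close>, but its form is too large for the hypothesis.\<close>
    obtain a b where ab: "a \<noteq> 0 \<or> b \<noteq> 0" "a * e i r + b * e j r = 0"
    proof (cases "e i r = 0")
      case True then show ?thesis using that[of 1 0] by simp
    next
      case False then show ?thesis using that[of "e j r" "- e i r"] by simp
    qed
    define x where "x = (\<lambda>v. a * e i v + b * e j v)"
    have c: "coord x k = a * of_bool (k = i) + b * of_bool (k = j)" if "k < n" for k
      using that ij by (simp add: x_def coord_combination coord_basis)
    have sm: "(\<Sum>k<n. f k * (coord x k)\<^sup>2) = f i * a\<^sup>2 + f j * b\<^sup>2" for f :: "nat \<Rightarrow> real"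
    proof -
      have "(\<Sum>k<n. f k * (coord x k)\<^sup>2) = (\<Sum>k<n. (if k = i then f i * a\<^sup>2 else 0) + (if k = j then f j * b\<^sup>2 else 0))"
        using ij by (intro sum.cong refl) (auto simp: c)
      then show ?thesis using ij by (simp add: sum.distrib)
    qed
    have nrm: "(\<Sum>v\<in>V. (x v)\<^sup>2) = a\<^sup>2 + b\<^sup>2" using sm[of "\<lambda>_. 1"] by (simp add: parseval)
    have "a\<^sup>2 + b\<^sup>2 > 0" using ab by (simp add: sum_power2_gt_zero_iff)
    then have "\<exists>v\<in>V. x v \<noteq> 0" using nrm by (metis (mono_tags, lifting) less_irrefl power_zero_numeral sum.neutral)
    then have "\<sigma> * (mu i * a\<^sup>2 + mu j * b\<^sup>2) < t * (a\<^sup>2 + b\<^sup>2)"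
      using *[of x] ab sm[of mu] nrm by (simp add: x_def form_coord)
    moreover have "t * a\<^sup>2 \<le> \<sigma> * mu i * a\<^sup>2" "t * b\<^sup>2 \<le> \<sigma> * mu j * b\<^sup>2"
      using ij by (auto intro: mult_right_mono)
    ultimately show False by (simp add: algebra_simps)
  qed
  then show ?thesis by (subst One_nat_def, subst card_le_Suc0_iff_eq) auto
qed

text \<open>If at most one eigenvalue reached \<open>t\<close>, the plane spanned by
  \<open>x\<close> and \<open>y\<close> would contain a nonzero vector orthogonal to its
  eigenvector, and the form of that vector would lie strictly below \<open>t\<close> times the
  squared norm. The first half of the hypothesis says that \<open>x\<close> and \<open>y\<close> are
  independent on \<open>V\<close>.\<close>

lemma card_eigenvalues_ge_2:
  assumes *: "\<And>a b. a \<noteq> 0 \<or> b \<noteq> 0 \<Longrightarrow> (\<exists>v\<in>V. a * x v + b * y v \<noteq> 0) \<and>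
    t * (\<Sum>v\<in>V. (a * x v + b * y v)\<^sup>2) \<le>
    \<sigma> * (\<Sum>u\<in>V. \<Sum>v\<in>V. (a * x u + b * y u) * A u v * (a * x v + b * y v))"
  shows "card {i. i < n \<and> t \<le> \<sigma> * mu i} \<ge> 2"
proof (rule ccontr)
  assume "\<not> ?thesis"
  then have "card {i. i < n \<and> t \<le> \<sigma> * mu i} \<le> Suc 0" by simp
  then have "\<forall>i\<in>{i. i < n \<and> t \<le> \<sigma> * mu i}. \<forall>j\<in>{i. i < n \<and> t \<le> \<sigma> * mu i}. i = j"
    by (subst (asm) card_le_Suc0_iff_eq) auto
  \<comment> \<open>If no eigenvalue reaches \<open>t\<close>, any \<open>k\<close> serves.\<close>
  then obtain k where k: "\<And>i. i < n \<Longrightarrow> i \<noteq> k \<Longrightarrow> \<sigma> * mu i < t"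
    by (metis (no_types, lifting) linorder_not_less mem_Collect_eq)
  obtain a b where ab: "a \<noteq> 0 \<or> b \<noteq> 0" "a * coord x k + b * coord y k = 0"
  proof (cases "coord x k = 0")
    case True then show ?thesis using that[of 1 0] by simp
  next
    case False then show ?thesis using that[of "coord y k" "- coord x k"] by simp
  qed
  define z where "z = (\<lambda>v. a * x v + b * y v)"
  have zk: "coord z k = 0" using ab by (simp add: z_def coord_combination)
  from *[OF ab(1)] obtain v where v: "v \<in> V" "z v \<noteq> 0"
    and le: "t * (\<Sum>v\<in>V. (z v)\<^sup>2) \<le> \<sigma> * (\<Sum>u\<in>V. \<Sum>v\<in>V. z u * A u v * z v)"
    by (auto simp: z_def)
  have "0 < (\<Sum>v\<in>V. (z v)\<^sup>2)" using v fin by (intro sum_pos2[of _ v]) auto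
  then have "(\<Sum>i<n. (coord z i)\<^sup>2) \<noteq> 0" by (simp add: parseval)
  then obtain i where i: "i < n" "coord z i \<noteq> 0"
    by (metis (mono_tags, lifting) lessThan_iff power_zero_numeral sum.neutral)
  have "(\<Sum>i<n. (\<sigma> * mu i) * (coord z i)\<^sup>2) < (\<Sum>i<n. t * (coord z i)\<^sup>2)"
  proof (rule sum_strict_mono_ex1)
    show "\<forall>i\<in>{..<n}. \<sigma> * mu i * (coord z i)\<^sup>2 \<le> t * (coord z i)\<^sup>2"
      using k zk by (metis lessThan_iff less_eq_real_def mult_right_mono mult_zero_right power_zero_numeral zero_le_power2)
    have "\<sigma> * mu i < t" using k[of i] i zk by auto
    then show "\<exists>i\<in>{..<n}. \<sigma> * mu i * (coord z i)\<^sup>2 < t * (coord z i)\<^sup>2" using i by (intro bexI[of _ i]) auto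
  qed simp
  with le show False unfolding form_coord parseval by (simp add: sum_distrib_left mult.assoc)
qed

end

section \<open>The Laplacian of a graph\<close>

abbreviation deg :: "'a pair_pre_digraph \<Rightarrow> 'a \<Rightarrow> nat" where
  "deg G \<equiv> out_degree (with_proj G)"

definition lap :: "'a pair_pre_digraph \<Rightarrow> 'a \<Rightarrow> 'a \<Rightarrow> real" where
  "lap G u v = (if u = v then real (deg G u) else 0) - of_bool ((u, v) \<in> parcs G)"

text \<open>Ordered triples: every triangle is counted six times.\<close>

definition triangles :: "'a pair_pre_digraph \<Rightarrow> ('a \<times> 'a \<times> 'a) set" where
  "triangles G = {(u, v, w). (u, v) \<in> parcs G \<and> (v, w) \<in> parcs G \<and> (w, u) \<in> parcs G}"

lemma pair_graphD:
  assumes "pair_graph G"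
  shows "finite (pverts G)" "finite (parcs G)" "(u, v) \<in> parcs G \<Longrightarrow> u \<in> pverts G"
    "(u, v) \<in> parcs G \<Longrightarrow> v \<in> pverts G" "(u, v) \<in> parcs G \<longleftrightarrow> (v, u) \<in> parcs G" "(u, u) \<notin> parcs G"
proof -
  interpret pair_graph G by fact
  show "finite (pverts G)" "finite (parcs G)" by auto
  show "(u, v) \<in> parcs G \<Longrightarrow> u \<in> pverts G" "(u, v) \<in> parcs G \<Longrightarrow> v \<in> pverts G"
    using in_arcsD1 in_arcsD2 by auto
  show "(u, v) \<in> parcs G \<longleftrightarrow> (v, u) \<in> parcs G" using arcs_symmetric by blast
  show "(u, u) \<notin> parcs G" using no_loops by fastforce
qed

lemma deg_eq_card: "deg G v = card {w. (v, w) \<in> parcs G}"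
proof -
  have "out_arcs (with_proj G) v = Pair v ` {w. (v, w) \<in> parcs G}"
    by (auto simp: out_arcs_def)
  then show ?thesis by (simp add: out_degree_def card_image inj_on_def)
qed

lemma sum_parcs:
  fixes f :: "'a \<Rightarrow> 'a \<Rightarrow> real"
  assumes "pair_graph G"
  shows "(\<Sum>(u, v)\<in>parcs G. f u v) = (\<Sum>u\<in>pverts G. \<Sum>v\<in>pverts G. of_bool ((u, v) \<in> parcs G) * f u v)"
proof -
  note G = pair_graphD[OF assms]
  have "(\<Sum>(u, v)\<in>parcs G. f u v) = (\<Sum>(u, v)\<in>pverts G \<times> pverts G. of_bool ((u, v) \<in> parcs G) * f u v)"
    using G by (intro sum.mono_neutral_cong_left) auto
  then show ?thesis by (simp add: sum.cartesian_product)
qed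

lemma sum_adjacent:
  assumes "pair_graph G"
  shows "(\<Sum>v\<in>pverts G. of_bool ((u, v) \<in> parcs G)) = real (deg G u)"
proof -
  note G = pair_graphD[OF assms]
  have "pverts G \<inter> {v. (u, v) \<in> parcs G} = {v. (u, v) \<in> parcs G}" using G by auto
  then show ?thesis using G by (simp add: sum_of_bool_eq deg_eq_card)
qed

lemma lap_sym: "pair_graph G \<Longrightarrow> lap G u v = lap G v u"
  using pair_graphD(5)[of G] by (simp add: lap_def)

lemma sum_lap_mult:
  assumes "pair_graph G" "u \<in> pverts G"
  shows "(\<Sum>v\<in>pverts G. lap G u v * x v) = (\<Sum>v | (u, v) \<in> parcs G. x u - x v)"
proof -
  note G = pair_graphD[OF assms(1)]
  have "(\<Sum>v\<in>pverts G. lap G u v * x v) = real (deg G u) * x u - (\<Sum>v\<in>pverts G. of_bool ((u, v) \<in> parcs G) * x v)"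
  proof -
    have "lap G u v * x v = (if u = v then real (deg G u) * x u else 0) - of_bool ((u, v) \<in> parcs G) * x v" for v
      by (simp add: lap_def left_diff_distrib)
    then show ?thesis using G assms(2) by (simp add: sum_subtractf)
  qed
  also have "(\<Sum>v\<in>pverts G. of_bool ((u, v) \<in> parcs G) * x v) = (\<Sum>v | (u, v) \<in> parcs G. x v)"
    using G by (intro sum.mono_neutral_cong_right) auto
  finally show ?thesis by (simp add: sum_subtractf deg_eq_card)
qed

lemma lap_form:
  assumes "pair_graph G"
  shows "2 * (\<Sum>u\<in>pverts G. \<Sum>v\<in>pverts G. x u * lap G u v * x v) = (\<Sum>(u, v)\<in>parcs G. (x u - x v)\<^sup>2)"
proof -
  note G = pair_graphD[OF assms]
  let ?V = "pverts G" and ?a = "\<lambda>u v. of_bool ((u, v) \<in> parcs G) :: real"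
  have d: "(\<Sum>u\<in>?V. \<Sum>v\<in>?V. ?a u v * (x u)\<^sup>2) = (\<Sum>u\<in>?V. real (deg G u) * (x u)\<^sup>2)"
    by (simp add: sum_distrib_right[symmetric] sum_adjacent[OF assms])
  have d': "(\<Sum>u\<in>?V. \<Sum>v\<in>?V. ?a u v * (x v)\<^sup>2) = (\<Sum>u\<in>?V. real (deg G u) * (x u)\<^sup>2)"
    by (subst sum.swap) (simp add: G(5)[of _ "_ :: 'a"] d[symmetric])
  have "(\<Sum>(u, v)\<in>parcs G. (x u - x v)\<^sup>2)
      = (\<Sum>u\<in>?V. \<Sum>v\<in>?V. ?a u v * (x u)\<^sup>2 + ?a u v * (x v)\<^sup>2 - 2 * (x u * ?a u v * x v))"
    by (simp add: sum_parcs[OF assms] power2_diff algebra_simps)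
  also have "\<dots> = 2 * (\<Sum>u\<in>?V. real (deg G u) * (x u)\<^sup>2) - 2 * (\<Sum>u\<in>?V. \<Sum>v\<in>?V. x u * ?a u v * x v)"
    by (simp add: sum.distrib sum_subtractf d d' sum_distrib_left[symmetric])
  also have "\<dots> = 2 * (\<Sum>u\<in>?V. \<Sum>v\<in>?V. x u * lap G u v * x v)"
  proof -
    have "x u * lap G u v * x v = (if u = v then real (deg G u) * (x u)\<^sup>2 else 0) - x u * ?a u v * x v" for u v
      by (simp add: lap_def algebra_simps power2_eq_square)
    then show ?thesis using G by (simp add: sum_subtractf)
  qed
  finally show ?thesis by simp
qed

text \<open>Laplacian plus signless Laplacian is twice the degree matrix, and sums over arcs count
  every edge twice, whence the factor 4. The identity turns a bound on degrees into one on the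
  Laplacian form and shows when it is strict.\<close>

lemma lap_form_parallelogram:
  assumes "pair_graph G"
  shows "(\<Sum>(u, v)\<in>parcs G. (x u - x v)\<^sup>2) + (\<Sum>(u, v)\<in>parcs G. (x u + x v)\<^sup>2)
    = 4 * (\<Sum>u\<in>pverts G. real (deg G u) * (x u)\<^sup>2)"
proof -
  note G = pair_graphD[OF assms]
  let ?V = "pverts G" and ?a = "\<lambda>u v. of_bool ((u, v) \<in> parcs G) :: real"
  have d: "(\<Sum>u\<in>?V. \<Sum>v\<in>?V. ?a u v * (x u)\<^sup>2) = (\<Sum>u\<in>?V. real (deg G u) * (x u)\<^sup>2)"
    by (simp add: sum_distrib_right[symmetric] sum_adjacent[OF assms])
  have d': "(\<Sum>u\<in>?V. \<Sum>v\<in>?V. ?a u v * (x v)\<^sup>2) = (\<Sum>u\<in>?V. real (deg G u) * (x u)\<^sup>2)"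
    by (subst sum.swap) (simp add: G(5)[of _ "_ :: 'a"] d[symmetric])
  have "(\<Sum>(u, v)\<in>parcs G. (x u - x v)\<^sup>2) + (\<Sum>(u, v)\<in>parcs G. (x u + x v)\<^sup>2)
      = (\<Sum>u\<in>?V. \<Sum>v\<in>?V. 2 * (?a u v * (x u)\<^sup>2) + 2 * (?a u v * (x v)\<^sup>2))"
    unfolding sum_parcs[OF assms] sum.distrib[symmetric]
    by (intro sum.cong refl) (simp add: power2_eq_square algebra_simps)
  then show ?thesis by (simp add: sum.distrib sum_distrib_left[symmetric] d d')
qed

lemma sum_lap_diag: "pair_graph G \<Longrightarrow> (\<Sum>v\<in>pverts G. lap G v v) = (\<Sum>v\<in>pverts G. real (deg G v))"
  using pair_graphD(6)[of G] by (simp add: lap_def)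

lemma sum_lap_square:
  assumes "pair_graph G"
  shows "(\<Sum>u\<in>pverts G. \<Sum>v\<in>pverts G. lap G u v * lap G v u)
    = (\<Sum>v\<in>pverts G. (real (deg G v))\<^sup>2 + real (deg G v))"
proof -
  note G = pair_graphD[OF assms]
  have "lap G u v * lap G v u = (if u = v then (real (deg G u))\<^sup>2 else 0) + of_bool ((u, v) \<in> parcs G)" for u v
    using G(5)[of u v] G(6) by (auto simp: lap_def power2_eq_square)
  then show ?thesis using G by (simp add: sum.distrib sum_adjacent[OF assms])
qed

text \<open>Expansion of the trace of \<open>(D - A)^3\<close>: products with a single
  \<open>A\<close> have zero diagonal, each of the three placements of one \<open>D\<close> among
  two \<open>A\<close> gives the sum of the squared degrees, and the trace of \<open>A^3\<close>
  counts ordered triangles.\<close>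

lemma sum_lap_cube:
  assumes "pair_graph G"
  shows "(\<Sum>u\<in>pverts G. \<Sum>v\<in>pverts G. \<Sum>w\<in>pverts G. lap G u v * lap G v w * lap G w u)
    = (\<Sum>v\<in>pverts G. real (deg G v) ^ 3 + 3 * (real (deg G v))\<^sup>2) - real (card (triangles G))"
proof -
  note G = pair_graphD[OF assms]
  let ?V = "pverts G" and ?a = "\<lambda>u v. of_bool ((u, v) \<in> parcs G) :: real" and ?d = "\<lambda>v. real (deg G v)"
  have 1: "lap G u v * lap G v w * lap G w u =
      (if u = v then if u = w then ?d u ^ 3 else 0 else 0) + (if u = v then ?d u * ?a u w else 0)
      + (if v = w then ?d v * ?a v u else 0) + (if u = w then ?d u * ?a u v else 0)
      - ?a u v * ?a v w * ?a w u" for u v w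
    using G(5)[of u v] G(5)[of v w] G(5)[of u w] G(6)
    by (auto simp: lap_def power3_eq_cube)
  have i1: "(\<Sum>w\<in>?V. if P then f w else 0) = (if P then \<Sum>w\<in>?V. f w else 0)" for P and f :: "'a \<Rightarrow> real"
    by simp
  have dd: "(\<Sum>v\<in>?V. ?d u * ?a u v) = (?d u)\<^sup>2" for u
    by (simp add: sum_distrib_left[symmetric] sum_adjacent[OF assms] power2_eq_square)
  have tr: "(\<Sum>u\<in>?V. \<Sum>v\<in>?V. \<Sum>w\<in>?V. ?a u v * ?a v w * ?a w u) = real (card (triangles G))"
  proof -
    have "(\<Sum>u\<in>?V. \<Sum>v\<in>?V. \<Sum>w\<in>?V. ?a u v * ?a v w * ?a w u)
        = (\<Sum>p\<in>?V \<times> ?V \<times> ?V. of_bool (p \<in> triangles G))"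
      unfolding sum.cartesian_product by (intro sum.cong refl) (auto simp: triangles_def)
    also have "\<dots> = real (card ((?V \<times> ?V \<times> ?V) \<inter> triangles G))"
      using G by (simp add: sum_of_bool_eq Int_def)
    also have "(?V \<times> ?V \<times> ?V) \<inter> triangles G = triangles G"
      using G by (auto simp: triangles_def)
    finally show ?thesis .
  qed
  have t4: "(\<Sum>u\<in>?V. \<Sum>v\<in>?V. \<Sum>w\<in>?V. if v = w then ?d v * ?a v u else 0) = (\<Sum>v\<in>?V. (?d v)\<^sup>2)"
    using G by (subst sum.swap) (simp add: dd)
  have t3: "(\<Sum>u\<in>?V. \<Sum>v\<in>?V. \<Sum>w\<in>?V. if u = w then ?d u * ?a u v else 0) = (\<Sum>v\<in>?V. (?d v)\<^sup>2)"
    using G by (simp add: dd)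
  have t2: "(\<Sum>u\<in>?V. \<Sum>v\<in>?V. \<Sum>w\<in>?V. if u = v then ?d u * ?a u w else 0) = (\<Sum>v\<in>?V. (?d v)\<^sup>2)"
    using G by (simp add: i1 dd)
  have t1: "(\<Sum>u\<in>?V. \<Sum>v\<in>?V. \<Sum>w\<in>?V. if u = v then if u = w then ?d u ^ 3 else 0 else 0) = (\<Sum>v\<in>?V. ?d v ^ 3)"
    using G by (simp add: i1)
  show ?thesis
    unfolding 1 sum.distrib sum_subtractf t1 t2 t3 t4 tr by (simp add: sum_distrib_left[symmetric])
qed

lemma laplacian_matrix_eq:
  assumes "distinct vs"
  shows "laplacian_matrix G vs = mat (length vs) (length vs) (\<lambda>(i, j). lap G (vs ! i) (vs ! j))"
  by (rule eq_matI) (use assms in \<open>auto simp: laplacian_matrix_def degree_matrix_def adjacency_matrix_def lap_def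
      nth_eq_iff_index_eq\<close>)

lemma vertex_enum_exists: "pair_graph G \<Longrightarrow> \<exists>vs. vertex_enum G vs"
  using finite_distinct_list[OF pair_graphD(1)] by (auto simp: vertex_enum_def)

lemma proots_linear_factors: "proots (\<Prod>a\<leftarrow>as. [:- a, 1:]) = mset (as :: 'a :: idom list)"
proof (induction as)
  case (Cons a as)
  have "(\<Prod>a\<leftarrow>as. [:- a, 1:]) \<noteq> 0" by (auto simp: prod_list_zero_iff)
  then show ?case using Cons by (simp add: proots_mult del: mult_pCons_left)
qed simp

text \<open>The spectrum is defined through complex roots, whereas the diagonalization lives over
  the reals; a real splitting of the characteristic polynomial bridges the two.\<close>

lemma char_poly_map_of_real:
  fixes A :: "real mat"
  assumes A: "A \<in> carrier_mat n n" and "char_poly A = (\<Prod>a\<leftarrow>as. [:- a, 1:])"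
  shows "eigenvalue_mset A = image_mset complex_of_real (mset as)"
proof -
  interpret h: map_poly_comm_ring_hom complex_of_real ..
  have "char_poly (map_mat complex_of_real A) = (\<Prod>a\<leftarrow>map complex_of_real as. [:- a, 1:])"
    unfolding of_real_hom.char_poly_hom[OF A] assms(2) by (simp add: h.hom_prod_list o_def)
  then show ?thesis by (simp only: eigenvalue_mset_def proots_linear_factors mset_map)
qed

lemma laplacian_eigenbasis:
  fixes G :: "'a pair_pre_digraph"
  assumes G: "pair_graph G"
  defines "n \<equiv> card (pverts G)"
  shows "\<exists>mu e. eigenbasis (pverts G) n (lap G) mu e \<and>
    laplacian_spectrum G = image_mset (\<lambda>i. complex_of_real (mu i)) (mset_set {..<n})"
proof -
  obtain vs where vs: "vertex_enum G vs" using vertex_enum_exists[OF G] by blast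
  then have dist: "distinct vs" and set: "set vs = pverts G" by (auto simp: vertex_enum_def)
  have len: "length vs = n" using dist set by (metis distinct_card n_def)
  define A where "A = laplacian_matrix G vs"
  have Aij: "A = mat n n (\<lambda>(i, j). lap G (vs ! i) (vs ! j))"
    using laplacian_matrix_eq[OF dist, of G] by (simp add: A_def len)
  have A: "A \<in> carrier_mat n n" by (simp add: Aij)
  have symA: "transpose_mat A = A"
    by (rule eq_matI) (auto simp: Aij lap_sym[OF G])
  obtain U D where U: "U \<in> carrier_mat n n" and D: "D \<in> carrier_mat n n"
    and UU: "transpose_mat U * U = 1\<^sub>m n" and dD: "diagonal_mat D" and AU: "A * U = U * D"
    using real_symmetric_diagonalization[OF A symA] by blast
  have UU': "U * transpose_mat U = 1\<^sub>m n"
    using mat_mult_left_right_inverse[OF _ U UU] U by simp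
  have AUD: "A = U * D * transpose_mat U"
  proof -
    have "U * D * transpose_mat U = A * (U * transpose_mat U)"
      unfolding AU[symmetric] using A U by (intro assoc_mult_mat[of _ n n _ n _ n]) auto
    then show ?thesis using A by (simp add: UU')
  qed
  have "similar_mat A D"
    unfolding similar_mat_def using similar_mat_witI[OF UU' UU AUD A D U] U by auto
  then have "char_poly A = char_poly D" by (rule char_poly_similar)
  also have "\<dots> = (\<Prod>a\<leftarrow>diag_mat D. [:- a, 1:])"
    using D dD by (intro char_poly_upper_triangular[of _ n]) (auto simp: diagonal_mat_def)
  finally have "eigenvalue_mset A = image_mset complex_of_real (mset (diag_mat D))"
    by (rule char_poly_map_of_real[OF A])
  then have spec: "laplacian_spectrum G = image_mset (\<lambda>i. complex_of_real (D $$ (i, i))) (mset_set {..<n})"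
    using D unfolding laplacian_spectrum_eq[OF vs] A_def[symmetric]
    by (simp add: diag_mat_def image_mset.compositionality o_def lessThan_atLeast0)
  define ix where "ix = the_inv_into {..<n} ((!) vs)"
  have bij: "bij_betw ((!) vs) {..<n} (pverts G)"
    using bij_betw_nth[OF dist] len set by blast
  then have ix: "ix (vs ! i) = i" if "i < n" for i
    using that by (auto simp: ix_def bij_betw_def the_inv_into_f_f)
  have ixv: "ix v < n" "vs ! ix v = v" if "v \<in> pverts G" for v
  proof -
    from that have "v \<in> set vs" by (simp only: set)
    then obtain k where k: "k < n" "vs ! k = v" unfolding in_set_conv_nth len by auto
    show "ix v < n" "vs ! ix v = v" using ix[OF k(1)] k by simp_all
  qed
  have sumV: "(\<Sum>v\<in>pverts G. f v) = (\<Sum>k<n. f (vs ! k))" for f :: "'a \<Rightarrow> real"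
    using sum.reindex_bij_betw[OF bij, of f] by simp
  define e where "e i v = U $$ (ix v, i)" for i v
  have "eigenbasis (pverts G) n (lap G) (\<lambda>i. D $$ (i, i)) e"
  proof
    show "finite (pverts G)" by (rule pair_graphD(1)[OF G])
    fix i j assume ij: "i < n" "j < n"
    have "(\<Sum>v\<in>pverts G. e i v * e j v) = (\<Sum>k<n. U $$ (k, i) * U $$ (k, j))"
      unfolding sumV by (intro sum.cong refl) (simp add: e_def ix)
    also have "\<dots> = (transpose_mat U * U) $$ (i, j)"
      using U ij by (simp add: scalar_prod_def lessThan_atLeast0)
    finally show "(\<Sum>v\<in>pverts G. e i v * e j v) = of_bool (i = j)" using ij by (simp add: UU)
  next
    fix u v assume uv: "u \<in> pverts G" "v \<in> pverts G"
    have "(\<Sum>i<n. e i u * e i v) = (U * transpose_mat U) $$ (ix u, ix v)"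
      using U ixv(1)[OF uv(1)] ixv(1)[OF uv(2)] by (simp add: scalar_prod_def lessThan_atLeast0 e_def)
    also have "\<dots> = of_bool (u = v)" 
    proof -
      have "ix u = ix v \<longleftrightarrow> u = v" by (metis ixv(2) uv)
      then show ?thesis unfolding UU' using ixv(1)[OF uv(1)] ixv(1)[OF uv(2)] by simp
    qed
    finally show "(\<Sum>i<n. e i u * e i v) = of_bool (u = v)" .
    have "lap G u v = A $$ (ix u, ix v)" using uv ixv[OF uv(1)] ixv[OF uv(2)] by (simp add: Aij)
    also have "\<dots> = (\<Sum>j<n. (U * D) $$ (ix u, j) * U $$ (ix v, j))"
    proof -
      define M where "M = U * D"
      have M: "M \<in> carrier_mat n n" using U D by (simp add: M_def)
      show ?thesis unfolding AUD M_def[symmetric] using U M ixv(1)[OF uv(1)] ixv(1)[OF uv(2)]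
        by (simp add: scalar_prod_def lessThan_atLeast0)
    qed
    also have "\<dots> = (\<Sum>j<n. D $$ (j, j) * e j u * e j v)"
    proof (intro sum.cong refl)
      fix j assume j: "j \<in> {..<n}"
      have "(U * D) $$ (ix u, j) = (\<Sum>k<n. U $$ (ix u, k) * D $$ (k, j))"
        using U D ixv(1)[OF uv(1)] j by (simp add: scalar_prod_def lessThan_atLeast0)
      also have "\<dots> = (\<Sum>k<n. if k = j then U $$ (ix u, j) * D $$ (j, j) else 0)"
        using dD D j by (intro sum.cong refl) (auto simp: diagonal_mat_def)
      finally show "(U * D) $$ (ix u, j) * U $$ (ix v, j) = D $$ (j, j) * e j u * e j v"
        using j by (simp add: e_def)
    qed
    finally show "lap G u v = (\<Sum>j<n. D $$ (j, j) * e j u * e j v)" .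
  qed
  with spec show ?thesis by blast
qed

section \<open>Consequences of cospectrality for degrees\<close>

lemma cospectral_eigenbases:
  assumes G: "pair_graph G" and H: "pair_graph H" and co: "L_cospectral H G"
  obtains mu e mu' e' where "card (pverts H) = card (pverts G)"
    "eigenbasis (pverts G) (card (pverts G)) (lap G) mu e"
    "eigenbasis (pverts H) (card (pverts G)) (lap H) mu' e'"
    "image_mset mu' (mset_set {..<card (pverts G)}) = image_mset mu (mset_set {..<card (pverts G)})"
proof -
  obtain mu e where 1: "eigenbasis (pverts G) (card (pverts G)) (lap G) mu e"
    and s1: "laplacian_spectrum G = image_mset (\<lambda>i. complex_of_real (mu i)) (mset_set {..<card (pverts G)})"
    using laplacian_eigenbasis[OF G] by blast
  obtain mu' e' where 2: "eigenbasis (pverts H) (card (pverts H)) (lap H) mu' e'"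
    and s2: "laplacian_spectrum H = image_mset (\<lambda>i. complex_of_real (mu' i)) (mset_set {..<card (pverts H)})"
    using laplacian_eigenbasis[OF H] by blast
  have eq: "image_mset (\<lambda>i. complex_of_real (mu' i)) (mset_set {..<card (pverts H)})
    = image_mset (\<lambda>i. complex_of_real (mu i)) (mset_set {..<card (pverts G)})"
    using co s1 s2 by (simp add: L_cospectral_def)
  have c: "card (pverts H) = card (pverts G)"
    using arg_cong[OF eq, of size] by simp
  \<comment> \<open>\<open>Re\<close> undoes the embedding into the complex numbers.\<close>
  have "image_mset mu' (mset_set {..<card (pverts H)}) = image_mset mu (mset_set {..<card (pverts G)})"
    using arg_cong[OF eq, of "image_mset Re"] by (simp add: image_mset.compositionality o_def)
  then show ?thesis using that[OF c 1] 2 unfolding c by blast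
qed

lemma image_mset_eq_sum:
  fixes f :: "'a \<Rightarrow> 'c :: comm_monoid_add"
  assumes "image_mset g (mset_set A) = image_mset h (mset_set B)"
  shows "(\<Sum>i\<in>A. f (g i)) = (\<Sum>i\<in>B. f (h i))"
  using arg_cong[OF assms, of "\<lambda>M. sum_mset (image_mset f M)"]
  by (simp add: sum_unfold_sum_mset image_mset.compositionality o_def)

lemma image_mset_eq_card:
  assumes "image_mset g (mset_set A) = image_mset h (mset_set B)" "finite A" "finite B"
  shows "card {i \<in> A. P (g i)} = card {i \<in> B. P (h i)}"
  using arg_cong[OF assms(1), of "\<lambda>M. size (filter_mset P M)"] assms(2,3)
  by (simp add: filter_mset_image_mset)

text \<open>The traces of the first three powers of the Laplacian are the sums of \<open>d\<close>,
  of \<open>d^2 + d\<close>, and of \<open>d^3 + 3 d^2\<close> less the ordered triangles; each is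
  freed of the lower powers in turn.\<close>

lemma cospectral_moments:
  assumes G: "pair_graph G" and H: "pair_graph H" and co: "L_cospectral H G"
  shows "card (pverts H) = card (pverts G)"
    and "(\<Sum>v\<in>pverts H. real (deg H v)) = (\<Sum>v\<in>pverts G. real (deg G v))"
    and "(\<Sum>v\<in>pverts H. (real (deg H v))\<^sup>2) = (\<Sum>v\<in>pverts G. (real (deg G v))\<^sup>2)"
    and "(\<Sum>v\<in>pverts H. real (deg H v) ^ 3) - real (card (triangles H))
      = (\<Sum>v\<in>pverts G. real (deg G v) ^ 3) - real (card (triangles G))"
proof -
  obtain mu e mu' e' where c: "card (pverts H) = card (pverts G)"
    and G': "eigenbasis (pverts G) (card (pverts G)) (lap G) mu e"
    and H': "eigenbasis (pverts H) (card (pverts G)) (lap H) mu' e'"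
    and eq: "image_mset mu' (mset_set {..<card (pverts G)}) = image_mset mu (mset_set {..<card (pverts G)})"
    using cospectral_eigenbases[OF assms] .
  show "card (pverts H) = card (pverts G)" by fact
  show 1: "(\<Sum>v\<in>pverts H. real (deg H v)) = (\<Sum>v\<in>pverts G. real (deg G v))"
    using image_mset_eq_sum[OF eq, of "\<lambda>x. x"] eigenbasis.trace1[OF G'] eigenbasis.trace1[OF H']
    by (simp add: sum_lap_diag G H)
  show 2: "(\<Sum>v\<in>pverts H. (real (deg H v))\<^sup>2) = (\<Sum>v\<in>pverts G. (real (deg G v))\<^sup>2)"
    using image_mset_eq_sum[OF eq, of "\<lambda>x. x\<^sup>2"] eigenbasis.trace2[OF G'] eigenbasis.trace2[OF H'] 1
    by (simp add: sum_lap_square G H sum.distrib)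
  show "(\<Sum>v\<in>pverts H. real (deg H v) ^ 3) - real (card (triangles H))
      = (\<Sum>v\<in>pverts G. real (deg G v) ^ 3) - real (card (triangles G))"
    using image_mset_eq_sum[OF eq, of "\<lambda>x. x^3"] eigenbasis.trace3[OF G'] eigenbasis.trace3[OF H'] 2
    by (simp add: sum_lap_cube G H sum.distrib sum_distrib_left[symmetric])
qed

section \<open>Test vectors and extreme eigenvalues\<close>

text \<open>Dropping edges only lowers the form, so a test vector has to be examined on a few edges
  only. The second condition on \<open>S\<close> admits each edge in one direction, which absorbs
  the factor 2 of \<open>lap_form\<close>.\<close>

lemma lap_form_ge:
  fixes x :: "'a \<Rightarrow> real"
  assumes G: "pair_graph G" and S: "S \<subseteq> parcs G" "S \<inter> S\<inverse> = {}"
  shows "(\<Sum>(u, v)\<in>S. (x u - x v)\<^sup>2) \<le> (\<Sum>u\<in>pverts G. \<Sum>v\<in>pverts G. x u * lap G u v * x v)"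
proof -
  note G' = pair_graphD[OF G]
  have fS: "finite S" using S(1) G'(2) by (rule finite_subset)
  have "(\<Sum>(u, v)\<in>S\<inverse>. (x u - x v)\<^sup>2) = (\<Sum>(u, v)\<in>S. (x u - x v)\<^sup>2)"
    by (rule sum.reindex_bij_witness[of _ prod.swap prod.swap]) (auto simp: power2_commute)
  then have "2 * (\<Sum>(u, v)\<in>S. (x u - x v)\<^sup>2) = (\<Sum>(u, v)\<in>S \<union> S\<inverse>. (x u - x v)\<^sup>2)"
    using S(2) fS by (subst sum.union_disjoint) auto
  also have "\<dots> \<le> (\<Sum>(u, v)\<in>parcs G. (x u - x v)\<^sup>2)"
    using S(1) G'(2,5) by (intro sum_mono2) auto
  finally show ?thesis unfolding lap_form[OF G, symmetric] by simp
qed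

text \<open>Nonadjacent vertices share no edge, so on the span of their indicators the form is
  \<open>deg u * a^2 + deg v * b^2\<close>, at least 4 times the squared norm.\<close>

lemma two_large_degrees_nonadjacent:
  assumes H: "pair_graph H" and E: "eigenbasis (pverts H) n (lap H) mu e"
    and uv: "u \<in> pverts H" "v \<in> pverts H" "u \<noteq> v" "(u, v) \<notin> parcs H" "4 \<le> deg H u" "4 \<le> deg H v"
  shows "2 \<le> card {i. i < n \<and> 4 \<le> 1 * mu i}"
proof (rule eigenbasis.card_eigenvalues_ge_2[OF E, of "\<lambda>w. of_bool (w = u)" "\<lambda>w. of_bool (w = v)"], rule conjI)
  note H' = pair_graphD[OF H]
  fix a b :: real assume ab: "a \<noteq> 0 \<or> b \<noteq> 0"
  define z where "z w = a * of_bool (w = u) + b * of_bool (w = v)" for w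
  have z: "z u = a" "z v = b" using uv by (auto simp: z_def)
  then show "\<exists>w\<in>pverts H. a * of_bool (w = u) + b * of_bool (w = v) \<noteq> 0"
    using ab uv unfolding z_def by metis
  have nrm: "(\<Sum>w\<in>pverts H. (z w)\<^sup>2) = a\<^sup>2 + b\<^sup>2"
  proof -
    have "(z w)\<^sup>2 = (if w = u then a\<^sup>2 else 0) + (if w = v then b\<^sup>2 else 0)" for w
      using uv by (simp add: z_def)
    then show ?thesis using uv H' by (simp add: sum.distrib)
  qed
  define S where "S = Pair u ` {w. (u, w) \<in> parcs H} \<union> Pair v ` {w. (v, w) \<in> parcs H}"
  have fN: "finite {w. (x, w) \<in> parcs H}" for x
    using finite_subset[OF _ H'(1), of "{w. (x, w) \<in> parcs H}"] H'(4) by auto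
  have "S \<subseteq> parcs H" by (auto simp: S_def)
  moreover have "S \<inter> S\<inverse> = {}" using uv H'(5)[of u v] H'(6) by (auto simp: S_def)
  ultimately have "(\<Sum>(p, q)\<in>S. (z p - z q)\<^sup>2) \<le> (\<Sum>p\<in>pverts H. \<Sum>q\<in>pverts H. z p * lap H p q * z q)"
    by (rule lap_form_ge[OF H])
  moreover have "(\<Sum>(p, q)\<in>S. (z p - z q)\<^sup>2) = real (deg H u) * a\<^sup>2 + real (deg H v) * b\<^sup>2"
  proof -
    have "z w = 0" if "(u, w) \<in> parcs H \<or> (v, w) \<in> parcs H" for w
      using that uv H'(5)[of u v] H'(6) by (auto simp: z_def)
    then show ?thesis unfolding S_def using fN uv
      by (subst sum.union_disjoint) (auto simp: sum.reindex inj_on_def z deg_eq_card)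
  qed
  moreover have "4 * a\<^sup>2 \<le> real (deg H u) * a\<^sup>2" "4 * b\<^sup>2 \<le> real (deg H v) * b\<^sup>2"
    using uv by (auto intro!: mult_right_mono)
  ultimately show "4 * (\<Sum>w\<in>pverts H. (a * of_bool (w = u) + b * of_bool (w = v))\<^sup>2)
    \<le> 1 * (\<Sum>p\<in>pverts H. \<Sum>q\<in>pverts H. (a * of_bool (p = u) + b * of_bool (p = v)) * lap H p q *
        (a * of_bool (q = u) + b * of_bool (q = v)))"
    using nrm unfolding z_def by simp
qed

text \<open>The value \<open>-1/3\<close> on the leaves is that of the eigenvector of the star \<open>K\<^sub>1\<^sub>,\<^sub>3\<close> for the eigenvalue 4.\<close>

lemma two_large_degrees_adjacent:
  assumes H: "pair_graph H" and E: "eigenbasis (pverts H) n (lap H) mu e"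
    and uv: "(u, v) \<in> parcs H" "4 \<le> deg H u" "4 \<le> deg H v"
  shows "2 \<le> card {i. i < n \<and> 4 \<le> 1 * mu i}"
proof -
  note H' = pair_graphD[OF H]
  have fN: "finite {w. (x, w) \<in> parcs H}" for x
    using finite_subset[OF _ H'(1), of "{w. (x, w) \<in> parcs H}"] H'(4) by auto
  have vu: "(v, u) \<in> parcs H" using H'(5) uv by blast
  have ne: "u \<noteq> v" and inV: "u \<in> pverts H" "v \<in> pverts H" using H' uv by auto
  \<comment> \<open>Besides the edge between \<open>u\<close> and \<open>v\<close>, three further
    edges at each end form two stars, which may share up to three leaves.\<close>
  have "3 \<le> card ({w. (u, w) \<in> parcs H} - {v})" using uv fN by (simp add: deg_eq_card)
  then obtain A where A: "A \<subseteq> {w. (u, w) \<in> parcs H} - {v}" "card A = 3"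
    using obtain_subset_with_card_n by metis
  have "3 \<le> card ({w. (v, w) \<in> parcs H} - {u})" using uv vu fN by (simp add: deg_eq_card)
  then obtain B where B: "B \<subseteq> {w. (v, w) \<in> parcs H} - {u}" "card B = 3"
    using obtain_subset_with_card_n by metis
  have fA: "finite A" "finite B" using A B by (auto intro: card_ge_0_finite)
  have AB: "u \<notin> A" "v \<notin> A" "u \<notin> B" "v \<notin> B" "A \<subseteq> pverts H" "B \<subseteq> pverts H"
    using A B H'(4,6) by auto
  define p where "p = card (A \<inter> B)"
  have p: "card (A - B) = 3 - p" "card (B - A) = 3 - p" "p \<le> 3"
    using A B fA card_mono[of A "A \<inter> B"] by (auto simp: p_def card_Diff_subset_Int Int_commute)
  define x where "x w = of_bool (w = u) - of_bool (w \<in> A) / (3::real)" for w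
  define y where "y w = of_bool (w = v) - of_bool (w \<in> B) / (3::real)" for w
  show ?thesis
  proof (rule eigenbasis.card_eigenvalues_ge_2[OF E, of x y], rule conjI)
    fix a b :: real assume ab: "a \<noteq> 0 \<or> b \<noteq> 0"
    define z where "z w = a * x w + b * y w" for w
    have z: "z u = a" "z v = b" using ne AB by (auto simp: z_def x_def y_def)
    have zA: "z w = - (a / 3)" if "w \<in> A - B" for w using that AB by (auto simp: z_def x_def y_def)
    have zB: "z w = - (b / 3)" if "w \<in> B - A" for w using that AB by (auto simp: z_def x_def y_def)
    have zC: "z w = - ((a + b) / 3)" if "w \<in> A \<inter> B" for w
      using that AB by (auto simp: z_def x_def y_def field_simps)
    show "\<exists>w\<in>pverts H. a * x w + b * y w \<noteq> 0" using z ab inV unfolding z_def by metis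
    have sA: "(\<Sum>w\<in>A. f w) = (\<Sum>w\<in>A - B. f w) + (\<Sum>w\<in>A \<inter> B. f w)" for f :: "'a \<Rightarrow> real"
      using sum.Int_Diff[OF fA(1), of f B] by simp
    have sB: "(\<Sum>w\<in>B. f w) = (\<Sum>w\<in>B - A. f w) + (\<Sum>w\<in>A \<inter> B. f w)" for f :: "'a \<Rightarrow> real"
      using sum.Int_Diff[OF fA(2), of f A] by (simp add: Int_commute)
    have nrm: "(\<Sum>w\<in>pverts H. (z w)\<^sup>2)
      = a\<^sup>2 + b\<^sup>2 + (3 - real p) * (a / 3)\<^sup>2 + (3 - real p) * (b / 3)\<^sup>2 + real p * ((a + b) / 3)\<^sup>2"
    proof -
      have "(\<Sum>w\<in>pverts H. (z w)\<^sup>2) = (\<Sum>w\<in>insert u (insert v (A \<union> (B - A))). (z w)\<^sup>2)"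
        using AB inV H'(1) by (intro sum.mono_neutral_right) (auto simp: z_def x_def y_def)
      also have "\<dots> = a\<^sup>2 + (b\<^sup>2 + ((\<Sum>w\<in>A. (z w)\<^sup>2) + (\<Sum>w\<in>B - A. (z w)\<^sup>2)))"
        using AB ne fA z sum.union_disjoint[of A "B - A" "\<lambda>w. (z w)\<^sup>2"] by simp
      finally show ?thesis using p by (simp add: sA zA zB zC p_def[symmetric])
    qed
    define S where "S = insert (u, v) (Pair u ` A \<union> Pair v ` B)"
    have "S \<subseteq> parcs H" using A B uv by (auto simp: S_def)
    moreover have "S \<inter> S\<inverse> = {}" using AB ne by (auto simp: S_def)
    ultimately have "(\<Sum>(p, q)\<in>S. (z p - z q)\<^sup>2) \<le> (\<Sum>p\<in>pverts H. \<Sum>q\<in>pverts H. z p * lap H p q * z q)"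
      by (rule lap_form_ge[OF H])
    moreover have "(\<Sum>(p, q)\<in>S. (z p - z q)\<^sup>2) = (a - b)\<^sup>2 + (\<Sum>w\<in>A. (a - z w)\<^sup>2) + (\<Sum>w\<in>B. (b - z w)\<^sup>2)"
    proof -
      have "(\<Sum>(p, q)\<in>Pair u ` A \<union> Pair v ` B. (z p - z q)\<^sup>2) = (\<Sum>w\<in>A. (a - z w)\<^sup>2) + (\<Sum>w\<in>B. (b - z w)\<^sup>2)"
        using fA ne by (subst sum.union_disjoint) (auto simp: sum.reindex inj_on_def z)
      moreover have "(u, v) \<notin> Pair u ` A \<union> Pair v ` B" using AB ne by auto
      ultimately show ?thesis using fA by (simp add: S_def z)
    qed
    moreover have "(\<Sum>w\<in>A. (a - z w)\<^sup>2) = (3 - real p) * (4 * a / 3)\<^sup>2 + real p * (a + (a + b) / 3)\<^sup>2"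
      using p by (simp add: sA zA zC p_def[symmetric])
    moreover have "(\<Sum>w\<in>B. (b - z w)\<^sup>2) = (3 - real p) * (4 * b / 3)\<^sup>2 + real p * (b + (a + b) / 3)\<^sup>2"
      using p by (simp add: sB zB zC p_def[symmetric])
    \<comment> \<open>The right side exceeds the left by
      \<open>(1 - p/6) (a - b)^2 + (5 p/18) (a + b)^2\<close>. The edge joining \<open>u\<close> and
      \<open>v\<close>, which supplies the full \<open>(a - b)^2\<close>, pays for the shared
      leaves.\<close>
    moreover have "4 * (a\<^sup>2 + b\<^sup>2 + (3 - real p) * (a / 3)\<^sup>2 + (3 - real p) * (b / 3)\<^sup>2 + real p * ((a + b) / 3)\<^sup>2)
      \<le> (a - b)\<^sup>2 + ((3 - real p) * (4 * a / 3)\<^sup>2 + real p * (a + (a + b) / 3)\<^sup>2)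
        + ((3 - real p) * (4 * b / 3)\<^sup>2 + real p * (b + (a + b) / 3)\<^sup>2)"
    proof -
      have "p = 0 \<or> p = 1 \<or> p = 2 \<or> p = 3" using p(3) by auto
      moreover have "0 \<le> (a - b)\<^sup>2" "0 \<le> (a + b)\<^sup>2" "0 \<le> a\<^sup>2" "0 \<le> b\<^sup>2" by simp_all
      ultimately show ?thesis by (elim disjE) (simp_all add: power2_eq_square field_simps)
    qed
    ultimately show "4 * (\<Sum>w\<in>pverts H. (a * x w + b * y w)\<^sup>2)
      \<le> 1 * (\<Sum>p\<in>pverts H. \<Sum>q\<in>pverts H. (a * x p + b * y p) * lap H p q * (a * x q + b * y q))"
      using nrm unfolding z_def by simp
  qed
qed

text \<open>The constant vector and the indicator of \<open>u\<close> are independent and both make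
  the form vanish. With the sign -1 and the threshold 0, the count is of the eigenvalues that are at
  most 0.\<close>

lemma isolated_vertex_eigenvalues:
  assumes H: "pair_graph H" and E: "eigenbasis (pverts H) n (lap H) mu e"
    and u: "u \<in> pverts H" "deg H u = 0" and card: "2 \<le> card (pverts H)"
  shows "2 \<le> card {i. i < n \<and> 0 \<le> (-1) * mu i}"
proof (rule eigenbasis.card_eigenvalues_ge_2[OF E, of "\<lambda>_. 1" "\<lambda>w. of_bool (w = u)"], rule conjI)
  note H' = pair_graphD[OF H]
  fix a b :: real assume ab: "a \<noteq> 0 \<or> b \<noteq> 0"
  define z where "z w = a * 1 + b * of_bool (w = u)" for w
  obtain w where w: "w \<in> pverts H" "w \<noteq> u"
  proof -
    have "\<not> pverts H \<subseteq> {u}" using card card_mono[of "{u}" "pverts H"] by auto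
    then show ?thesis using that by blast
  qed
  have "z w = a" "z u = a + b" using w by (auto simp: z_def)
  then have "z w \<noteq> 0 \<or> z u \<noteq> 0" using ab by auto
  then show "\<exists>w\<in>pverts H. a * 1 + b * of_bool (w = u) \<noteq> 0" using w u unfolding z_def by blast
  have "finite {w. (u, w) \<in> parcs H}" using finite_subset[OF _ H'(1), of "{w. (u, w) \<in> parcs H}"] H'(4) by auto
  then have "(u, w) \<notin> parcs H" "(w, u) \<notin> parcs H" for w
    using u H'(5)[of u w] by (auto simp: deg_eq_card)
  then have "(\<Sum>(p, q)\<in>parcs H. (z p - z q)\<^sup>2) = 0"
    by (intro sum.neutral) (auto simp: z_def)
  then show "0 * (\<Sum>w\<in>pverts H. (a * 1 + b * of_bool (w = u))\<^sup>2)
    \<le> (-1) * (\<Sum>p\<in>pverts H. \<Sum>q\<in>pverts H. (a * 1 + b * of_bool (p = u)) * lap H p q *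
        (a * 1 + b * of_bool (q = u)))"
    using lap_form[OF H, of z] unfolding z_def by simp
qed

text \<open>For \<open>x c = 0\<close> the parallelogram identity bounds the form by
  \<open>4 * |x|^2\<close>, with equality only if \<open>x u = - x v\<close> along all edges; the
  form itself is 0 only if \<open>x u = x v\<close> along all edges. The absolute values in
  \<open>conn\<close> state connectedness in a way that excludes both for a nonzero
  \<open>x\<close>.\<close>

lemma small_degrees_eigenvalues:
  fixes G :: "'a pair_pre_digraph"
  assumes G: "pair_graph G" and E: "eigenbasis (pverts G) n (lap G) mu e"
    and small: "\<And>v. v \<in> pverts G \<Longrightarrow> v \<noteq> c \<Longrightarrow> deg G v \<le> 2"
    and conn: "\<And>x :: 'a \<Rightarrow> real. x c = 0 \<Longrightarrow> (\<And>u v. (u, v) \<in> parcs G \<Longrightarrow> \<bar>x u\<bar> = \<bar>x v\<bar>) \<Longrightarrow> \<forall>v\<in>pverts G. x v = 0"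
  shows "card {i. i < n \<and> 4 \<le> 1 * mu i} \<le> 1" "card {i. i < n \<and> 0 \<le> (-1) * mu i} \<le> 1"
proof -
  note G' = pair_graphD[OF G]
  show "card {i. i < n \<and> 4 \<le> 1 * mu i} \<le> 1"
  proof (rule eigenbasis.card_eigenvalues_le_1[OF E, of c])
    fix x :: "'a \<Rightarrow> real" assume x: "x c = 0" "\<exists>v\<in>pverts G. x v \<noteq> 0"
    have "(\<Sum>(u, v)\<in>parcs G. (x u + x v)\<^sup>2) \<noteq> 0"
    proof
      assume "(\<Sum>(u, v)\<in>parcs G. (x u + x v)\<^sup>2) = 0"
      then have "x u + x v = 0" if "(u, v) \<in> parcs G" for u v
        using that G'(2) by (subst (asm) sum_nonneg_eq_0_iff) auto
      then have "\<bar>x u\<bar> = \<bar>x v\<bar>" if "(u, v) \<in> parcs G" for u v using that by fastforce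
      with conn[of x] x show False by blast
    qed
    moreover have "0 \<le> (\<Sum>(u, v)\<in>parcs G. (x u + x v)\<^sup>2)" by (rule sum_nonneg) auto
    moreover have "(\<Sum>v\<in>pverts G. real (deg G v) * (x v)\<^sup>2) \<le> (\<Sum>v\<in>pverts G. 2 * (x v)\<^sup>2)"
    proof (rule sum_mono)
      fix v assume "v \<in> pverts G"
      then show "real (deg G v) * (x v)\<^sup>2 \<le> 2 * (x v)\<^sup>2"
        using x(1) small[of v] by (cases "v = c") (auto intro: mult_right_mono)
    qed
    ultimately show "1 * (\<Sum>u\<in>pverts G. \<Sum>v\<in>pverts G. x u * lap G u v * x v) < 4 * (\<Sum>v\<in>pverts G. (x v)\<^sup>2)"
      using lap_form[OF G, of x] lap_form_parallelogram[OF G, of x] by (simp add: sum_distrib_left[symmetric])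
  qed
  show "card {i. i < n \<and> 0 \<le> (-1) * mu i} \<le> 1"
  proof (rule eigenbasis.card_eigenvalues_le_1[OF E, of c])
    fix x :: "'a \<Rightarrow> real" assume x: "x c = 0" "\<exists>v\<in>pverts G. x v \<noteq> 0"
    have "(\<Sum>(u, v)\<in>parcs G. (x u - x v)\<^sup>2) \<noteq> 0"
    proof
      assume "(\<Sum>(u, v)\<in>parcs G. (x u - x v)\<^sup>2) = 0"
      then have "x u - x v = 0" if "(u, v) \<in> parcs G" for u v
        using that G'(2) by (subst (asm) sum_nonneg_eq_0_iff) auto
      then have "\<bar>x u\<bar> = \<bar>x v\<bar>" if "(u, v) \<in> parcs G" for u v using that by fastforce
      with conn[of x] x show False by blast
    qed
    moreover have "0 \<le> (\<Sum>(u, v)\<in>parcs G. (x u - x v)\<^sup>2)" by (rule sum_nonneg) auto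
    ultimately show "(-1) * (\<Sum>u\<in>pverts G. \<Sum>v\<in>pverts G. x u * lap G u v * x v) < 0 * (\<Sum>v\<in>pverts G. (x v)\<^sup>2)"
      using lap_form[OF G, of x] by simp
  qed
qed

lemma cospectral_degree_bounds:
  fixes G :: "'a pair_pre_digraph" and H :: "'b pair_pre_digraph"
  assumes G: "pair_graph G" and H: "pair_graph H" and co: "L_cospectral H G"
    and small: "\<And>v. v \<in> pverts G \<Longrightarrow> v \<noteq> c \<Longrightarrow> deg G v \<le> 2"
    and conn: "\<And>x :: 'a \<Rightarrow> real. x c = 0 \<Longrightarrow> (\<And>u v. (u, v) \<in> parcs G \<Longrightarrow> \<bar>x u\<bar> = \<bar>x v\<bar>) \<Longrightarrow> \<forall>v\<in>pverts G. x v = 0"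
  shows "\<lbrakk>u \<in> pverts H; v \<in> pverts H; u \<noteq> v; 4 \<le> deg H u\<rbrakk> \<Longrightarrow> deg H v \<le> 3"
    and "\<lbrakk>u \<in> pverts H; 2 \<le> card (pverts H)\<rbrakk> \<Longrightarrow> 1 \<le> deg H u"
proof -
  define n where "n = card (pverts G)"
  obtain mu e mu' e' where 
    G': "eigenbasis (pverts G) n (lap G) mu e"
    and H': "eigenbasis (pverts H) n (lap H) mu' e'"
    and eq: "image_mset mu' (mset_set {..<n}) = image_mset mu (mset_set {..<n})"
    unfolding n_def using cospectral_eigenbases[OF G H co] .
  have c: "card {i. i < n \<and> P (mu' i)} = card {i. i < n \<and> P (mu i)}" for P
    using image_mset_eq_card[OF eq, of P] by simp
  have le: "card {i. i < n \<and> 4 \<le> 1 * mu' i} \<le> 1" "card {i. i < n \<and> 0 \<le> (-1) * mu' i} \<le> 1"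
  proof -
    note * = small_degrees_eigenvalues[OF G G', of c]
    have "card {i. i < n \<and> 4 \<le> 1 * mu i} \<le> 1" by (rule *(1)[OF small]) (assumption+, rule conn, assumption+)
    then show "card {i. i < n \<and> 4 \<le> 1 * mu' i} \<le> 1" using c[of "\<lambda>x. 4 \<le> 1 * x"] by simp
    have "card {i. i < n \<and> 0 \<le> (-1) * mu i} \<le> 1" by (rule *(2)[OF small]) (assumption+, rule conn, assumption+)
    then show "card {i. i < n \<and> 0 \<le> (-1) * mu' i} \<le> 1" using c[of "\<lambda>x. 0 \<le> (-1) * x"] by simp
  qed
  show "deg H v \<le> 3" if "u \<in> pverts H" "v \<in> pverts H" "u \<noteq> v" "4 \<le> deg H u"
  proof (rule ccontr)
    assume "\<not> deg H v \<le> 3"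
    then have "4 \<le> deg H v" by simp
    then have "2 \<le> card {i. i < n \<and> 4 \<le> 1 * mu' i}"
      using two_large_degrees_nonadjacent[OF H H' that(1-3) _ that(4)]
        two_large_degrees_adjacent[OF H H' _ that(4)] by metis
    with le(1) show False by linarith
  qed
  show "1 \<le> deg H u" if "u \<in> pverts H" "2 \<le> card (pverts H)"
  proof (rule ccontr)
    assume "\<not> 1 \<le> deg H u"
    then have "deg H u = 0" by simp
    from isolated_vertex_eigenvalues[OF H H' that(1) this that(2)] le(2) show False by linarith
  qed
qed

section \<open>Spanning trees and integer cycles\<close>

lemma sum_of_bool_delta:
  fixes f :: "nat \<Rightarrow> 'a :: comm_ring_1"
  assumes "i < n"
  shows "(\<Sum>k=0..<n. of_bool (i = k) * f k) = f i" "(\<Sum>k=0..<n. f k * of_bool (i = k)) = f i"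
    "(\<Sum>k=0..<n. f k * of_bool (k = i)) = f i"
proof -
  have "{0..<n} \<inter> {k. i = k} = {i}" "{0..<n} \<inter> {k. k = i} = {i}" using assms by auto
  then show "(\<Sum>k=0..<n. of_bool (i = k) * f k) = f i" "(\<Sum>k=0..<n. f k * of_bool (i = k)) = f i"
    "(\<Sum>k=0..<n. f k * of_bool (k = i)) = f i" by simp_all
qed

definition all_ones :: "nat \<Rightarrow> real mat" where "all_ones n = mat n n (\<lambda>_. 1)"

text \<open>With \<open>J\<close> the all-ones matrix, \<open>A J = 0\<close> gives
  \<open>(t I - A)(t I - J) = t (t I - (A + J))\<close>; take determinants.\<close>

lemma char_poly_add_all_ones:
  assumes A: "A \<in> carrier_mat n n" and AJ: "A * all_ones n = 0\<^sub>m n n"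
  shows "t ^ n * poly (char_poly (A + all_ones n)) t = poly (char_poly A) t * det (t \<cdot>\<^sub>m 1\<^sub>m n - all_ones n)"
proof -
  let ?J = "all_ones n" and ?I = "t \<cdot>\<^sub>m 1\<^sub>m n"
  have J: "?J \<in> carrier_mat n n" by (simp add: all_ones_def)
  have I: "?I \<in> carrier_mat n n" by simp
  have cp: "poly (char_poly B) t = det (?I - B)" if "B \<in> carrier_mat n n" for B
    unfolding char_poly_matrix[OF that] char_matrix_def
    by (rule arg_cong[of _ _ det], rule eq_matI) (use that in auto)
  have "(?I - A) * (?I - ?J) = t \<cdot>\<^sub>m (?I - (A + ?J))"
  proof (rule eq_matI)
    fix i j assume "i < dim_row (t \<cdot>\<^sub>m (?I - (A + ?J)))" "j < dim_col (t \<cdot>\<^sub>m (?I - (A + ?J)))"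
    then have ij: "i < n" "j < n" using A J by auto
    have aj: "(\<Sum>k=0..<n. A $$ (i, k)) = 0"
      using arg_cong[OF AJ, of "\<lambda>M. M $$ (i, j)"] ij A by (simp add: all_ones_def scalar_prod_def)
    have "((?I - A) * (?I - ?J)) $$ (i, j) = (\<Sum>k=0..<n. (t * of_bool (i = k) - A $$ (i, k)) * (t * of_bool (k = j) - 1))"
      using ij A J by (simp add: scalar_prod_def all_ones_def of_bool_def if_distrib cong: if_cong)
    also have "\<dots> = (\<Sum>k=0..<n. (if k = i then t * t * of_bool (i = j) - t else 0) - (if k = j then t * A $$ (i, j) else 0) + A $$ (i, k))"
      by (intro sum.cong refl) (auto simp: algebra_simps)
    also have "\<dots> = t * (t * of_bool (i = j) - A $$ (i, j) - 1)"
      using ij by (simp add: sum.distrib sum_subtractf aj algebra_simps)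
    finally show "((?I - A) * (?I - ?J)) $$ (i, j) = (t \<cdot>\<^sub>m (?I - (A + ?J))) $$ (i, j)"
      using ij A J by (simp add: all_ones_def algebra_simps)
  qed (use A J in auto)
  then have "det (?I - A) * det (?I - ?J) = t ^ n * det (?I - (A + ?J))"
    using A J I by (subst det_mult[symmetric, of _ n]) auto
  then show ?thesis using cp[OF A] cp[of "A + ?J"] A J by simp
qed

text \<open>The determinant is, up to sign, the value of the characteristic polynomial at 0. There
  the factor \<open>t^n\<close> of \<open>char_poly_add_all_ones\<close> vanishes, so it is
  cancelled between polynomials and not between values.\<close>

lemma det_add_all_ones_eq:
  assumes A: "A \<in> carrier_mat n n" and AJ: "A * all_ones n = 0\<^sub>m n n"
    and B: "B \<in> carrier_mat n n" and BJ: "B * all_ones n = 0\<^sub>m n n"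
    and eq: "char_poly A = char_poly B"
  shows "det (A + all_ones n) = det (B + all_ones n)"
proof -
  have J: "all_ones n \<in> carrier_mat n n" by (simp add: all_ones_def)
  have "poly (monom 1 n * char_poly (A + all_ones n)) t = poly (monom 1 n * char_poly (B + all_ones n)) t" for t
    using char_poly_add_all_ones[OF A AJ, of t] char_poly_add_all_ones[OF B BJ, of t] eq by (simp add: poly_monom)
  then have "monom 1 n * char_poly (A + all_ones n) = monom 1 n * char_poly (B + all_ones n)"
    by (intro poly_eq_poly_eq_iff[THEN iffD1] ext)
  then have "char_poly (A + all_ones n) = char_poly (B + all_ones n)" by simp
  moreover have "poly (char_poly M) 0 = (-1) ^ n * det M" if M: "M \<in> carrier_mat n n" for M :: "real mat"
  proof -
    have "- char_matrix M 0 = (-1) \<cdot>\<^sub>m M"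
      by (rule eq_matI) (use M in \<open>auto simp: char_matrix_def\<close>)
    then show ?thesis using M by (simp add: char_poly_matrix[OF M])
  qed
  ultimately show ?thesis using A B J by (metis add_carrier_mat mult_cancel_left power_eq_0_iff zero_neq_neg_one)
qed

text \<open>By the matrix-tree theorem, \<open>det (corner_mat 1 L)\<close> is the number of spanning trees when \<open>L\<close> is a
  Laplacian matrix.\<close>

definition corner_mat :: "'a :: comm_ring_1 \<Rightarrow> 'a mat \<Rightarrow> 'a mat" where
  "corner_mat g A = mat (dim_row A) (dim_row A)
    (\<lambda>(i, j). if i = 0 \<or> j = 0 then (if i = j then g else 0) else A $$ (i, j))"

lemma det_corner_mat:
  assumes "A \<in> carrier_mat n n" "0 < n"
  shows "det (corner_mat g A) = g * det (corner_mat 1 A)"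
proof -
  have "corner_mat g A = multrow 0 g (corner_mat 1 A)"
    by (rule eq_matI) (use assms in \<open>auto simp: corner_mat_def\<close>)
  then show ?thesis using assms by (simp add: det_multrow[of 0 n] corner_mat_def)
qed

text \<open>\<open>R (A + J) R^T\<close> and \<open>F M F^T\<close>, where \<open>M\<close> is the
  corner matrix with entry \<open>n^2\<close>, are the same matrix: \<open>n^2\<close> in the
  corner, \<open>n\<close> in the rest of row and column 0, and \<open>A + J\<close> elsewhere.
  \<open>R\<close> adds all rows to row 0, and \<open>F\<close> spreads the corner by the factor
  \<open>1 / n\<close>; both are triangular with unit diagonal.\<close>

lemma det_add_all_ones:
  assumes A: "A \<in> carrier_mat n n" and n: "0 < n"
    and row: "\<And>i. i < n \<Longrightarrow> (\<Sum>j<n. A $$ (i, j)) = 0" and col: "\<And>j. j < n \<Longrightarrow> (\<Sum>i<n. A $$ (i, j)) = 0"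
  shows "det (A + all_ones n) = (real n)\<^sup>2 * det (corner_mat 1 A)"
proof -
  define R where "R = mat n n (\<lambda>(i, j). if i = 0 then 1 else of_bool (i = j) :: real)"
  define F where "F = mat n n (\<lambda>(i, j). if j = 0 then (if i = 0 then 1 else 1 / real n) else of_bool (i = j) :: real)"
  let ?M = "corner_mat ((real n)\<^sup>2) A" and ?J = "all_ones n"
  have c: "R \<in> carrier_mat n n" "F \<in> carrier_mat n n" "?M \<in> carrier_mat n n" "?J \<in> carrier_mat n n"
    using A by (auto simp: R_def F_def corner_mat_def all_ones_def)
  have detR: "det R = 1"
  proof -
    have "upper_triangular R" by (auto simp: R_def)
    then show ?thesis using det_upper_triangular[of R n] c by (simp add: prod_list_diag_prod R_def)
  qed
  have detF: "det F = 1"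
    using det_lower_triangular[of n F] c by (simp add: prod_list_diag_prod F_def)
  have split: "(\<Sum>k=0..<n. f k) = f 0 + (\<Sum>k=1..<n. f k)" for f :: "nat \<Rightarrow> real"
    using n by (simp add: sum.atLeast_Suc_lessThan)
  have RA: "(R * (A + ?J)) $$ (i, j) = (if i = 0 then real n else A $$ (i, j) + 1)" if "i < n" "j < n" for i j
  proof -
    have "(R * (A + ?J)) $$ (i, j) = (\<Sum>k=0..<n. (if i = 0 then 1 else of_bool (i = k)) * (A $$ (k, j) + 1))"
      using that A by (simp add: R_def all_ones_def scalar_prod_def)
    also have "\<dots> = (if i = 0 then real n else A $$ (i, j) + 1)"
      using that col[of j] sum_of_bool_delta(1)[of i n "\<lambda>k. A $$ (k, j) + 1"]
      by (cases "i = 0") (simp_all add: sum.distrib lessThan_atLeast0)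
    finally show ?thesis .
  qed
  define X where "X = R * (A + ?J)"
  have X: "X \<in> carrier_mat n n" using c A by (simp add: X_def)
  have FM: "(F * ?M) $$ (i, j) = (if j = 0 then (if i = 0 then (real n)\<^sup>2 else real n) else if i = 0 then 0 else A $$ (i, j))"
    if ij: "i < n" "j < n" for i j
  proof -
    have "(F * ?M) $$ (i, j) = (\<Sum>k=0..<n. F $$ (i, k) * ?M $$ (k, j))"
      using ij c by (simp add: scalar_prod_def)
    also have "\<dots> = F $$ (i, 0) * ?M $$ (0, j) + (\<Sum>k=1..<n. F $$ (i, k) * ?M $$ (k, j))" by (rule split)
    also have "(\<Sum>k=1..<n. F $$ (i, k) * ?M $$ (k, j)) = (\<Sum>k=1..<n. if k = i then (if j = 0 then 0 else A $$ (i, j)) else 0)"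
      using ij A by (intro sum.cong refl) (auto simp: F_def corner_mat_def)
    finally show ?thesis using ij A n by (auto simp: F_def corner_mat_def power2_eq_square)
  qed
  define Y where "Y = F * ?M"
  have Y: "Y \<in> carrier_mat n n" using c by (simp add: Y_def)
  note FM = FM[folded Y_def]
  have Fij: "F $$ (i, j) = (if j = 0 then (if i = 0 then 1 else 1 / real n) else of_bool (i = j))" if "i < n" "j < n" for i j
    using that by (simp add: F_def)
  have "X * transpose_mat R = Y * transpose_mat F"
  proof (rule eq_matI)
    fix i j assume "i < dim_row (Y * transpose_mat F)" "j < dim_col (Y * transpose_mat F)"
    then have ij: "i < n" "j < n" using c Y by auto
    have "(X * transpose_mat R) $$ (i, j) = (\<Sum>k=0..<n. (if i = 0 then real n else A $$ (i, k) + 1) * (if j = 0 then 1 else of_bool (j = k)))"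
      using ij c X RA by (simp add: scalar_prod_def X_def[symmetric]) (simp add: R_def)
    also have "\<dots> = (if i = 0 then (if j = 0 then (real n)\<^sup>2 else real n) else if j = 0 then real n else A $$ (i, j) + 1)"
      using ij row[of i] sum_of_bool_delta(2)[of j n "\<lambda>k. A $$ (i, k) + 1"] sum_of_bool_delta(2)[of j n "\<lambda>_. real n"]
      by (cases "i = 0"; cases "j = 0") (simp_all add: sum.distrib lessThan_atLeast0 power2_eq_square)
    finally have 1: "(X * transpose_mat R) $$ (i, j) = \<dots>" .
    have "(Y * transpose_mat F) $$ (i, j) = (\<Sum>k=0..<n. Y $$ (i, k) * F $$ (j, k))"
      using ij c Y by (simp add: scalar_prod_def)
    also have "\<dots> = Y $$ (i, 0) * F $$ (j, 0) + (\<Sum>k=1..<n. Y $$ (i, k) * F $$ (j, k))" by (rule split)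
    also have "(\<Sum>k=1..<n. Y $$ (i, k) * F $$ (j, k)) = (\<Sum>k=1..<n. if k = j then (if i = 0 then 0 else A $$ (i, j)) else 0)"
      using ij by (intro sum.cong refl) (auto simp: Fij FM)
    finally have 2: "(Y * transpose_mat F) $$ (i, j) = (if i = 0 then (if j = 0 then (real n)\<^sup>2 else real n) else if j = 0 then real n else A $$ (i, j) + 1)"
      using ij n by (auto simp: Fij FM power2_eq_square)
    show "(X * transpose_mat R) $$ (i, j) = (Y * transpose_mat F) $$ (i, j)" unfolding 1 2 ..
  qed (use c X Y in auto)
  then have "det X * det R = det Y * det F"
    using c X Y det_transpose[of R n] det_transpose[of F n] det_mult[of X n "transpose_mat R"] det_mult[of Y n "transpose_mat F"]
    by simp
  then have "det R * det (A + ?J) = det F * det ?M"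
    unfolding X_def Y_def using c A det_mult[of R n "A + ?J"] det_mult[of F n ?M] detR detF by simp
  then show ?thesis by (simp add: detR detF det_corner_mat[OF A n, of "(real n)\<^sup>2"])
qed

section \<open>Integer Gram matrices and primitive kernel vectors\<close>

text \<open>\<open>N\<close> will be the incidence matrix of an oriented graph with as many edges as
  vertices: it is square, and \<open>gram\<close>, which is \<open>N N^T\<close>, is the Laplacian
  matrix.\<close>

locale integer_gram =
  fixes n :: nat and N :: "nat \<Rightarrow> nat \<Rightarrow> int"
  assumes n: "0 < n"
begin

definition gram :: "int mat" where "gram = mat n n (\<lambda>(i, j). \<Sum>k<n. N i k * N j k)"

definition replace_row :: "(nat \<Rightarrow> int) \<Rightarrow> int mat" where
  "replace_row z = mat n n (\<lambda>(i, j). if i = 0 then z j else N i j)"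

lemma gram_carrier: "gram \<in> carrier_mat n n"
  by (simp add: gram_def)

text \<open>\<open>z\<close> is orthogonal to all rows of \<open>N\<close>, so multiplying the
  matrix with its transpose clears row and column 0 except for the corner, which becomes
  \<open>|z|^2\<close>.\<close>

lemma replace_row_square:
  assumes z: "\<And>i. i < n \<Longrightarrow> (\<Sum>j<n. N i j * z j) = 0"
  shows "(det (replace_row z))\<^sup>2 = (\<Sum>j<n. (z j)\<^sup>2) * det (corner_mat 1 gram)"
proof -
  let ?P = "replace_row z"
  have P: "?P \<in> carrier_mat n n" by (simp add: replace_row_def)
  have z': "(\<Sum>j<n. z j * N i j) = 0" if "i < n" for i using z[OF that] by (simp add: mult.commute)
  have "?P * transpose_mat ?P = corner_mat (\<Sum>j<n. (z j)\<^sup>2) gram"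
    by (rule eq_matI) (auto simp: replace_row_def corner_mat_def gram_def scalar_prod_def
        lessThan_atLeast0[symmetric] z z' power2_eq_square)
  then have "det ?P * det ?P = det (corner_mat (\<Sum>j<n. (z j)\<^sup>2) gram)"
    using det_mult[of ?P n "transpose_mat ?P"] P det_transpose[OF P] by simp
  then show ?thesis using det_corner_mat[OF gram_carrier n, of "\<Sum>j<n. (z j)\<^sup>2"] by (simp add: power2_eq_square)
qed

text \<open>Cramer's rule for the system with matrix \<open>replace_row z\<close>, solution \<open>z\<close> and right-hand side
  \<open>(\<bar>z\<bar>\<^sup>2, 0, \<dots>, 0)\<close>.\<close>

lemma norm_dvd_replace_row:
  assumes z: "\<And>i. i < n \<Longrightarrow> (\<Sum>j<n. N i j * z j) = 0" and gcd: "Gcd (z ` {..<n}) = 1"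
  shows "(\<Sum>j<n. (z j)\<^sup>2) dvd det (replace_row z)"
proof -
  let ?P = "replace_row z" and ?g = "\<Sum>j<n. (z j)\<^sup>2"
  have P: "?P \<in> carrier_mat n n" by (simp add: replace_row_def)
  note adj = adj_mat[OF P]
  have Pz: "?P *\<^sub>v vec n z = vec n (\<lambda>i. if i = 0 then ?g else 0)"
    by (rule eq_vecI) (auto simp: replace_row_def scalar_prod_def lessThan_atLeast0[symmetric] z power2_eq_square)
  have "?g dvd det ?P * z i" if i: "i < n" for i
  proof -
    have "(adj_mat ?P * ?P) *\<^sub>v vec n z = adj_mat ?P *\<^sub>v (?P *\<^sub>v vec n z)"
      using adj(1) P by (intro assoc_mult_mat_vec) auto
    then have "(det ?P \<cdot>\<^sub>m 1\<^sub>m n) *\<^sub>v vec n z = adj_mat ?P *\<^sub>v vec n (\<lambda>i. if i = 0 then ?g else 0)"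
      by (simp only: adj(3) Pz)
    from arg_cong[OF this, of "\<lambda>v. v $ i"]
    have "det ?P * z i = adj_mat ?P $$ (i, 0) * ?g"
      using i adj(1) n by (simp add: scalar_prod_def if_distrib if_distribR cong: if_cong)
    then show ?thesis by simp
  qed
  then have "?g dvd Gcd ((*) (det ?P) ` z ` {..<n})" by (intro Gcd_greatest) auto
  then show ?thesis by (simp add: Gcd_mult gcd)
qed

text \<open>\<open>cols\<close> makes \<open>N\<close> singular, so there is an integer kernel
  vector; division by its gcd makes it primitive. With \<open>g = |z|^2\<close>, divisibility gives
  \<open>det (replace_row z) = g q\<close> and the square formula \<open>(g q)^2 = 3 g\<close>.
  Hence \<open>g q^2 = 3\<close>, and as 3 is a squarefree prime only \<open>q^2 = 1\<close> is
  left.\<close>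

lemma kernel_vector_of_det_3:
  assumes cols: "\<And>j. j < n \<Longrightarrow> (\<Sum>i<n. N i j) = 0" and det3: "det (corner_mat 1 gram) = 3"
  shows "\<exists>z. (\<forall>i<n. (\<Sum>j<n. N i j * z j) = 0) \<and> (\<Sum>j<n. (z j)\<^sup>2) = 3"
proof -
  define M where "M = mat n n (\<lambda>(i, j). N i j)"
  have M: "M \<in> carrier_mat n n" by (simp add: M_def)
  have "transpose_mat M *\<^sub>v vec n (\<lambda>_. 1) = 0\<^sub>v n"
    by (rule eq_vecI) (auto simp: M_def scalar_prod_def lessThan_atLeast0[symmetric] cols)
  moreover have "vec n (\<lambda>_. 1 :: int) \<noteq> 0\<^sub>v n"
    using n by (metis index_vec index_zero_vec(1) zero_neq_one)
  ultimately have "det (transpose_mat M) = 0"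
    using M by (subst det_0_iff_vec_prod_zero[of _ n]) (auto intro!: exI[of _ "vec n (\<lambda>_. 1)"])
  then have "det M = 0" using det_transpose[OF M] by simp
  then obtain v where v: "v \<in> carrier_vec n" "v \<noteq> 0\<^sub>v n" "M *\<^sub>v v = 0\<^sub>v n"
    using det_0_iff_vec_prod_zero[OF M] by auto
  define d where "d = Gcd ((\<lambda>j. v $ j) ` {..<n})"
  have "d \<noteq> 0"
  proof
    assume "d = 0"
    then have "v = 0\<^sub>v n" using v(1) by (intro eq_vecI) (auto simp: d_def)
    with v(2) show False by simp
  qed
  define z where "z j = v $ j div d" for j
  have vz: "v $ j = d * z j" if "j < n" for j
    using that by (simp add: z_def d_def Gcd_dvd)
  have zker: "(\<Sum>j<n. N i j * z j) = 0" if i: "i < n" for i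
  proof -
    have "d * (\<Sum>j<n. N i j * z j) = (\<Sum>j<n. N i j * v $ j)"
      by (simp add: sum_distrib_left vz mult_ac)
    also have "\<dots> = (M *\<^sub>v v) $ i" using i v(1) by (simp add: M_def scalar_prod_def lessThan_atLeast0)
    finally show ?thesis using i v(3) \<open>d \<noteq> 0\<close> by simp
  qed
  have "d = Gcd ((*) d ` z ` {..<n})"
    unfolding image_image d_def[symmetric] by (subst d_def) (rule arg_cong[of _ _ Gcd], rule image_cong, auto simp: vz)
  also have "\<dots> = \<bar>d * Gcd (z ` {..<n})\<bar>" by (simp add: Gcd_mult)
  finally have "Gcd (z ` {..<n}) = 1"
    using \<open>d \<noteq> 0\<close> by (metis Gcd_int_greater_eq_0 abs_ge_zero abs_mult abs_of_nonneg mult_cancel_left mult.right_neutral)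
  from norm_dvd_replace_row[OF zker this] obtain q where q: "det (replace_row z) = (\<Sum>j<n. (z j)\<^sup>2) * q" by blast
  define g where "g = (\<Sum>j<n. (z j)\<^sup>2)"
  have eq: "(g * q)\<^sup>2 = g * 3"
    using replace_row_square[OF zker] q det3 by (simp add: g_def)
  have "g \<noteq> 0"
  proof
    assume "g = 0"
    then have "\<forall>j<n. z j = 0" by (auto simp: g_def sum_nonneg_eq_0_iff)
    then have "v = 0\<^sub>v n" using v(1) vz by (intro eq_vecI) auto
    with v(2) show False by simp
  qed
  moreover have "g \<ge> 0" by (auto simp: g_def intro: sum_nonneg)
  ultimately have g: "g > 0" by simp
  from eq g have e3: "g * q\<^sup>2 = 3" by (simp add: power2_eq_square mult.left_commute)
  have "q\<^sup>2 \<noteq> 3"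
  proof
    assume q3: "q\<^sup>2 = 3"
    have "\<bar>q\<bar>\<^sup>2 < 2\<^sup>2" by (simp add: q3)
    then have "\<bar>q\<bar> < 2" by (rule power_less_imp_less_base) simp
    then have "q \<in> {-1, 0, 1}" by auto
    with q3 show False by auto
  qed
  have "g = 3"
  proof -
    have "g dvd 3" using e3 by (metis dvd_triv_left)
    then have "g \<le> 3" by (simp add: zdvd_imp_le)
    with g have "g \<in> {1, 2, 3}" by auto
    then show ?thesis using e3 \<open>q\<^sup>2 \<noteq> 3\<close> by auto presburger
  qed
  with zker show ?thesis unfolding g_def by blast
qed

text \<open>Computes the tree number when a cycle vector is known. Multiplying by \<open>S\<close>,
  which has first column \<open>z\<close> and determinant 1, turns column 0 into
  \<open>(3, 0, ..., 0)\<close> because \<open>N z = 0\<close>; what remains is upper triangular. So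
  \<open>replace_row z\<close> has determinant 3, and the square formula reads
  \<open>9 = 3 * det\<close>.\<close>

lemma det_gram_of_triangular:
  assumes z: "\<And>i. i < n \<Longrightarrow> (\<Sum>j<n. N i j * z j) = 0" and z0: "z 0 = 1" and z3: "(\<Sum>j<n. (z j)\<^sup>2) = 3"
    and tri: "\<And>i j. \<lbrakk>0 < j; j < i; i < n\<rbrakk> \<Longrightarrow> N i j = 0" and diag: "\<And>i. \<lbrakk>0 < i; i < n\<rbrakk> \<Longrightarrow> N i i = 1"
  shows "det (corner_mat 1 gram) = 3"
proof -
  let ?P = "replace_row z"
  have P: "?P \<in> carrier_mat n n" by (simp add: replace_row_def)
  define S where "S = mat n n (\<lambda>(i, j). if j = 0 then z i else of_bool (i = j))"
  have S: "S \<in> carrier_mat n n" by (simp add: S_def)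
  have "det S = 1"
    using det_lower_triangular[of n S] S z0 by (simp add: prod_list_diag_prod S_def)
  have PS: "(?P * S) $$ (i, j) = (if j = 0 then (if i = 0 then 3 else 0) else ?P $$ (i, j))" if ij: "i < n" "j < n" for i j
  proof -
    have "(?P * S) $$ (i, j) = (\<Sum>k<n. ?P $$ (i, k) * (if j = 0 then z k else of_bool (k = j)))"
      using ij P by (simp add: S_def scalar_prod_def lessThan_atLeast0)
    also have "\<dots> = (if j = 0 then (\<Sum>k<n. ?P $$ (i, k) * z k) else ?P $$ (i, j))"
      using sum_of_bool_delta(3)[OF ij(2), of "\<lambda>k. ?P $$ (i, k)"] by (simp add: lessThan_atLeast0)
    also have "(\<Sum>k<n. ?P $$ (i, k) * z k) = (if i = 0 then 3 else 0)"
      using ij z z3 by (simp add: replace_row_def power2_eq_square)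
    finally show ?thesis .
  qed
  have dimPS: "dim_row (?P * S) = n" "dim_col (?P * S) = n" using P S by auto
  have "upper_triangular (?P * S)"
    by (rule upper_triangularI) (use dimPS PS tri in \<open>auto simp: replace_row_def simp del: index_mult_mat(1)\<close>)
  then have "det (?P * S) = (\<Prod>i=0..<n. (?P * S) $$ (i, i))"
    using det_upper_triangular[of "?P * S" n] P S dimPS by (simp add: prod_list_diag_prod del: index_mult_mat)
  also have "\<dots> = (\<Prod>i=0..<n. if i = 0 then 3 else 1)"
    by (intro prod.cong refl) (use PS diag in \<open>auto simp: replace_row_def simp del: index_mult_mat(1)\<close>)
  also have "\<dots> = 3" using n by simp
  finally have "det ?P = 3" using det_mult[OF P S] \<open>det S = 1\<close> by simp
  then show ?thesis using replace_row_square[OF z] z3 by simp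
qed

end

lemma eigenvalue_mset_eq_imp_char_poly_eq:
  fixes A B :: "real mat"
  assumes A: "A \<in> carrier_mat n n" and B: "B \<in> carrier_mat n n" and eq: "eigenvalue_mset A = eigenvalue_mset B"
  shows "char_poly A = char_poly B"
proof -
  have d: "char_poly (map_mat complex_of_real M) = (\<Prod>x\<in>#eigenvalue_mset M. [:- x, 1:])" if "M \<in> carrier_mat n n" for M
  proof -
    have "lead_coeff (char_poly (map_mat complex_of_real M)) = 1"
      using degree_monic_char_poly[of "map_mat complex_of_real M" n] that by simp
    then show ?thesis
      using complex_poly_decompose_multiset[of "char_poly (map_mat complex_of_real M)"]
      by (simp add: eigenvalue_mset_def)
  qed
  have "map_poly complex_of_real (char_poly A) = map_poly complex_of_real (char_poly B)"
    using d[OF A] d[OF B] eq of_real_hom.char_poly_hom[OF A] of_real_hom.char_poly_hom[OF B] by metis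
  then have "coeff (map_poly complex_of_real (char_poly A)) i = coeff (map_poly complex_of_real (char_poly B)) i" for i
    by simp
  then show ?thesis by (intro poly_eqI) (simp add: coeff_map_poly)
qed

lemma vertex_enum_nth: "vertex_enum G vs \<Longrightarrow> i < length vs \<Longrightarrow> vs ! i \<in> pverts G"
  by (metis nth_mem vertex_enum_def)

lemma sum_nth_enum:
  assumes "vertex_enum G vs"
  shows "(\<Sum>i<length vs. f (vs ! i)) = (\<Sum>v\<in>pverts G. f v)"
  using assms sum.reindex_bij_betw[OF bij_betw_nth[of vs "{..<length vs}" "pverts G"], of f]
  by (simp add: vertex_enum_def)

lemma sum_lap_row: "pair_graph G \<Longrightarrow> u \<in> pverts G \<Longrightarrow> (\<Sum>v\<in>pverts G. lap G u v) = 0"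
  using sum_lap_mult[of G u "\<lambda>_. 1"] by simp

lemma length_vertex_enum: "vertex_enum G vs \<Longrightarrow> length vs = card (pverts G)"
  by (metis distinct_card vertex_enum_def)

lemma det_corner_laplacian:
  assumes G: "pair_graph G" and vs: "vertex_enum G vs" and ne: "pverts G \<noteq> {}"
  shows "det (laplacian_matrix G vs + all_ones (length vs)) = (real (length vs))\<^sup>2 * det (corner_mat 1 (laplacian_matrix G vs))"
    and "laplacian_matrix G vs * all_ones (length vs) = 0\<^sub>m (length vs) (length vs)"
proof -
  have L: "laplacian_matrix G vs = mat (length vs) (length vs) (\<lambda>(i, j). lap G (vs ! i) (vs ! j))"
    using vs by (intro laplacian_matrix_eq) (simp add: vertex_enum_def)
  note inV = vertex_enum_nth[OF vs]
  have row: "(\<Sum>j<length vs. lap G (vs ! i) (vs ! j)) = 0" if "i < length vs" for i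
    using sum_nth_enum[OF vs, of "lap G (vs ! i)"] sum_lap_row[OF G inV[OF that]] by simp
  have col: "(\<Sum>i<length vs. lap G (vs ! i) (vs ! j)) = 0" if "j < length vs" for j
    using row[OF that] by (simp add: lap_sym[OF G, of "vs ! j"])
  have n: "0 < length vs" using ne vs by (auto simp: vertex_enum_def)
  show "det (laplacian_matrix G vs + all_ones (length vs)) = (real (length vs))\<^sup>2 * det (corner_mat 1 (laplacian_matrix G vs))"
    by (rule det_add_all_ones) (use n row col in \<open>auto simp: L\<close>)
  show "laplacian_matrix G vs * all_ones (length vs) = 0\<^sub>m (length vs) (length vs)"
    by (rule eq_matI) (auto simp: L all_ones_def scalar_prod_def row lessThan_atLeast0[symmetric])
qed

text \<open>The determinant of \<open>L + J\<close> depends on the spectrum alone and is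
  \<open>n^2\<close> times the corner determinant, so the latter is a spectral invariant whichever
  vertex is listed first.\<close>

lemma cospectral_det_corner:
  assumes G: "pair_graph G" and H: "pair_graph H" and co: "L_cospectral H G"
    and vs: "vertex_enum G vs" and ws: "vertex_enum H ws" and ne: "pverts G \<noteq> {}"
  shows "det (corner_mat 1 (laplacian_matrix H ws)) = det (corner_mat 1 (laplacian_matrix G vs))"
proof -
  define n where "n = length vs"
  have len: "length ws = n"
    using cospectral_moments(1)[OF G H co] vs ws length_vertex_enum n_def by metis
  have n: "n > 0" using ne vs by (auto simp: vertex_enum_def n_def)
  have neH: "pverts H \<noteq> {}" using ws len n by (auto simp: vertex_enum_def)
  have c: "laplacian_matrix G vs \<in> carrier_mat n n" "laplacian_matrix H ws \<in> carrier_mat n n"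
    by (auto simp: laplacian_matrix_def degree_matrix_def adjacency_matrix_def n_def len)
  have "eigenvalue_mset (laplacian_matrix H ws) = eigenvalue_mset (laplacian_matrix G vs)"
    using co laplacian_spectrum_eq[OF vs] laplacian_spectrum_eq[OF ws] by (simp add: L_cospectral_def)
  then have "char_poly (laplacian_matrix H ws) = char_poly (laplacian_matrix G vs)"
    by (rule eigenvalue_mset_eq_imp_char_poly_eq[OF c(2) c(1)])
  then have "det (laplacian_matrix H ws + all_ones n) = det (laplacian_matrix G vs + all_ones n)"
    using det_corner_laplacian(2)[OF G vs ne] det_corner_laplacian(2)[OF H ws neH]
    by (intro det_add_all_ones_eq[OF c(2) _ c(1)]) (simp_all add: len n_def)
  then show ?thesis
    using det_corner_laplacian(1)[OF G vs ne] det_corner_laplacian(1)[OF H ws neH] n by (simp add: len n_def)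
qed

section \<open>Oriented incidence matrices and short cycles\<close>

definition inc :: "'a \<Rightarrow> 'a \<times> 'a \<Rightarrow> int" where
  "inc u p = of_bool (u = fst p) - of_bool (u = snd p)"

definition orientation :: "'a pair_pre_digraph \<Rightarrow> ('a \<times> 'a) set \<Rightarrow> bool" where
  "orientation G S \<longleftrightarrow> S \<inter> S\<inverse> = {} \<and> S \<union> S\<inverse> = parcs G"

lemma orientation_finite: "pair_graph G \<Longrightarrow> orientation G S \<Longrightarrow> finite S"
  using pair_graphD(2)[of G] by (metis finite_Un orientation_def)

lemma orientation_card:
  assumes "pair_graph G" "orientation G S"
  shows "real (2 * card S) = (\<Sum>v\<in>pverts G. real (deg G v))"
proof -
  have "card (parcs G) = card S + card (S\<inverse>)"
    using assms orientation_finite[OF assms] by (metis card_Un_disjoint finite_converse orientation_def)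
  then have "card (parcs G) = 2 * card S" by simp
  moreover have "real (card (parcs G)) = (\<Sum>v\<in>pverts G. real (deg G v))"
    using sum_parcs[OF assms(1), of "\<lambda>_ _. 1"] by (simp add: sum_adjacent[OF assms(1)] case_prod_unfold del: sum_of_bool_eq)
  ultimately show ?thesis by simp
qed

text \<open>Reversing an arc changes both signs in the product, so twice the sum over
  \<open>S\<close> is the sum over all arcs, which does not depend on the orientation.\<close>

lemma lap_eq_sum_inc:
  assumes G: "pair_graph G" and S: "orientation G S" and uv: "u \<in> pverts G" "v \<in> pverts G"
  shows "lap G u v = real_of_int (\<Sum>p\<in>S. inc u p * inc v p)"
proof -
  note G' = pair_graphD[OF G]
  have fS: "finite S" by (rule orientation_finite[OF G S])
  define f where "f a b = (of_bool (u = a) - of_bool (u = b)) * (of_bool (v = a) - of_bool (v = b) :: real)" for a b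
  have "(\<Sum>(a, b)\<in>S\<inverse>. f a b) = (\<Sum>(a, b)\<in>S. f a b)"
    by (rule sum.reindex_bij_witness[of _ prod.swap prod.swap]) (auto simp: f_def algebra_simps)
  then have "2 * (\<Sum>(a, b)\<in>S. f a b) = (\<Sum>(a, b)\<in>parcs G. f a b)"
    using S fS unfolding orientation_def by (metis sum.union_disjoint finite_converse mult_2)
  also have "\<dots> = (\<Sum>a\<in>pverts G. \<Sum>b\<in>pverts G. of_bool ((a, b) \<in> parcs G) * f a b)"
    by (rule sum_parcs[OF G])
  also have "\<dots> = (\<Sum>a\<in>pverts G. \<Sum>b\<in>pverts G.
      (if a = u then of_bool (u = v) * of_bool ((u, b) \<in> parcs G) else 0) - (if a = u then if b = v then of_bool ((u, v) \<in> parcs G) else 0 else 0)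
      - (if a = v then if b = u then of_bool ((u, v) \<in> parcs G) else 0 else 0) + (if b = u then of_bool (u = v) * of_bool ((u, a) \<in> parcs G) else 0))"
    by (intro sum.cong refl) (use G'(5) in \<open>auto simp: f_def\<close>)
  also have "\<dots> = 2 * lap G u v"
  proof -
    have i1: "(\<Sum>w\<in>pverts G. if P then g w else 0) = (if P then \<Sum>w\<in>pverts G. g w else 0)" for P and g :: "'a \<Rightarrow> real"
      by simp
    show ?thesis using G'(1) uv
      by (simp add: sum.distrib sum_subtractf i1 sum_distrib_left[symmetric] sum_adjacent[OF G] lap_def del: sum_of_bool_eq)
  qed
  finally show ?thesis by (simp add: f_def inc_def case_prod_unfold)
qed

text \<open>\<open>h\<close> numbers the edges by the same indices as the vertices, which is
  possible exactly when their numbers agree.\<close>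

lemma gram_incidence:
  assumes G: "pair_graph G" and vs: "vertex_enum G vs" and n: "0 < length vs"
    and h: "bij_betw h {..<length vs} S" and S: "orientation G S"
  shows "laplacian_matrix G vs = map_mat real_of_int (integer_gram.gram (length vs) (\<lambda>i k. inc (vs ! i) (h k)))"
proof -
  interpret integer_gram "length vs" "\<lambda>i k. inc (vs ! i) (h k)" by unfold_locales (rule n)
  have L: "laplacian_matrix G vs = mat (length vs) (length vs) (\<lambda>(i, j). lap G (vs ! i) (vs ! j))"
    using vs by (intro laplacian_matrix_eq) (simp add: vertex_enum_def)
  note inV = vertex_enum_nth[OF vs]
  have "(\<Sum>k<length vs. inc u (h k) * inc v (h k)) = (\<Sum>p\<in>S. inc u p * inc v p)" for u v
    by (rule sum.reindex_bij_betw[OF h])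
  then show ?thesis
    by (intro eq_matI) (auto simp: L gram_def lap_eq_sum_inc[OF G S] inV)
qed

lemma det_corner_of_int: "det (corner_mat 1 (map_mat real_of_int M)) = real_of_int (det (corner_mat 1 M))"
  if "M \<in> carrier_mat n n"
proof -
  have "corner_mat 1 (map_mat real_of_int M) = map_mat real_of_int (corner_mat 1 M)"
    by (rule eq_matI) (use that in \<open>auto simp: corner_mat_def\<close>)
  then show ?thesis by simp
qed

lemma orientation_exists:
  assumes G: "pair_graph G"
  shows "\<exists>S. orientation G S"
proof -
  obtain vs where vs: "vertex_enum G vs" using vertex_enum_exists[OF G] by blast
  define S where "S = {(vs ! i, vs ! j) | i j. i < j \<and> j < length vs \<and> (vs ! i, vs ! j) \<in> parcs G}"
  have d: "distinct vs" using vs by (simp add: vertex_enum_def)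
  have "S \<inter> S\<inverse> = {}" unfolding S_def by (auto simp: nth_eq_iff_index_eq[OF d])
  moreover have "S \<union> S\<inverse> = parcs G"
  proof
    show "S \<union> S\<inverse> \<subseteq> parcs G" using pair_graphD(5)[OF G] by (auto simp: S_def)
    show "parcs G \<subseteq> S \<union> S\<inverse>"
    proof
      fix p assume p: "p \<in> parcs G"
      obtain u v where uv: "p = (u, v)" by (cases p)
      then obtain i j where ij: "i < length vs" "u = vs ! i" "j < length vs" "v = vs ! j"
        using p vs pair_graphD(3,4)[OF G] by (metis in_set_conv_nth vertex_enum_def)
      have "i \<noteq> j" using p uv ij pair_graphD(6)[OF G] by auto
      then consider "i < j" | "j < i" by linarith
      then show "p \<in> S \<union> S\<inverse>"
      proof cases
        case 1 then show ?thesis using p uv ij by (auto simp: S_def)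
      next
        case 2
        moreover have "(vs ! j, vs ! i) \<in> parcs G" using p uv ij pair_graphD(5)[OF G] by blast
        ultimately have "(v, u) \<in> S" using ij by (auto simp: S_def)
        then show ?thesis using uv by simp
      qed
    qed
  qed
  ultimately show ?thesis by (auto simp: orientation_def)
qed

text \<open>Squares that sum to 3 are three ones, since a single entry of absolute value 2 is
  already too large. So \<open>z\<close> lives on three edges, and at each end of such an edge the
  kernel equation needs a second one to cancel it. Three edges without a loose end form a
  triangle.\<close>

lemma triangle_of_short_cycle:
  fixes m :: nat
  assumes G: "pair_graph G" and vs: "vertex_enum G vs" and S: "orientation G S" and h: "bij_betw h {..<m} S"
    and z: "\<And>i. i < length vs \<Longrightarrow> (\<Sum>k<m. inc (vs ! i) (h k) * z k) = 0" and z3: "(\<Sum>k<m. (z k)\<^sup>2) = 3"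
  shows "triangles G \<noteq> {}"
proof -
  note G' = pair_graphD[OF G]
  define K where "K = {k \<in> {..<m}. z k \<noteq> 0}"
  have fK: "finite K" by (rule finite_subset[of _ "{..<m}"]) (auto simp: K_def)
  have sK: "(\<Sum>k\<in>K. (z k)\<^sup>2) = 3"
    using sum.mono_neutral_left[of "{..<m}" K "\<lambda>k. (z k)\<^sup>2"] z3 by (auto simp: K_def)
  have one: "(z k)\<^sup>2 = 1" if k: "k \<in> K" for k
  proof -
    have "(z k)\<^sup>2 \<le> 3" using member_le_sum[OF k, of "\<lambda>k. (z k)\<^sup>2"] fK sK by simp
    then have "\<bar>z k\<bar>\<^sup>2 < 2\<^sup>2" by simp
    then have "\<bar>z k\<bar> < 2" by (rule power_less_imp_less_base) simp
    moreover have "z k \<noteq> 0" using k by (simp add: K_def)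
    ultimately have "z k = 1 \<or> z k = -1" by auto
    then show ?thesis by auto
  qed
  have cK: "card K = 3" using sK one by simp
  have arc: "h k \<in> parcs G" if "k \<in> K" for k
  proof -
    have "h k \<in> S" using that h by (auto simp: K_def bij_betw_def)
    then show ?thesis using S by (auto simp: orientation_def)
  qed
  define ends where "ends k = {fst (h k), snd (h k)}" for k
  have ne: "fst (h k) \<noteq> snd (h k)" if "k \<in> K" for k using arc[OF that] G'(6) by (metis prod.collapse)
  have another: "\<exists>k'\<in>K. k' \<noteq> k \<and> w \<in> ends k'" if k: "k \<in> K" and w: "w \<in> ends k" for k w
  proof (rule ccontr)
    assume "\<not> ?thesis"
    then have *: "inc w (h k') * z k' = 0" if "k' < m" "k' \<noteq> k" for k'
      using that by (auto simp: K_def ends_def inc_def)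
    have "w \<in> pverts G" using w arc[OF k] G'(3,4) by (cases "h k") (auto simp: ends_def)
    then obtain i where i: "i < length vs" "vs ! i = w" using vs by (metis in_set_conv_nth vertex_enum_def)
    have "(\<Sum>k'<m. inc w (h k') * z k') = (\<Sum>k'\<in>{k}. inc w (h k') * z k')"
      using k * by (intro sum.mono_neutral_right) (auto simp: K_def)
    then have "inc w (h k) * z k = 0" using z[OF i(1)] i(2) by simp
    then show False using k w ne[OF k] by (auto simp: K_def inc_def ends_def)
  qed
  \<comment> \<open>\<open>S\<close> holds one direction of each edge, so two of the three edges
    never have the same pair of ends.\<close>
  have inj: "k = k'" if k: "k \<in> K" "k' \<in> K" and eq: "ends k = ends k'" for k k'
  proof -
    have hS: "h k \<in> S" "h k' \<in> S" using k h by (auto simp: K_def bij_betw_def)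
    have "h k = h k' \<or> h k = prod.swap (h k')"
      using eq ne[OF k(1)] ne[OF k(2)] by (cases "h k"; cases "h k'") (auto simp: ends_def doubleton_eq_iff)
    moreover have "h k \<noteq> prod.swap (h k')"
    proof
      assume "h k = prod.swap (h k')"
      moreover have "prod.swap (h k') \<in> S\<inverse>" using hS(2) by (cases "h k'") simp
      ultimately have "h k \<in> S \<inter> S\<inverse>" using hS(1) by simp
      moreover have "S \<inter> S\<inverse> = {}" using S by (simp add: orientation_def)
      ultimately show False by simp
    qed
    ultimately have "h k = h k'" by simp
    then show ?thesis using h k by (auto simp: bij_betw_def inj_on_def K_def)
  qed
  obtain k1 where k1: "k1 \<in> K" using cK by fastforce
  obtain a b where ab: "h k1 = (a, b)" by (cases "h k1")
  have e1: "ends k1 = {a, b}" and anb: "a \<noteq> b" using ab ne[OF k1] by (auto simp: ends_def)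
  obtain k2 where k2: "k2 \<in> K" "k2 \<noteq> k1" "a \<in> ends k2" using another[OF k1, of a] e1 by auto
  obtain k3 where k3: "k3 \<in> K" "k3 \<noteq> k1" "b \<in> ends k3" using another[OF k1, of b] e1 by auto
  have notboth: "\<not> (a \<in> ends k \<and> b \<in> ends k)" if "k \<in> K" "k \<noteq> k1" for k
  proof
    assume "a \<in> ends k \<and> b \<in> ends k"
    then have "ends k = ends k1" using anb e1 by (auto simp: ends_def)
    with inj that k1 show False by blast
  qed
  have k23: "k2 \<noteq> k3" using notboth k2 k3 by blast
  have K: "K = {k1, k2, k3}"
    using k1 k2 k3 k23 cK fK by (intro card_seteq[symmetric]) auto
  obtain c where c: "ends k2 = {a, c}" "c \<noteq> a"
  proof (cases "a = fst (h k2)")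
    case True
    then show ?thesis using that[of "snd (h k2)"] ne[OF k2(1)] by (simp add: ends_def)
  next
    case False
    then have "a = snd (h k2)" using k2(3) by (simp add: ends_def)
    then show ?thesis using that[of "fst (h k2)"] ne[OF k2(1)] by (simp add: ends_def insert_commute)
  qed
  have cb: "c \<noteq> b" using notboth[OF k2(1,2)] c by auto
  obtain k' where k': "k' \<in> K" "k' \<noteq> k2" "c \<in> ends k'" using another[OF k2(1), of c] c by auto
  have "k' = k3" using k' K e1 c cb by auto
  then have e3: "ends k3 = {b, c}" using k3 k' cb by (auto simp: ends_def)
  have adj: "(x, y) \<in> parcs G" if "k \<in> K" "ends k = {x, y}" for k x y
    using arc[OF that(1)] that(2) G'(5)[of x y] by (cases "h k") (auto simp: ends_def doubleton_eq_iff)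
  have "(a, b, c) \<in> triangles G"
    using adj[OF k1 e1] adj[OF k3(1) e3] adj[OF k2(1), of c a] c by (simp add: triangles_def insert_commute)
  then show ?thesis by auto
qed

text \<open>The degree sum says that there are as many edges as vertices, so the incidence matrix is
  square; its columns sum to 0, as every arc has one tail and one head. The kernel vector of squared
  norm 3 is then the cycle.\<close>

lemma unicyclic_three_trees_triangle:
  assumes G: "pair_graph G" and vs: "vertex_enum G vs" and ne: "pverts G \<noteq> {}"
    and sum: "(\<Sum>v\<in>pverts G. real (deg G v)) = 2 * real (card (pverts G))"
    and det3: "det (corner_mat 1 (laplacian_matrix G vs)) = 3"
  shows "triangles G \<noteq> {}"
proof -
  obtain S where S: "orientation G S" using orientation_exists[OF G] by blast
  have n: "0 < length vs" using ne vs by (auto simp: vertex_enum_def)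
  have "card S = length vs"
    using orientation_card[OF G S] sum length_vertex_enum[OF vs] by simp
  then obtain h where h: "bij_betw h {..<length vs} S"
    using orientation_finite[OF G S] by (metis ex_bij_betw_nat_finite lessThan_atLeast0)
  interpret integer_gram "length vs" "\<lambda>i k. inc (vs ! i) (h k)" by unfold_locales (rule n)
  have "real_of_int (det (corner_mat 1 gram)) = 3"
    using det3 gram_incidence[OF G vs n h S] det_corner_of_int[OF gram_carrier] by simp
  then have d: "det (corner_mat 1 gram) = 3" by linarith
  have cols: "(\<Sum>i<length vs. inc (vs ! i) (h j)) = 0" if "j < length vs" for j
  proof -
    have "h j \<in> S" using h that by (auto simp: bij_betw_def)
    then have "h j \<in> parcs G" using S by (auto simp: orientation_def)
    then have "fst (h j) \<in> pverts G" "snd (h j) \<in> pverts G" using pair_graphD(3,4)[OF G] by (metis prod.collapse)+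
    then show ?thesis using pair_graphD(1)[OF G] unfolding sum_nth_enum[OF vs, of "\<lambda>v. inc v (h j)"]
      by (simp add: inc_def sum_subtractf of_bool_def)
  qed
  obtain z where "\<forall>i<length vs. (\<Sum>j<length vs. inc (vs ! i) (h j) * z j) = 0" "(\<Sum>j<length vs. (z j)\<^sup>2) = 3"
    using kernel_vector_of_det_3[OF cols d] by blast
  then show ?thesis using triangle_of_short_cycle[OF G vs S h, of z] by blast
qed

section \<open>Path-friendship graphs\<close>

text \<open>Each edge in one direction only: towards the center, and from \<open>Tri i False\<close>
  to \<open>Tri i True\<close>. This is also the orientation used for the incidence matrix.\<close>

definition pf_edge :: "nat \<Rightarrow> nat list \<Rightarrow> pf_vertex \<Rightarrow> pf_vertex \<Rightarrow> bool" where
  "pf_edge s ls u v \<longleftrightarrow> (case u of Center \<Rightarrow> False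
     | Tri i b \<Rightarrow> i < s \<and> (v = Center \<or> \<not> b \<and> v = Tri i True)
     | Leg j i \<Rightarrow> j < length ls \<and> 1 \<le> i \<and> i \<le> ls ! j \<and> v = leg_vertex j (i - 1))"

lemma leg_vertex_eq_iff:
  "Leg j i = leg_vertex j' x \<longleftrightarrow> j = j' \<and> i = x \<and> x \<noteq> 0" "Center = leg_vertex j' x \<longleftrightarrow> x = 0"
  "Tri a b \<noteq> leg_vertex j' x"
  by (auto simp: leg_vertex_def)

lemma pverts_path_friendship_graph:
  "v \<in> pverts (path_friendship_graph s ls) \<longleftrightarrow> (case v of Center \<Rightarrow> True
     | Tri i b \<Rightarrow> i < s | Leg j i \<Rightarrow> j < length ls \<and> 1 \<le> i \<and> i \<le> ls ! j)"
  by (cases v) (auto simp: path_friendship_graph_def friendship_graph_def pendant_path_def leg_vertex_eq_iff Let_def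
      image_iff Bex_def)

lemma parcs_path_friendship_graph:
  "(u, v) \<in> parcs (path_friendship_graph s ls) \<longleftrightarrow> pf_edge s ls u v \<or> pf_edge s ls v u"
proof -
  have path: "(u, v) \<in> {(leg_vertex j i, leg_vertex j (Suc i)) | i. i < l} \<longleftrightarrow>
      (\<exists>i. v = Leg j i \<and> 1 \<le> i \<and> i \<le> l \<and> u = leg_vertex j (i - 1))" for u v j l
  proof
    assume "(u, v) \<in> {(leg_vertex j i, leg_vertex j (Suc i)) | i. i < l}"
    then obtain i where "u = leg_vertex j i" "v = leg_vertex j (Suc i)" "i < l" by auto
    then show "\<exists>i. v = Leg j i \<and> 1 \<le> i \<and> i \<le> l \<and> u = leg_vertex j (i - 1)"
      by (intro exI[of _ "Suc i"]) (simp add: leg_vertex_def)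
  next
    assume "\<exists>i. v = Leg j i \<and> 1 \<le> i \<and> i \<le> l \<and> u = leg_vertex j (i - 1)"
    then obtain i where "v = Leg j (Suc i)" "i < l" "u = leg_vertex j i"
      by (metis Suc_diff_le Suc_le_eq diff_Suc_1 le_add_diff_inverse plus_1_eq_Suc)
    then show "(u, v) \<in> {(leg_vertex j i, leg_vertex j (Suc i)) | i. i < l}"
      by (auto simp: leg_vertex_def)
  qed
  have fr: "(u, v) \<in> {(Center, Tri i b) | i b. i < s} \<union> {(Tri i False, Tri i True) | i. i < s} \<longleftrightarrow>
      (\<exists>i b. v = Tri i b \<and> i < s \<and> u = Center) \<or> (\<exists>i. u = Tri i False \<and> v = Tri i True \<and> i < s)" for u v
    by auto
  have "(u, v) \<in> parcs (path_friendship_graph s ls) \<longleftrightarrow>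
      ((\<exists>i b. v = Tri i b \<and> i < s \<and> u = Center) \<or> (\<exists>i. u = Tri i False \<and> v = Tri i True \<and> i < s)) \<or>
      ((\<exists>i b. u = Tri i b \<and> i < s \<and> v = Center) \<or> (\<exists>i. v = Tri i False \<and> u = Tri i True \<and> i < s)) \<or>
      (\<exists>j<length ls. (\<exists>i. v = Leg j i \<and> 1 \<le> i \<and> i \<le> ls ! j \<and> u = leg_vertex j (i - 1)) \<or>
        (\<exists>i. u = Leg j i \<and> 1 \<le> i \<and> i \<le> ls ! j \<and> v = leg_vertex j (i - 1)))"
    unfolding path_friendship_graph_def friendship_graph_def pendant_path_def Let_def
      pair_pre_digraph.simps Un_iff[of _ _ "\<Union> _"] Un_iff[of _ _ "_\<inverse>"] converse_iff fr UN_iff path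
    by blast
  then show ?thesis
    by (cases u; cases v) (auto simp: pf_edge_def leg_vertex_def split: if_splits)
qed

lemma pf_connected:
  fixes x :: "pf_vertex \<Rightarrow> real"
  assumes x0: "x Center = 0" and x: "\<And>u v. (u, v) \<in> parcs (path_friendship_graph s ls) \<Longrightarrow> \<bar>x u\<bar> = \<bar>x v\<bar>"
  shows "\<forall>v\<in>pverts (path_friendship_graph s ls). x v = 0"
proof
  have leg: "i \<le> ls ! j \<Longrightarrow> x (leg_vertex j i) = 0" if j: "j < length ls" for i j
  proof (induction i)
    case 0 then show ?case using x0 by (simp add: leg_vertex_def)
  next
    case (Suc i)
    have "(leg_vertex j (Suc i), leg_vertex j i) \<in> parcs (path_friendship_graph s ls)"
      unfolding parcs_path_friendship_graph using Suc.prems j by (simp add: pf_edge_def leg_vertex_def)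
    from x[OF this] Suc show ?case by simp
  qed
  fix v assume v: "v \<in> pverts (path_friendship_graph s ls)"
  show "x v = 0"
  proof (cases v)
    case Center then show ?thesis using x0 by simp
  next
    case (Tri i b)
    then have "(v, Center) \<in> parcs (path_friendship_graph s ls)"
      using v unfolding parcs_path_friendship_graph pverts_path_friendship_graph by (simp add: pf_edge_def)
    from x[OF this] x0 show ?thesis by simp
  next
    case (Leg j i)
    then show ?thesis using leg[of j i] v unfolding pverts_path_friendship_graph by (simp add: leg_vertex_def split: if_splits)
  qed
qed

lemma deg_pf_center:
  assumes "\<forall>l\<in>set ls. 1 \<le> l"
  shows "deg (path_friendship_graph s ls) Center = 2 * s + length ls"
proof -
  have "{w. (Center, w) \<in> parcs (path_friendship_graph s ls)}
      = (\<lambda>(i, b). Tri i b) ` ({..<s} \<times> UNIV) \<union> (\<lambda>j. Leg j 1) ` {..<length ls}" (is "_ = ?A \<union> ?B")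
  proof (rule Set.set_eqI)
    fix w
    show "w \<in> {w. (Center, w) \<in> parcs (path_friendship_graph s ls)} \<longleftrightarrow> w \<in> ?A \<union> ?B"
      using assms by (cases w) (auto simp: parcs_path_friendship_graph pf_edge_def leg_vertex_def image_iff split: if_splits)
  qed
  moreover have "card ?A = 2 * s"
    by (subst card_image) (auto simp: inj_on_def card_cartesian_product)
  moreover have "card ?B = length ls"
    by (subst card_image) (auto simp: inj_on_def)
  moreover have "?A \<inter> ?B = {}" "finite ?A" "finite ?B" by auto
  ultimately show ?thesis by (simp add: deg_eq_card card_Un_disjoint)
qed

lemma deg_pf_tri:
  assumes "i < s"
  shows "deg (path_friendship_graph s ls) (Tri i b) = 2"
proof -
  have "{w. (Tri i b, w) \<in> parcs (path_friendship_graph s ls)} = {Center, Tri i (\<not> b)}"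
  proof (rule Set.set_eqI)
    fix w
    show "w \<in> {w. (Tri i b, w) \<in> parcs (path_friendship_graph s ls)} \<longleftrightarrow> w \<in> {Center, Tri i (\<not> b)}"
      using assms by (cases w) (auto simp: parcs_path_friendship_graph pf_edge_def leg_vertex_def split: if_splits)
  qed
  then show ?thesis by (simp add: deg_eq_card)
qed

lemma deg_pf_leg:
  assumes "j < length ls" "1 \<le> i" "i \<le> ls ! j"
  shows "deg (path_friendship_graph s ls) (Leg j i) \<in> {1, 2}"
proof -
  have "{w. (Leg j i, w) \<in> parcs (path_friendship_graph s ls)}
    = insert (leg_vertex j (i - 1)) (if i < ls ! j then {Leg j (Suc i)} else {})"
  proof (rule Set.set_eqI)
    fix w
    show "w \<in> {w. (Leg j i, w) \<in> parcs (path_friendship_graph s ls)} \<longleftrightarrow>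
        w \<in> insert (leg_vertex j (i - 1)) (if i < ls ! j then {Leg j (Suc i)} else {})"
      using assms by (cases w) (auto simp: parcs_path_friendship_graph pf_edge_def leg_vertex_def split: if_splits)
  qed
  then show ?thesis by (auto simp: deg_eq_card leg_vertex_def)
qed

lemma deg_pf_noncenter:
  assumes "v \<in> pverts (path_friendship_graph s ls)" "v \<noteq> Center"
  shows "deg (path_friendship_graph s ls) v \<in> {1, 2}"
  using assms deg_pf_tri deg_pf_leg by (cases v) (auto simp: pverts_path_friendship_graph)

text \<open>Legs close no cycle and different triangles share only the center, so every closed
  triple is one of the six orderings in some \<open>f i\<close>.\<close>

lemma card_triangles_pf: "card (triangles (path_friendship_graph s ls)) \<le> 6 * s"
proof -
  define f where "f i = (let a = Center; b = Tri i False; c = Tri i True in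
    {(a, b, c), (a, c, b), (b, a, c), (b, c, a), (c, a, b), (c, b, a)})" for i
  have "triangles (path_friendship_graph s ls) \<subseteq> (\<Union>i<s. f i)"
  proof
    fix p assume p: "p \<in> triangles (path_friendship_graph s ls)"
    obtain u v w where uvw: "p = (u, v, w)" by (cases p)
    show "p \<in> (\<Union>i<s. f i)"
      using p unfolding uvw triangles_def f_def Let_def
      by (cases u; cases v; cases w)
        (auto simp: parcs_path_friendship_graph pf_edge_def leg_vertex_def split: if_splits)
  qed
  moreover have "finite (\<Union>i<s. f i)" by (auto simp: f_def Let_def)
  ultimately have "card (triangles (path_friendship_graph s ls)) \<le> card (\<Union>i<s. f i)"
    by (rule card_mono[rotated])
  also have "\<dots> \<le> (\<Sum>i<s. card (f i))" by (rule card_UN_le) simp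
  also have "\<dots> \<le> (\<Sum>i<s. 6)"
    by (intro sum_mono) (auto simp: f_def Let_def card_insert_if)
  finally show ?thesis by simp
qed

section \<open>Spanning trees of the graphs with one triangle\<close>

fun pf_depth :: "pf_vertex \<Rightarrow> nat" where
  "pf_depth Center = 0" | "pf_depth (Tri i b) = 1" | "pf_depth (Leg j i) = i"

fun pf_parent :: "pf_vertex \<Rightarrow> pf_vertex" where
  "pf_parent Center = Center" | "pf_parent (Tri i b) = Center" | "pf_parent (Leg j i) = leg_vertex j (i - 1)"

text \<open>Edges at a vertex \<open>v \<noteq> Center\<close> leading towards the center get the index of \<open>v\<close>, and the remaining
  edge, opposite to the center in the triangle, the index of \<open>Center\<close>. Enumerating the vertices by
  depth then makes the incidence matrix triangular outside row and column 0.\<close>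

lemma pf_one_triangle_trees:
  fixes ls :: "nat list"
  defines "G \<equiv> path_friendship_graph 1 ls"
  obtains vs where "vertex_enum G vs" "det (corner_mat 1 (laplacian_matrix G vs)) = 3"
    "(\<Sum>v\<in>pverts G. real (deg G v)) = 2 * real (card (pverts G))"
proof -
  have G: "pair_graph G" unfolding G_def by (rule pair_graph_path_friendship_graph)
  note V = pverts_path_friendship_graph[of _ 1 ls, folded G_def]
  note E = parcs_path_friendship_graph[of _ _ 1 ls, folded G_def]
  let ?F = "Tri 0 False" and ?T = "Tri 0 True"
  obtain us where us: "vertex_enum G us" using vertex_enum_exists[OF G] by blast
  \<comment> \<open>The center is the only vertex of depth 0 and thus gets index 0, the row that
    \<open>replace_row\<close> exchanges for the cycle vector.\<close>
  define vs where "vs = sort_key pf_depth us"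
  have vs: "vertex_enum G vs" using us by (simp add: vertex_enum_def vs_def)
  have inV: "Center \<in> pverts G" "?F \<in> pverts G" "?T \<in> pverts G" by (auto simp: V)
  have srt: "pf_depth (vs ! i) \<le> pf_depth (vs ! j)" if "i \<le> j" "j < length vs" for i j
    using sorted_nth_mono[OF sorted_sort_key[of pf_depth us, folded vs_def] that(1)] that by simp
  have depth0: "pf_depth v = 0 \<longleftrightarrow> v = Center" if "v \<in> pverts G" for v using that by (cases v) (auto simp: V)
  obtain k where k: "k < length vs" "vs ! k = Center" using vs inV by (metis in_set_conv_nth vertex_enum_def)
  have n: "0 < length vs" using k by auto
  have vs0: "vs ! 0 = Center" using srt[of 0 k] k depth0[OF vertex_enum_nth[OF vs n]] by simp
  have vsi: "vs ! i = vs ! j \<longleftrightarrow> i = j" if "i < length vs" "j < length vs" for i j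
    using vs that by (auto simp: vertex_enum_def nth_eq_iff_index_eq)
  have nC: "vs ! i \<noteq> Center" if "0 < i" "i < length vs" for i using vsi[of i 0] that n vs0 by auto
  have par: "pf_depth (pf_parent v) < pf_depth v" if "v \<in> pverts G" "v \<noteq> Center" for v
    using that by (cases v) (auto simp: V leg_vertex_def)
  define e where "e v = (if v = Center then (?F, ?T) else (v, pf_parent v))" for v
  define S where "S = e ` pverts G"
  have Sedge: "(u, v) \<in> S \<longleftrightarrow> pf_edge 1 ls u v" for u v
  proof (cases u)
    case Center then show ?thesis by (auto simp: S_def e_def pf_edge_def)
  next
    case (Tri i b)
    then show ?thesis using inV by (auto simp: S_def e_def pf_edge_def V image_iff split: if_splits)
  next
    case (Leg j i)
    then show ?thesis by (auto simp: S_def e_def pf_edge_def V image_iff split: if_splits intro!: bexI[of _ "Leg j i"])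
  qed
  have anti: "\<not> (pf_edge 1 ls u v \<and> pf_edge 1 ls v u)" for u v
    by (cases u; cases v) (auto simp: pf_edge_def leg_vertex_def split: if_splits)
  have or: "orientation G S"
    unfolding orientation_def using anti by (auto simp: Sedge E)
  have inj: "inj_on e (pverts G)"
    by (rule inj_onI) (auto simp: e_def split: if_splits elim: pf_parent.elims)
  define h where "h = (\<lambda>k. e (vs ! k))"
  have h: "bij_betw h {..<length vs} S"
    using bij_betw_trans[OF bij_betw_nth[of vs "{..<length vs}" "pverts G"], of e S] inj vs
    by (auto simp: S_def bij_betw_def vertex_enum_def h_def o_def)
  interpret integer_gram "length vs" "\<lambda>i k. inc (vs ! i) (h k)" by unfold_locales (rule n)
  \<comment> \<open>The circulation \<open>?F\<close> to \<open>?T\<close> to \<open>Center\<close>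
    and back to \<open>?F\<close>. Its three edges carry the indices of \<open>Center\<close>,
    \<open>?T\<close> and \<open>?F\<close>; the last one is oriented towards the center and hence
    traversed backwards.\<close>
  define y :: "pf_vertex \<Rightarrow> int" where
    "y v = (if v = Center then 1 else if v = ?F then -1 else if v = ?T then 1 else 0)" for v
  have sumy: "(\<Sum>v\<in>pverts G. f v) = f Center + f ?F + f ?T" if "\<And>v. y v = 0 \<Longrightarrow> f v = 0" for f :: "pf_vertex \<Rightarrow> int"
  proof -
    have "(\<Sum>v\<in>pverts G. f v) = (\<Sum>v\<in>{Center, ?F, ?T}. f v)"
      using inV pair_graphD(1)[OF G] that by (intro sum.mono_neutral_right) (auto simp: y_def)
    then show ?thesis by simp
  qed
  have "det (corner_mat 1 gram) = 3"
  proof (rule det_gram_of_triangular[of "\<lambda>k. y (vs ! k)"])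
    fix i assume i: "i < length vs"
    have "(\<Sum>k<length vs. inc (vs ! i) (h k) * y (vs ! k)) = (\<Sum>v\<in>pverts G. inc (vs ! i) (e v) * y v)"
      unfolding h_def by (rule sum_nth_enum[OF vs])
    also have "\<dots> = 0" by (subst sumy) (auto simp: y_def e_def inc_def)
    finally show "(\<Sum>k<length vs. inc (vs ! i) (h k) * y (vs ! k)) = 0" .
  next
    show "y (vs ! 0) = 1" by (simp add: vs0 y_def)
    have "(\<Sum>k<length vs. (y (vs ! k))\<^sup>2) = (\<Sum>v\<in>pverts G. (y v)\<^sup>2)" by (rule sum_nth_enum[OF vs])
    also have "\<dots> = 3" by (subst sumy) (auto simp: y_def)
    finally show "(\<Sum>k<length vs. (y (vs ! k))\<^sup>2) = 3" .
  next
    \<comment> \<open>Below the diagonal, \<open>vs ! i\<close> is at least as deep as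
      \<open>vs ! j\<close> and so strictly deeper than the parent of \<open>vs ! j\<close>: it is
      neither end of edge \<open>j\<close>.\<close>
    fix i j assume ij: "0 < j" "j < i" "i < length vs"
    have "vs ! i \<noteq> vs ! j" using vsi[of i j] ij by auto
    moreover have "vs ! i \<noteq> pf_parent (vs ! j)"
      using par[OF vertex_enum_nth[OF vs], of j] nC[of j] srt[of j i] ij by auto
    ultimately show "inc (vs ! i) (h j) = 0" using nC[of j] ij by (simp add: h_def e_def inc_def)
  next
    fix i assume i: "0 < i" "i < length vs"
    then have "vs ! i \<noteq> pf_parent (vs ! i)" using par[OF vertex_enum_nth[OF vs], of i] nC[of i] by auto
    then show "inc (vs ! i) (h i) = 1" using nC[of i] i by (simp add: h_def e_def inc_def)
  qed
  then have d: "det (corner_mat 1 (laplacian_matrix G vs)) = 3"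
    using gram_incidence[OF G vs n h or] det_corner_of_int[OF gram_carrier] by simp
  have "card S = card (pverts G)" unfolding S_def by (rule card_image[OF inj])
  then have "(\<Sum>v\<in>pverts G. real (deg G v)) = 2 * real (card (pverts G))"
    using orientation_card[OF G or] by simp
  with that vs d show ?thesis by blast
qed

section \<open>Graphs cospectral to a path-friendship graph\<close>

text \<open>Tail and head of an arc are its components in both graphs, so the arc map of the
  isomorphism is forced to be the vertex map applied to both components.\<close>

lemma digraph_iso_with_proj:
  fixes G :: "'a pair_pre_digraph" and P :: "'b pair_pre_digraph"
  assumes iso: "digraph_iso (with_proj P) (with_proj G)"
  obtains \<phi> where "inj_on \<phi> (pverts P)" "pverts G = \<phi> ` pverts P"
    "parcs G = (\<lambda>(u, v). (\<phi> u, \<phi> v)) ` parcs P"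
proof -
  obtain f where f: "pre_digraph.digraph_isomorphism (with_proj P) f" and G: "with_proj G = app_iso f (with_proj P)"
    using iso by (auto simp: digraph_iso_def)
  have eqs: "pverts G = iso_verts f ` pverts P" "parcs G = iso_arcs f ` parcs P" "fst = iso_tail f" "snd = iso_head f"
    using arg_cong[OF G, of verts] arg_cong[OF G, of arcs] arg_cong[OF G, of tail] arg_cong[OF G, of head]
    by (simp_all add: app_iso_def)
  have "iso_arcs f p = (\<lambda>(u, v). (iso_verts f u, iso_verts f v)) p" if "p \<in> parcs P" for p
    using f that unfolding pre_digraph.digraph_isomorphism_def eqs(3,4)[symmetric]
    by (auto simp: prod_eq_iff case_prod_unfold)
  then have "parcs G = (\<lambda>(u, v). (iso_verts f u, iso_verts f v)) ` parcs P"
    unfolding eqs(2) by (intro image_cong refl)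
  moreover have "inj_on (iso_verts f) (pverts P)"
    using f by (simp add: pre_digraph.digraph_isomorphism_def)
  ultimately show ?thesis using that eqs(1) by blast
qed

text \<open>An enumeration of \<open>P\<close> carried over to \<open>G\<close> by the isomorphism
  yields the very same Laplacian matrix.\<close>

lemma isomorphic_spectrum_degrees:
  fixes G :: "'a pair_pre_digraph" and P :: "'b pair_pre_digraph"
  assumes P: "pair_graph P" and iso: "digraph_iso (with_proj P) (with_proj G)"
  shows "laplacian_spectrum G = laplacian_spectrum P" "degree_sequence G = degree_sequence P"
proof -
  obtain \<phi> where inj: "inj_on \<phi> (pverts P)" and V: "pverts G = \<phi> ` pverts P"
    and E: "parcs G = (\<lambda>(u, v). (\<phi> u, \<phi> v)) ` parcs P" using digraph_iso_with_proj[OF iso] .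
  note P' = pair_graphD[OF P]
  have adj: "(\<phi> u, \<phi> v) \<in> parcs G \<longleftrightarrow> (u, v) \<in> parcs P" if "u \<in> pverts P" "v \<in> pverts P" for u v
  proof
    assume "(\<phi> u, \<phi> v) \<in> parcs G"
    then obtain a b where ab: "(a, b) \<in> parcs P" "\<phi> u = \<phi> a" "\<phi> v = \<phi> b" by (auto simp: E)
    have "u = a" "v = b"
      using inj_onD[OF inj ab(2)] inj_onD[OF inj ab(3)] that P'(3)[OF ab(1)] P'(4)[OF ab(1)] by simp_all
    with ab(1) show "(u, v) \<in> parcs P" by simp
  qed (auto simp: E)
  have deg: "deg G (\<phi> u) = deg P u" if u: "u \<in> pverts P" for u
  proof -
    have "{w. (\<phi> u, w) \<in> parcs G} = \<phi> ` {w. (u, w) \<in> parcs P}"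
    proof
      show "{w. (\<phi> u, w) \<in> parcs G} \<subseteq> \<phi> ` {w. (u, w) \<in> parcs P}"
      proof
        fix w assume "w \<in> {w. (\<phi> u, w) \<in> parcs G}"
        then obtain a b where ab: "(a, b) \<in> parcs P" "\<phi> a = \<phi> u" "w = \<phi> b" by (auto simp: E)
        then have "a = u" using inj_onD[OF inj ab(2)] u P'(3)[OF ab(1)] by simp
        with ab show "w \<in> \<phi> ` {w. (u, w) \<in> parcs P}" by auto
      qed
      show "\<phi> ` {w. (u, w) \<in> parcs P} \<subseteq> {w. (\<phi> u, w) \<in> parcs G}" by (auto simp: E)
    qed
    moreover have "inj_on \<phi> {w. (u, w) \<in> parcs P}" using inj P'(4) by (auto intro: inj_on_subset)
    ultimately show ?thesis by (simp add: deg_eq_card card_image)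
  qed
  obtain vs where vs: "vertex_enum P vs" using vertex_enum_exists[OF P] by blast
  have ws: "vertex_enum G (map \<phi> vs)"
    using vs inj V by (simp add: vertex_enum_def distinct_map)
  have "laplacian_matrix G (map \<phi> vs) = laplacian_matrix P vs"
    using vs by (intro eq_matI) (auto simp: laplacian_matrix_def degree_matrix_def adjacency_matrix_def
        adj deg vertex_enum_nth[OF vs])
  then show "laplacian_spectrum G = laplacian_spectrum P"
    by (simp add: laplacian_spectrum_eq[OF vs] laplacian_spectrum_eq[OF ws])
  have "image_mset (deg G) (mset_set (pverts G)) = image_mset (\<lambda>u. deg G (\<phi> u)) (mset_set (pverts P))"
    unfolding V image_mset_mset_set[OF inj, symmetric] by (simp add: image_mset.compositionality o_def)
  also have "\<dots> = image_mset (deg P) (mset_set (pverts P))"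
    using P'(1) deg by (intro image_mset_cong) simp
  finally show "degree_sequence G = degree_sequence P" by (simp add: degree_sequence_def)
qed

text \<open>Size and sum are two independent linear equations for the two multiplicities.\<close>

lemma mset_ones_twos_eq:
  fixes M N :: "nat multiset"
  assumes "set_mset M \<subseteq> {1, 2}" "set_mset N \<subseteq> {1, 2}" "size M = size N" "sum_mset M = sum_mset N"
  shows "M = N"
proof -
  have d: "K = replicate_mset (count K 1) 1 + replicate_mset (count K 2) 2" if "set_mset K \<subseteq> {1, 2}" for K :: "nat multiset"
    using that by (intro multiset_eqI) (auto simp: count_eq_zero_iff)
  have s: "size K = count K 1 + count K 2" "sum_mset K = count K 1 + 2 * count K 2" if "set_mset K \<subseteq> {1, 2}" for K :: "nat multiset"
  proof -
    show "size K = count K 1 + count K 2" using arg_cong[OF d[OF that], of size] by simp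
    show "sum_mset K = count K 1 + 2 * count K 2" using arg_cong[OF d[OF that], of sum_mset] by simp
  qed
  have "count M 1 = count N 1" "count M 2 = count N 2"
    using s[OF assms(1)] s[OF assms(2)] assms(3,4) by linarith+
  then show ?thesis using d[OF assms(1)] d[OF assms(2)] by metis
qed

section \<open>The butterfly\<close>

lemma pverts_butterfly:
  "pverts (path_friendship_graph 2 []) = {Center, Tri 0 False, Tri 0 True, Tri 1 False, Tri 1 True}"
proof (rule Set.set_eqI)
  fix v
  show "v \<in> pverts (path_friendship_graph 2 []) \<longleftrightarrow> v \<in> {Center, Tri 0 False, Tri 0 True, Tri 1 False, Tri 1 True}"
    unfolding pverts_path_friendship_graph by (cases v) (auto simp: less_2_cases_iff)
qed

text \<open>The butterfly has eigenvalue \<open>5 = n\<close>, so the complement of \<open>H\<close> is disconnected; a vertex of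
  degree 1 and the degree bound rule this out.\<close>

lemma not_cospectral_butterfly:
  fixes H :: "'b pair_pre_digraph"
  defines "G \<equiv> path_friendship_graph 2 []"
  assumes H: "pair_graph H" and co: "L_cospectral H G" and le3: "\<And>v. v \<in> pverts H \<Longrightarrow> deg H v \<le> 3"
    and ex1: "\<exists>p\<in>pverts H. deg H p = 1"
  shows False
proof -
  have G: "pair_graph G" unfolding G_def by (rule pair_graph_path_friendship_graph)
  note H' = pair_graphD[OF H]
  have V: "pverts G = {Center, Tri 0 False, Tri 0 True, Tri 1 False, Tri 1 True}"
    unfolding G_def by (rule pverts_butterfly)
  have c5: "card (pverts G) = 5" by (simp add: V)
  obtain mu e mu' e' where cH: "card (pverts H) = card (pverts G)"
    and EG: "eigenbasis (pverts G) (card (pverts G)) (lap G) mu e"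
    and EH: "eigenbasis (pverts H) (card (pverts G)) (lap H) mu' e'"
    and eq: "image_mset mu' (mset_set {..<card (pverts G)}) = image_mset mu (mset_set {..<card (pverts G)})"
    using cospectral_eigenbases[OF G H co] .
  \<comment> \<open>The center is adjacent to all other vertices, and for such a vertex the vector
    with \<open>n - 1\<close> there and -1 elsewhere has the eigenvalue
    \<open>n = 5\<close>.\<close>
  define x :: "pf_vertex \<Rightarrow> real" where "x v = (if v = Center then 4 else -1)" for v
  have "\<exists>i<card (pverts G). mu i = 5"
  proof (rule eigenbasis.eigenvalue_in_basis[OF EG])
    fix u assume u: "u \<in> pverts G"
    have "(\<Sum>v | (u, v) \<in> parcs G. x u - x v) = 5 * x u"
    proof (cases u)
      case Center
      then have "{v. (u, v) \<in> parcs G} = {Tri 0 False, Tri 0 True, Tri 1 False, Tri 1 True}"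
        unfolding G_def parcs_path_friendship_graph
        by (intro Set.set_eqI, rename_tac v, case_tac v) (auto simp: pf_edge_def less_2_cases_iff)
      then show ?thesis using Center by (simp add: x_def)
    next
      case (Tri i b)
      then have "i < 2" using u by (auto simp: G_def pverts_path_friendship_graph)
      then have "{v. (u, v) \<in> parcs G} = {Center, Tri i (\<not> b)}"
        unfolding G_def Tri parcs_path_friendship_graph
        by (intro Set.set_eqI, rename_tac v, case_tac v) (auto simp: pf_edge_def)
      then show ?thesis using Tri by (simp add: x_def)
    next
      case (Leg j i)
      then show ?thesis using u by (simp add: V)
    qed
    then show "(\<Sum>v\<in>pverts G. lap G u v * x v) = 5 * x u" by (simp add: sum_lap_mult[OF G u])
  next
    show "\<exists>v\<in>pverts G. x v \<noteq> 0" by (rule bexI[of _ Center]) (auto simp: x_def V)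
  qed
  then have "5 \<in># image_mset mu (mset_set {..<card (pverts G)})" by force
  then have "5 \<in># image_mset mu' (mset_set {..<card (pverts G)})" by (simp only: eq)
  then obtain i where i: "i < card (pverts G)" "mu' i = 5" by force
  define y where "y = e' i"
  have y: "(\<Sum>v\<in>pverts H. lap H u v * y v) = 5 * y u" if "u \<in> pverts H" for u
    using eigenbasis.eigenvector[OF EH i(1) that] i(2) by (simp add: y_def)
  have nrm: "(\<Sum>v\<in>pverts H. (y v)\<^sup>2) = 1"
    using eigenbasis.orth[OF EH i(1) i(1)] by (simp add: y_def power2_eq_square)
  have "5 * (\<Sum>u\<in>pverts H. y u) = (\<Sum>u\<in>pverts H. \<Sum>v\<in>pverts H. lap H u v * y v)"
    by (simp add: sum_distrib_left y)
  also have "\<dots> = (\<Sum>v\<in>pverts H. y v * (\<Sum>u\<in>pverts H. lap H v u))"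
    by (subst sum.swap) (simp add: sum_distrib_left lap_sym[OF H] mult.commute)
  also have "\<dots> = 0" by (simp add: sum_lap_row[OF H])
  finally have sum0: "(\<Sum>u\<in>pverts H. y u) = 0" by simp
  \<comment> \<open>Over all ordered pairs the sum is
    \<open>2 n |y|^2 - 2 (sum of y)^2 = 10\<close>; over the arcs it is twice the form,
    \<open>2 * 5 * |y|^2\<close>, again 10. So nonadjacent pairs contribute nothing, and
    \<open>y\<close> is constant along the edges of the complement.\<close>
  have all: "(\<Sum>(u, v)\<in>pverts H \<times> pverts H. (y u - y v)\<^sup>2) = 10"
  proof -
    have "(\<Sum>(u, v)\<in>pverts H \<times> pverts H. (y u - y v)\<^sup>2)
        = (\<Sum>u\<in>pverts H. \<Sum>v\<in>pverts H. (y u)\<^sup>2 + (y v)\<^sup>2 - 2 * y u * y v)"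
      by (simp add: sum.cartesian_product power2_diff)
    also have "\<dots> = 10"
      by (simp add: sum.distrib sum_subtractf nrm cH c5 sum_distrib_left[symmetric] sum0)
    finally show ?thesis .
  qed
  have arcs: "(\<Sum>(u, v)\<in>parcs H. (y u - y v)\<^sup>2) = 10"
  proof -
    have "(\<Sum>(u, v)\<in>parcs H. (y u - y v)\<^sup>2) = 2 * (\<Sum>u\<in>pverts H. y u * (\<Sum>v\<in>pverts H. lap H u v * y v))"
      by (simp add: lap_form[OF H, symmetric] sum_distrib_left mult.assoc)
    also have "\<dots> = 2 * (\<Sum>u\<in>pverts H. 5 * (y u)\<^sup>2)" by (simp add: y power2_eq_square mult.left_commute)
    also have "\<dots> = 10" by (simp add: sum_distrib_left[symmetric] nrm)
    finally show ?thesis .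
  qed
  have sub: "parcs H \<subseteq> pverts H \<times> pverts H" using H'(3,4) by auto
  have "(\<Sum>(u, v)\<in>pverts H \<times> pverts H - parcs H. (y u - y v)\<^sup>2) = 0"
    using sum.subset_diff[OF sub, of "\<lambda>(u, v). (y u - y v)\<^sup>2"] H'(1) all arcs by simp
  then have zero: "\<forall>p\<in>pverts H \<times> pverts H - parcs H. (\<lambda>(u, v). (y u - y v)\<^sup>2) p = 0"
    using H'(1) by (subst (asm) sum_nonneg_eq_0_iff) auto
  have nonadj: "y u = y v" if "u \<in> pverts H" "v \<in> pverts H" "(u, v) \<notin> parcs H" for u v
  proof -
    have "(u, v) \<in> pverts H \<times> pverts H - parcs H" using that by simp
    from bspec[OF zero this] show ?thesis by simp
  qed
  obtain p where p: "p \<in> pverts H" "deg H p = 1" using ex1 by blast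
  then obtain q where q: "{w. (p, w) \<in> parcs H} = {q}" by (auto simp: deg_eq_card card_1_singleton_iff)
  have qV: "q \<in> pverts H" using q H'(4)[of p q] by blast
  \<comment> \<open>In the complement \<open>p\<close> is joined to everything but
    \<open>q\<close>.\<close>
  have yv: "y v = y p" if "v \<in> pverts H" "v \<noteq> q" for v
  proof -
    have "v \<notin> {w. (p, w) \<in> parcs H}" unfolding q using that(2) by simp
    then have "y p = y v" by (intro nonadj[OF p(1) that(1)]) simp
    then show ?thesis by simp
  qed
  \<comment> \<open>The degree of \<open>q\<close> is at most 3, while there are four other
    vertices, so \<open>q\<close> too has a neighbor in the complement. Then \<open>y\<close> is
    constant with sum 0, against its norm 1.\<close>
  have yq: "y q = y p"
  proof -
    have "\<exists>v\<in>pverts H - {q}. (q, v) \<notin> parcs H"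
    proof (rule ccontr)
      assume "\<not> ?thesis"
      then have "pverts H - {q} \<subseteq> {w. (q, w) \<in> parcs H}" by blast
      moreover have "finite {w. (q, w) \<in> parcs H}"
        using finite_subset[OF _ H'(1), of "{w. (q, w) \<in> parcs H}"] H'(4) by auto
      ultimately have "card (pverts H - {q}) \<le> deg H q" unfolding deg_eq_card by (intro card_mono)
      then show False using le3[OF qV] H'(1) qV cH c5 by simp
    qed
    then obtain v where v: "v \<in> pverts H" "v \<noteq> q" "(q, v) \<notin> parcs H" by blast
    then show ?thesis using nonadj[OF qV v(1) v(3)] yv[OF v(1) v(2)] by simp
  qed
  have const: "y v = y p" if "v \<in> pverts H" for v using yv[OF that] yq by (cases "v = q") simp_all
  have "(\<Sum>u\<in>pverts H. y u) = 5 * y p" using const cH c5 by simp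
  then have "y p = 0" using sum0 by simp
  then have "(\<Sum>v\<in>pverts H. (y v)\<^sup>2) = 0" using const by simp
  with nrm show False by simp
qed

section \<open>Arithmetic of degree sums\<close>

lemma degree_polynomial_nonneg: "0 \<le> (int d - 1) * (int d - 2)"
proof -
  consider "d = 0" | "d = 1" | "d \<ge> 2" by linarith
  then show ?thesis by cases auto
qed

lemma degree_polynomial_eq_0: "(int d - 1) * (int d - 2) = 0 \<longleftrightarrow> d \<in> {1, 2}"
  by auto

lemma cubic_mono:
  fixes a b :: nat
  assumes "1 \<le> a" "a \<le> b"
  shows "(int a - 1) * (int a - 2) * (int a - 3) \<le> (int b - 1) * (int b - 2) * (int b - 3)"
proof (cases "a \<le> 3")
  case True
  with assms have "a = 1 \<or> a = 2 \<or> a = 3" by linarith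
  then have a: "(int a - 1) * (int a - 2) * (int a - 3) = 0" by auto
  have "0 \<le> (int b - 1) * (int b - 2) * (int b - 3)"
  proof (cases "b \<le> 2")
    case True
    with assms have "b = 1 \<or> b = 2" by linarith
    then show ?thesis by auto
  qed auto
  with a show ?thesis by linarith
next
  case False
  then show ?thesis using assms by (intro mult_mono) auto
qed

lemma sum_degree_polynomials:
  fixes f :: "'a \<Rightarrow> nat"
  shows "real_of_int (\<Sum>v\<in>V. (int (f v) - 1) * (int (f v) - 2))
    = (\<Sum>v\<in>V. (real (f v))\<^sup>2) - 3 * (\<Sum>v\<in>V. real (f v)) + 2 * real (card V)"
  and "real_of_int (\<Sum>v\<in>V. (int (f v) - 1) * (int (f v) - 2) * (int (f v) - 3))
    = (\<Sum>v\<in>V. real (f v) ^ 3) - 6 * (\<Sum>v\<in>V. (real (f v))\<^sup>2) + 11 * (\<Sum>v\<in>V. real (f v)) - 6 * real (card V)"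
proof -
  have "real_of_int ((int d - 1) * (int d - 2)) = (real d)\<^sup>2 - 3 * real d + 2" for d
    by (simp add: power2_eq_square algebra_simps)
  then show "real_of_int (\<Sum>v\<in>V. (int (f v) - 1) * (int (f v) - 2))
      = (\<Sum>v\<in>V. (real (f v))\<^sup>2) - 3 * (\<Sum>v\<in>V. real (f v)) + 2 * real (card V)"
    unfolding of_int_sum by (simp only: sum.distrib sum_subtractf sum_distrib_left) simp
  have "real_of_int ((int d - 1) * (int d - 2) * (int d - 3)) = real d ^ 3 - 6 * (real d)\<^sup>2 + 11 * real d - 6" for d
    by (simp add: power2_eq_square power3_eq_cube algebra_simps)
  then show "real_of_int (\<Sum>v\<in>V. (int (f v) - 1) * (int (f v) - 2) * (int (f v) - 3))
      = (\<Sum>v\<in>V. real (f v) ^ 3) - 6 * (\<Sum>v\<in>V. (real (f v))\<^sup>2) + 11 * (\<Sum>v\<in>V. real (f v)) - 6 * real (card V)"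
    unfolding of_int_sum by (simp only: sum.distrib sum_subtractf sum_distrib_left) simp
qed

lemma cospectral_degree_polynomials:
  assumes G: "pair_graph G" and H: "pair_graph H" and co: "L_cospectral H G"
  shows "(\<Sum>v\<in>pverts H. (int (deg H v) - 1) * (int (deg H v) - 2))
      = (\<Sum>v\<in>pverts G. (int (deg G v) - 1) * (int (deg G v) - 2))"
    and "(\<Sum>v\<in>pverts H. (int (deg H v) - 1) * (int (deg H v) - 2) * (int (deg H v) - 3)) - int (card (triangles H))
      = (\<Sum>v\<in>pverts G. (int (deg G v) - 1) * (int (deg G v) - 2) * (int (deg G v) - 3)) - int (card (triangles G))"
    and "(\<Sum>v\<in>pverts H. deg H v) = (\<Sum>v\<in>pverts G. deg G v)"
proof -
  note m = cospectral_moments[OF assms]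
  have "real_of_int (\<Sum>v\<in>pverts H. (int (deg H v) - 1) * (int (deg H v) - 2))
      = real_of_int (\<Sum>v\<in>pverts G. (int (deg G v) - 1) * (int (deg G v) - 2))"
    unfolding sum_degree_polynomials using m by simp
  then show "(\<Sum>v\<in>pverts H. (int (deg H v) - 1) * (int (deg H v) - 2))
      = (\<Sum>v\<in>pverts G. (int (deg G v) - 1) * (int (deg G v) - 2))" by (simp only: of_int_eq_iff)
  have "real_of_int ((\<Sum>v\<in>pverts H. (int (deg H v) - 1) * (int (deg H v) - 2) * (int (deg H v) - 3)) - int (card (triangles H)))
      = real_of_int ((\<Sum>v\<in>pverts G. (int (deg G v) - 1) * (int (deg G v) - 2) * (int (deg G v) - 3)) - int (card (triangles G)))"
    unfolding of_int_diff[where ?'a = real] sum_degree_polynomials using m by simp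
  then show "(\<Sum>v\<in>pverts H. (int (deg H v) - 1) * (int (deg H v) - 2) * (int (deg H v) - 3)) - int (card (triangles H))
      = (\<Sum>v\<in>pverts G. (int (deg G v) - 1) * (int (deg G v) - 2) * (int (deg G v) - 3)) - int (card (triangles G))"
    by (simp only: of_int_eq_iff)
  show "(\<Sum>v\<in>pverts H. deg H v) = (\<Sum>v\<in>pverts G. deg G v)"
    using m(2) by (simp flip: of_nat_sum)
qed

lemma deg_only_vertex:
  assumes G: "pair_graph G" and v: "pverts G = {v}"
  shows "deg G v = 0"
proof -
  have "(v, w) \<notin> parcs G" for w
  proof
    assume vw: "(v, w) \<in> parcs G"
    then have "w = v" using pair_graphD(4)[OF G vw] v by simp
    with vw pair_graphD(6)[OF G, of v] show False by simp
  qed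
  then show ?thesis by (simp add: deg_eq_card)
qed

lemma degree_mset_remove:
  assumes "finite V" "c \<in> V"
  shows "image_mset f (mset_set V) = add_mset (f c) (image_mset f (mset_set (V - {c})))"
  using assms by (metis image_mset_add_mset mset_set.remove)

lemma degree_mset_eq:
  fixes f :: "'a \<Rightarrow> nat" and g :: "'b \<Rightarrow> nat"
  assumes fin: "finite V" "finite W" and card: "card V = card W" and sum: "sum f V = sum g W"
    and "\<And>v. v \<in> V \<Longrightarrow> f v \<in> {1, 2}" "\<And>v. v \<in> W \<Longrightarrow> g v \<in> {1, 2}"
  shows "image_mset f (mset_set V) = image_mset g (mset_set W)"
  using assms by (intro mset_ones_twos_eq) (auto simp: sum_unfold_sum_mset)

lemma cospectral_pf_no_smaller_max_degree:
  fixes H :: "'b pair_pre_digraph" and s :: nat and ls :: "nat list"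
  defines "G \<equiv> path_friendship_graph s ls"
  assumes H: "pair_graph H" and co: "L_cospectral H G"
    and w: "w \<in> pverts H" and max: "\<And>v. v \<in> pverts H \<Longrightarrow> deg H v \<le> deg H w"
    and bounds: "\<And>v. v \<in> pverts H \<Longrightarrow> 1 \<le> deg H v" "\<And>v. v \<in> pverts H \<Longrightarrow> v \<noteq> w \<Longrightarrow> deg H v \<le> 3"
    and D: "3 \<le> 2 * s + length ls" and less: "deg H w < 2 * s + length ls"
    and M: "(\<Sum>v\<in>pverts H. (int (deg H v) - 1) * (int (deg H v) - 2))
      = (int (2 * s + length ls) - 1) * (int (2 * s + length ls) - 2)"
    and C: "(\<Sum>v\<in>pverts H. (int (deg H v) - 1) * (int (deg H v) - 2) * (int (deg H v) - 3)) - int (card (triangles H))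
      = (int (2 * s + length ls) - 1) * (int (2 * s + length ls) - 2) * (int (2 * s + length ls) - 3) - int (card (triangles G))"
  shows False
proof -
  have G: "pair_graph G" unfolding G_def by (rule pair_graph_path_friendship_graph)
  note H' = pair_graphD[OF H]
  define d where "d = 2 * s + length ls"
  define a where "a = deg H w"
  have cub: "(\<Sum>v\<in>pverts H. (int (deg H v) - 1) * (int (deg H v) - 2) * (int (deg H v) - 3))
      = (int a - 1) * (int a - 2) * (int a - 3)"
  proof -
    have "(\<Sum>v\<in>pverts H - {w}. (int (deg H v) - 1) * (int (deg H v) - 2) * (int (deg H v) - 3)) = 0"
    proof (rule sum.neutral, rule ballI)
      fix v assume "v \<in> pverts H - {w}"
      then have "deg H v = 1 \<or> deg H v = 2 \<or> deg H v = 3" using bounds(1)[of v] bounds(2)[of v] by auto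
      then show "(int (deg H v) - 1) * (int (deg H v) - 2) * (int (deg H v) - 3) = 0" by auto
    qed
    then show ?thesis
      using sum.remove[OF H'(1) w, of "\<lambda>v. (int (deg H v) - 1) * (int (deg H v) - 2) * (int (deg H v) - 3)"]
      by (simp add: a_def)
  qed
  have tG: "int (card (triangles G)) \<le> 6 * int s" using card_triangles_pf[of s ls] unfolding G_def by linarith
  have a: "1 \<le> a" "a \<le> d - 1" using bounds(1)[OF w] less by (auto simp: a_def d_def)
  have cd: "int (d - 1) = int d - 1" using D by (simp add: d_def)
  have "(int a - 1) * (int a - 2) * (int a - 3) \<le> (int d - 2) * (int d - 3) * (int d - 4)"
    using cubic_mono[OF a] unfolding cd by (simp add: algebra_simps)
  \<comment> \<open>The drop of the cubic from \<open>d\<close> to \<open>d - 1\<close>, the best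
    case for H. By \<open>C\<close> it bounds the triangles of H from above, and as their number is
    nonnegative it bounds \<open>d\<close>.\<close>
  moreover have "(int d - 1) * (int d - 2) * (int d - 3) - (int d - 2) * (int d - 3) * (int d - 4) = 3 * ((int d - 2) * (int d - 3))"
    by (simp add: algebra_simps)
  ultimately have tH: "int (card (triangles H)) \<le> 6 * int s - 3 * ((int d - 2) * (int d - 3))"
    using C cub tG unfolding d_def[symmetric] by linarith
  then have s2: "(int d - 2) * (int d - 3) \<le> 2 * int s" by linarith
  have sd: "2 * int s \<le> int d" by (simp add: d_def)
  have "d \<le> 4"
  proof (rule ccontr)
    assume "\<not> d \<le> 4"
    then have "(int d - 2) * 2 \<le> (int d - 2) * (int d - 3)" by (intro mult_left_mono) auto
    then have "(int d - 2) * 2 \<le> 2 * int s" using s2 by (rule order_trans)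
    with sd have "int d \<le> 4" by (simp add: algebra_simps)
    with \<open>\<not> d \<le> 4\<close> show False by simp
  qed
  moreover have "d \<noteq> 3"
  proof
    assume d3: "d = 3"
    \<comment> \<open>All degrees of H would be 1 or 2, but \<open>M\<close> gives the value
      2.\<close>
    have "(\<Sum>v\<in>pverts H. (int (deg H v) - 1) * (int (deg H v) - 2)) = 0"
    proof (rule sum.neutral, rule ballI)
      fix v assume "v \<in> pverts H"
      then have "deg H v = 1 \<or> deg H v = 2" using bounds(1)[of v] max[of v] a d3 by (auto simp: a_def)
      then show "(int (deg H v) - 1) * (int (deg H v) - 2) = 0" by auto
    qed
    with M d3 show False unfolding d_def[symmetric] by simp
  qed
  ultimately have d4: "d = 4" using D unfolding d_def[symmetric] by linarith
  have le3: "deg H v \<le> 3" if "v \<in> pverts H" for v using max[OF that] a d4 by (simp add: a_def)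
  have sum: "(\<Sum>v\<in>pverts H. real (deg H v)) = (\<Sum>v\<in>pverts G. real (deg G v))"
    and card: "card (pverts H) = card (pverts G)" using cospectral_moments(1,2)[OF G H co] by auto
  \<comment> \<open>For \<open>d = 4\<close> the bounds \<open>s2\<close> and \<open>sd\<close> read
    \<open>2 \<le> 2 s \<le> 4\<close>.\<close>
  consider "s = 1" | "s = 2" using s2 sd d4 by force
  then show False
  proof cases
    case 1
    obtain vs where vs: "vertex_enum G vs" and det3: "det (corner_mat 1 (laplacian_matrix G vs)) = 3"
      and sG: "(\<Sum>v\<in>pverts G. real (deg G v)) = 2 * real (card (pverts G))"
      using pf_one_triangle_trees[of ls] 1 unfolding G_def by blast
    obtain ws where ws: "vertex_enum H ws" using vertex_enum_exists[OF H] by blast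
    have "pverts G \<noteq> {}" "pverts H \<noteq> {}" using w card H'(1) by auto
    then have "triangles H \<noteq> {}"
      using cospectral_det_corner[OF G H co vs ws] det3 sG sum card
      by (intro unicyclic_three_trees_triangle[OF H ws]) simp_all
    \<comment> \<open>The bound \<open>tH\<close> is now \<open>6 - 3 * 2 = 0\<close>.\<close>
    moreover have "card (triangles H) = 0" using tH 1 d4 by simp
    moreover have "finite (triangles H)"
      by (rule finite_subset[of _ "pverts H \<times> pverts H \<times> pverts H"]) (use H' in \<open>auto simp: triangles_def\<close>)
    ultimately show False by simp
  next
    case 2
    then have "ls = []" using d4 by (simp add: d_def)
    with 2 have G2: "G = path_friendship_graph 2 []" by (simp add: G_def)
    have V: "pverts G = {Center, Tri 0 False, Tri 0 True, Tri 1 False, Tri 1 True}"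
      unfolding G2 by (rule pverts_butterfly)
    have c5: "card (pverts H) = 5" using card by (simp add: V)
    have "real (\<Sum>v\<in>pverts H. deg H v) = 12"
      using sum deg_pf_center[of "[]" 2] deg_pf_tri[of 0 2 "[]"] deg_pf_tri[of 1 2 "[]"] by (simp add: V G2[symmetric])
    then have s12: "(\<Sum>v\<in>pverts H. deg H v) = 12" by linarith
    have "\<exists>p\<in>pverts H. deg H p = 1"
    proof (rule ccontr)
      assume no: "\<not> ?thesis"
      \<comment> \<open>On the degrees 2 and 3 the quadratic agrees with \<open>2 d - 4\<close>. Its
        sum would be \<open>2 * 12 - 4 * 5 = 4\<close>, whereas \<open>M\<close> says 6.\<close>
      have "(\<Sum>v\<in>pverts H. (int (deg H v) - 1) * (int (deg H v) - 2)) = (\<Sum>v\<in>pverts H. 2 * int (deg H v) - 4)"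
      proof (rule sum.cong[OF refl])
        fix v assume v: "v \<in> pverts H"
        then have "deg H v = 2 \<or> deg H v = 3" using bounds(1)[OF v] le3[OF v] no by (metis One_nat_def Suc_leI le_antisym le_less numeral_2_eq_2 numeral_3_eq_3 not_less_eq_eq)
        then show "(int (deg H v) - 1) * (int (deg H v) - 2) = 2 * int (deg H v) - 4" by auto
      qed
      also have "\<dots> = 2 * int (\<Sum>v\<in>pverts H. deg H v) - 4 * int (card (pverts H))"
        by (simp add: sum_subtractf sum_distrib_left)
      finally show False using M c5 s12 d4 unfolding d_def[symmetric] by simp
    qed
    then show False using not_cospectral_butterfly[OF H] co le3 unfolding G2 by blast
  qed
qed

lemma cospectral_pf_degree_sequence:
  fixes H :: "'b pair_pre_digraph" and s :: nat and ls :: "nat list"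
  defines "G \<equiv> path_friendship_graph s ls"
  assumes ls: "\<forall>l\<in>set ls. 1 \<le> l" and H: "pair_graph H" and co: "L_cospectral H G"
  shows "degree_sequence H = degree_sequence G"
proof -
  have G: "pair_graph G" unfolding G_def by (rule pair_graph_path_friendship_graph)
  note G' = pair_graphD[OF G] and H' = pair_graphD[OF H]
  note poly = cospectral_degree_polynomials[OF G H co]
  define d where "d = 2 * s + length ls"
  have card: "card (pverts H) = card (pverts G)" by (rule cospectral_moments(1)[OF G H co])
  have cV: "Center \<in> pverts G" by (simp add: G_def pverts_path_friendship_graph)
  have dC: "deg G Center = d" unfolding G_def d_def by (rule deg_pf_center[OF ls])
  have d12: "deg G v \<in> {1, 2}" if "v \<in> pverts G" "v \<noteq> Center" for v
    using deg_pf_noncenter that unfolding G_def by blast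
  have small: "deg G v \<le> 2" if "v \<in> pverts G" "v \<noteq> Center" for v using d12[OF that] by auto
  have conn: "\<forall>v\<in>pverts G. x v = 0" if "x Center = 0" "\<And>u v. (u, v) \<in> parcs G \<Longrightarrow> \<bar>x u\<bar> = \<bar>x v\<bar>"
    for x :: "pf_vertex \<Rightarrow> real"
    using that unfolding G_def by (rule pf_connected)
  have bound3: "deg H v \<le> 3" if "u \<in> pverts H" "v \<in> pverts H" "u \<noteq> v" "4 \<le> deg H u" for u v
    by (rule cospectral_degree_bounds(1)[OF G H co small _ that, of Center]) (assumption+, rule conn, assumption+)
  have bound1: "1 \<le> deg H u" if "u \<in> pverts H" "2 \<le> card (pverts H)" for u
    by (rule cospectral_degree_bounds(2)[OF G H co small _ that, of Center]) (assumption+, rule conn, assumption+)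
  have "image_mset (deg H) (mset_set (pverts H)) = image_mset (deg G) (mset_set (pverts G))"
  proof (cases "2 \<le> card (pverts G)")
    case False
    \<comment> \<open>A single vertex has degree 0, which escapes the lower bound
      \<open>bound1\<close>.\<close>
    have "card (pverts G) \<noteq> 0" using cV G'(1) by auto
    with False have c1: "card (pverts G) = 1" by linarith
    then have "pverts G = {Center}" using cV by (metis card_1_singletonE singletonD)
    moreover obtain u where "pverts H = {u}" using c1 card by (metis card_1_singletonE)
    ultimately show ?thesis using deg_only_vertex[OF G] deg_only_vertex[OF H] by simp
  next
    case True
    then have b1: "1 \<le> deg H v" if "v \<in> pverts H" for v using bound1[OF that] card by simp
    have sumG: "(\<Sum>v\<in>pverts G. f (deg G v)) = f d" if "f 1 = 0" "f 2 = 0" for f :: "nat \<Rightarrow> int"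
    proof -
      have "(\<Sum>v\<in>pverts G - {Center}. f (deg G v)) = 0" using d12 that by (intro sum.neutral) fastforce
      then show ?thesis using sum.remove[OF G'(1) cV, of "\<lambda>v. f (deg G v)"] dC by simp
    qed
    have M: "(\<Sum>v\<in>pverts H. (int (deg H v) - 1) * (int (deg H v) - 2)) = (int d - 1) * (int d - 2)"
      using poly(1) sumG[of "\<lambda>k. (int k - 1) * (int k - 2)"] by simp
    have C: "(\<Sum>v\<in>pverts H. (int (deg H v) - 1) * (int (deg H v) - 2) * (int (deg H v) - 3)) - int (card (triangles H))
      = (int d - 1) * (int d - 2) * (int d - 3) - int (card (triangles G))"
      using poly(2) sumG[of "\<lambda>k. (int k - 1) * (int k - 2) * (int k - 3)"] by simp
    show ?thesis
    proof (cases "d \<le> 2")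
      case d2: True
      \<comment> \<open>Degree 0 would leave the center alone. With \<open>d\<close> equal to 1 or 2
        the quadratic sum vanishes, and its nonnegative terms force the degrees of H into
        \<open>{1, 2}\<close>.\<close>
      have "d \<noteq> 0"
      proof
        assume "d = 0"
        then have "pverts G = {Center}"
          unfolding G_def d_def by (intro Set.set_eqI, rename_tac v, case_tac v) (auto simp: pverts_path_friendship_graph)
        with True show False by simp
      qed
      with d2 have d': "d \<in> {1, 2}" by auto
      then have "(\<Sum>v\<in>pverts H. (int (deg H v) - 1) * (int (deg H v) - 2)) = 0" using M by auto
      then have "\<forall>v\<in>pverts H. (int (deg H v) - 1) * (int (deg H v) - 2) = 0"
        by (subst (asm) sum_nonneg_eq_0_iff) (auto simp: H'(1) degree_polynomial_nonneg)
      then have "deg H v \<in> {1, 2}" if "v \<in> pverts H" for v using that degree_polynomial_eq_0 by blast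
      moreover have "deg G v \<in> {1, 2}" if "v \<in> pverts G" for v
        using d12[OF that] dC d' by (cases "v = Center") simp_all
      ultimately show ?thesis using H'(1) G'(1) card poly(3) by (intro degree_mset_eq) simp_all
    next
      case False
      have neH: "pverts H \<noteq> {}" using True card by auto
      obtain w where w: "w \<in> pverts H" and maxw: "\<And>v. v \<in> pverts H \<Longrightarrow> deg H v \<le> deg H w"
      proof -
        have "Max (deg H ` pverts H) \<in> deg H ` pverts H" using H'(1) neH by (intro Max_in) auto
        then obtain w where "w \<in> pverts H" "deg H w = Max (deg H ` pverts H)" by (metis imageE)
        then show ?thesis using that[of w] H'(1) by simp
      qed
      \<comment> \<open>If \<open>w\<close> has degree at most 3, maximality bounds the others; if
        not, \<open>w\<close> is the one vertex of degree at least 4.\<close>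
      have b3: "deg H v \<le> 3" if "v \<in> pverts H" "v \<noteq> w" for v
        using bound3[OF w that(1)] maxw[OF that(1)] that(2) by (cases "4 \<le> deg H w") auto
      have ge: "d \<le> deg H w"
      proof (rule ccontr)
        assume "\<not> d \<le> deg H w"
        then show False
          using cospectral_pf_no_smaller_max_degree[OF H co[unfolded G_def] w maxw b1 b3]
            False M C unfolding d_def G_def by simp
      qed
      \<comment> \<open>The cubic argument bounds the degree of \<open>w\<close> from below;
        nonnegativity of \<open>r\<close> bounds it from above, since the quadratic is strictly
        increasing beyond 2. Equality leaves \<open>r = 0\<close>, so the other degrees are 1 or
        2.\<close>
      define r where "r = (\<Sum>v\<in>pverts H - {w}. (int (deg H v) - 1) * (int (deg H v) - 2))"
      have r0: "r \<ge> 0" unfolding r_def by (intro sum_nonneg degree_polynomial_nonneg)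
      have Mr: "(int (deg H w) - 1) * (int (deg H w) - 2) + r = (int d - 1) * (int d - 2)"
        using M sum.remove[OF H'(1) w, of "\<lambda>v. (int (deg H v) - 1) * (int (deg H v) - 2)"] by (simp add: r_def)
      have eq: "deg H w = d"
      proof (rule ccontr)
        assume "deg H w \<noteq> d"
        with ge have "int d + 1 \<le> int (deg H w)" by simp
        then have "int d * (int d - 1) \<le> (int (deg H w) - 1) * (int (deg H w) - 2)"
          using False by (intro mult_mono) auto
        moreover have "(int d - 1) * (int d - 2) < int d * (int d - 1)" using False by (simp add: algebra_simps)
        ultimately show False using Mr r0 by linarith
      qed
      then have "r = 0" using Mr by simp
      then have "\<forall>v\<in>pverts H - {w}. (int (deg H v) - 1) * (int (deg H v) - 2) = 0"
        unfolding r_def by (subst (asm) sum_nonneg_eq_0_iff) (auto simp: H'(1) degree_polynomial_nonneg)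
      then have h12: "deg H v \<in> {1, 2}" if "v \<in> pverts H - {w}" for v using that degree_polynomial_eq_0 by blast
      have "sum (deg H) (pverts H - {w}) = sum (deg G) (pverts G - {Center})"
        using poly(3) sum.remove[OF H'(1) w, of "deg H"] sum.remove[OF G'(1) cV, of "deg G"] eq dC by simp
      then have "image_mset (deg H) (mset_set (pverts H - {w})) = image_mset (deg G) (mset_set (pverts G - {Center}))"
        using H'(1) G'(1) card w cV h12 d12 by (intro degree_mset_eq) auto
      then show ?thesis
        using degree_mset_remove[OF H'(1) w, of "deg H"] degree_mset_remove[OF G'(1) cV, of "deg G"] eq dC by simp
    qed
  qed
  then show ?thesis by (simp add: degree_sequence_def)
qed

theorem theorem3p5:
  fixes s k :: nat
    and G :: "'a pair_pre_digraph"
    and H :: "'b pair_pre_digraph"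
  assumes "pair_graph G"
    and "is_path_friendship s k G"
    and "pair_graph H"
    and "L_cospectral H G"
  shows "degree_sequence H = degree_sequence G"
proof -
  obtain ls where ls: "\<forall>l\<in>set ls. 1 \<le> l"
    and iso: "digraph_iso (with_proj (path_friendship_graph s ls)) (with_proj G)"
    using assms(2) by (auto simp: is_path_friendship_def)
  note iso' = isomorphic_spectrum_degrees[OF pair_graph_path_friendship_graph iso]
  have "L_cospectral H (path_friendship_graph s ls)"
    using assms(4) iso'(1) by (simp add: L_cospectral_def)
  from cospectral_pf_degree_sequence[OF ls assms(3) this] show ?thesis by (simp add: iso'(2))
qed

end
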